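(* Assume the standing setting described in the context (with $J=I$) and let $\boldsymbol\gamma=(\gamma^i)_{i\in I}\in\mathfrak E_\chi(\boldsymbol A,\boldsymbol a,g)$ be an extremal measure. Then $$\sum_{i\in I}\int W^i_{\boldsymbol\gamma}\,d\gamma^i=\frac12\Bigl[\|\boldsymbol\gamma\|^2_{\mathcal E^+(\boldsymbol A)}+G_\chi(\boldsymbol A,\boldsymbol a,g)\Bigr]$$ and, for every $i\in I$, $$a_i\,W^i_{\boldsymbol\gamma}(x)\ge\Bigl(\int W^i_{\boldsymbol\gamma}\,d\gamma^i\Bigr)\,g(x)\quad\text{for n.e. }x\in A_i.$$ Moreover, these two relations characterize the numbers $\int W^i_{\boldsymbol\gamma}\,d\gamma^i$, $i\in I$, uniquely: if real numbers $\eta_i$, $i\in I$, satisfy $\sum_{i\in I}\eta_i=\frac12[\|\boldsymbol\gamma\|^2_{\mathcal E^+(\boldsymbol A)}+G_\chi(\boldsymbol A,\boldsymbol a,g)]$ and $a_iW^i_{\boldsymbol\gamma}(x)\ge\eta_i g(x)$ for n.e. $x\in A_i$, for all $i\in I$, then $\eta_i=\int W^i_{\boldsymbol\gamma}\,d\gamma^i$ for all $i\in I$.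
   Context: Standing setting. $\mathrm X$ noncompact locally compact Hausdorff; $\mathfrak M$ real Radon measures, vague topology; $S(\nu)$ support. Kernel $\kappa:\mathrm X\times\mathrm X\to[0,\infty]$ lower semicontinuous, symmetric; $\kappa(\nu,\nu_1)=\int\kappa\,d(\nu\otimes\nu_1)$, $\kappa(x,\nu)=\int\kappa(x,y)d\nu(y)$; $\mathcal E$ = measures with $\kappa(\nu,\nu)$ well defined and finite. Assumed: (a) strictly positive definite ($\|\nu\|=\kappa(\nu,\nu)^{1/2}$ a norm on the pre-Hilbert space $\mathcal E$; "strong" refers to it); (b) consistent: every strong Cauchy net in $\mathcal E^+=\{\nu\in\mathcal E:\nu\ge0\}$ converges strongly to each of its vague cluster points; (c) $\kappa(x,y)$ finite, continuous for $x\ne y$; (d) for each $\varepsilon>0$, compact $K$ there is compact $K'$ with $\kappa(x,y)<\varepsilon$ for $x\in K,y\notin K'$; (e) generalized maximum principle with constant $h\ge1$ (for compactly supported $\nu\ge0$ with $M=\sup_{S(\nu)}\kappa(\cdot,\nu)<\infty$, $\kappa(\cdot,\nu)\le hM$ everywhere). $\mathcal E^+_E$: elements of $\mathcal E^+$ concentrated on $E$; interior capacity $C(E)=1/\inf\{\kappa(\nu,\nu):\nu\in\mathcal E^+_E,\nu(E)=1\}$; "n.e." = outside a set of interior capacity zero. Condenser: disjoint countable $I^+,I^-$, $I=I^+\cup I^-$; nonempty closed $A_i$, locally finite, $A_i\cap A_j=\varnothing$ for $i\in I^+,j\in I^-$; $\alpha_i=\pm1$ on $I^\pm$; $A^\pm=\bigcup_{I^\pm}A_i$,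 $A=\bigcup A_i$; $\sup_{A^+\times A^-}\kappa<\infty$. Vector measures $\boldsymbol\mu=(\mu^i)$, $\mu^i\ge0$ concentrated on $A_i$; $R\boldsymbol\mu=\sum\alpha_i\mu^i$; $\mathcal E^+(\boldsymbol A)$ those of finite energy $\sum_{i,j}\alpha_i\alpha_j\kappa(\mu^i,\mu^j)$; $\|\boldsymbol\mu_1-\boldsymbol\mu_2\|_{\mathcal E^+(\boldsymbol A)}:=\|R\boldsymbol\mu_1-R\boldsymbol\mu_2\|$ (strong topology on $\mathcal E^+(\boldsymbol A)$); vague topology on vector measures is componentwise. External field: bounded signed $\chi\in\mathcal E$ with $S(\chi^+)\cap A^-=\varnothing$, $S(\chi^-)\cap A^+=\varnothing$; $G_\chi(\boldsymbol\mu)=\|R\boldsymbol\mu\|^2+2\kappa(\chi,R\boldsymbol\mu)$. The weighted potential of $\boldsymbol\mu\in\mathcal E^+(\boldsymbol A)$ has components $W^i_{\boldsymbol\mu}(x)=\alpha_i\kappa(x,\chi)+\sum_{j}\alpha_i\alpha_j\kappa(x,\mu^j)=\alpha_i\kappa(x,\chi+R\boldsymbol\mu)$ (finite n.e.). $g$ continuous on $A$, $g_{\inf}=\inf_Ag>0$, and for each $i$ either $g|_{A_i}$ bounded or $g^{r_i}\le\kappa(\cdot,\nu_i)$ n.e. on $A_i$ for some $r_i>1,\nu_i\in\mathcal E$. $\boldsymbol a=(a_i)$, $a_i>0$, $\sum a_i<\infty$. For $I^+\subseteq J\subseteq I$: $\mathcal E^+(\boldsymbol A,\boldsymbol a,g,J)=\{\boldsymbol\mu\in\mathcal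 E^+(\boldsymbol A):\int g\,d\mu^i=a_i\ \forall i\in J\}$, $G_\chi(\boldsymbol A,\boldsymbol a,g,J)$ = infimum of $G_\chi$ on it; $J=I$ is dropped from notation; assumed $G_\chi(\boldsymbol A,\boldsymbol a,g)<\infty$. Extremal measures: let $H:=h[\chi^+(\mathrm X)+2g_{\inf}^{-1}\sum_{i\in J}a_i]$. A net $(\boldsymbol\mu_s)$ is minimizing for the $J$-problem if each $\boldsymbol\mu_s\in\mathcal E^+(\boldsymbol A,\boldsymbol a,g,J)$ with $\sum_i\mu^i_s(\mathrm X)\le H$, and $G_\chi(\boldsymbol\mu_s)\to G_\chi(\boldsymbol A,\boldsymbol a,g,J)$. $\tilde{\boldsymbol\gamma}\in\mathcal E^+(\boldsymbol A)$ is extremal if some minimizing net converges to it both strongly and vaguely; $\mathfrak E_\chi(\boldsymbol A,\boldsymbol a,g,J)$ is the set of extremal measures. *)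

theory Defs
  imports "HOL-Probability.Probability"
begin

text \<open>Positive Radon measures are represented as Borel measures (on the whole type)
that are finite on compact sets, outer regular on Borel sets and inner regular
(by compact sets) on open sets.  A real (signed) Radon measure is represented by a
pair (P, N) of positive Radon measures, standing for P - N.\<close>

definition radon :: "'a::topological_space measure \<Rightarrow> bool" where
  "radon M \<longleftrightarrow> sets M = sets borel
     \<and> (\<forall>K. compact K \<longrightarrow> emeasure M K < \<infinity>)
     \<and> (\<forall>B\<in>sets borel. emeasure M B = (INF U\<in>{U. open U \<and> B \<subseteq> U}. emeasure M U))
     \<and> (\<forall>U. open U \<longrightarrow> emeasure M U = (SUP K\<in>{K. compact K \<and> K \<subseteq> U}. emeasure M K))"

definition supp :: "'a::topological_space measure \<Rightarrow> 'a set" where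
  "supp M = {x. \<forall>U. open U \<and> x \<in> U \<longrightarrow> emeasure M U > 0}"

definition concentrated :: "'a measure \<Rightarrow> 'a set \<Rightarrow> bool" where
  "concentrated M E \<longleftrightarrow> (\<exists>N\<in>null_sets M. UNIV - E \<subseteq> N)"

definition Cc :: "('a::topological_space \<Rightarrow> real) set" where
  "Cc = {f. continuous_on UNIV f \<and> (\<exists>K. compact K \<and> (\<forall>x. x \<notin> K \<longrightarrow> f x = 0))}"

definition pot :: "('a \<Rightarrow> 'a \<Rightarrow> ennreal) \<Rightarrow> 'a measure \<Rightarrow> 'a \<Rightarrow> ennreal" where
  "pot \<kappa> \<nu> x = (\<integral>\<^sup>+ y. \<kappa> x y \<partial>\<nu>)"

definition menergy :: "('a \<Rightarrow> 'a \<Rightarrow> ennreal) \<Rightarrow> 'a measure \<Rightarrow> 'a measure \<Rightarrow> ennreal" where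
  "menergy \<kappa> \<mu> \<nu> = (\<integral>\<^sup>+ x. pot \<kappa> \<nu> x \<partial>\<mu>)"

definition Eplus :: "('a::topological_space \<Rightarrow> 'a \<Rightarrow> ennreal) \<Rightarrow> 'a measure set" where
  "Eplus \<kappa> = {\<nu>. radon \<nu> \<and> menergy \<kappa> \<nu> \<nu> < \<infinity>}"

definition inE :: "('a::topological_space \<Rightarrow> 'a \<Rightarrow> ennreal) \<Rightarrow> 'a measure \<Rightarrow> 'a measure \<Rightarrow> bool" where
  "inE \<kappa> P N \<longleftrightarrow> radon P \<and> radon N \<and> menergy \<kappa> P P < \<infinity> \<and> menergy \<kappa> N N < \<infinity>
      \<and> menergy \<kappa> P N < \<infinity>"

definition senergy :: "('a \<Rightarrow> 'a \<Rightarrow> ennreal) \<Rightarrow> 'a measure \<Rightarrow> 'a measure \<Rightarrow> real" where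
  "senergy \<kappa> P N = enn2real (menergy \<kappa> P P) + enn2real (menergy \<kappa> N N)
      - 2 * enn2real (menergy \<kappa> P N)"

definition spot :: "('a \<Rightarrow> 'a \<Rightarrow> ennreal) \<Rightarrow> 'a measure \<Rightarrow> 'a measure \<Rightarrow> 'a \<Rightarrow> ereal" where
  "spot \<kappa> P N x = enn2ereal (pot \<kappa> P x) - enn2ereal (pot \<kappa> N x)"

definition sdist :: "('a \<Rightarrow> 'a \<Rightarrow> ennreal) \<Rightarrow> 'a measure \<Rightarrow> 'a measure \<Rightarrow> real" where
  "sdist \<kappa> \<mu> \<nu> = sqrt (enn2real (menergy \<kappa> \<mu> \<mu>) + enn2real (menergy \<kappa> \<nu> \<nu>)
      - 2 * enn2real (menergy \<kappa> \<mu> \<nu>))"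

definition icap :: "('a::topological_space \<Rightarrow> 'a \<Rightarrow> ennreal) \<Rightarrow> 'a set \<Rightarrow> ennreal" where
  "icap \<kappa> E = inverse (INF \<nu>\<in>{\<nu>. \<nu> \<in> Eplus \<kappa> \<and> concentrated \<nu> E \<and> emeasure \<nu> UNIV = 1}.
                            menergy \<kappa> \<nu> \<nu>)"

definition nearly_everywhere ::
    "('a::topological_space \<Rightarrow> 'a \<Rightarrow> ennreal) \<Rightarrow> 'a set \<Rightarrow> ('a \<Rightarrow> bool) \<Rightarrow> bool" where
  "nearly_everywhere \<kappa> S P \<longleftrightarrow> icap \<kappa> {x\<in>S. \<not> P x} = 0"

text \<open>A net is represented by its image filter.  Vague cluster point of a net of measures.\<close>
definition vague_cluster :: "'a::topological_space measure filter \<Rightarrow> 'a measure \<Rightarrow> bool" where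
  "vague_cluster F \<nu> \<longleftrightarrow> (\<forall>fs. finite fs \<and> fs \<subseteq> Cc \<longrightarrow>
      (\<forall>\<epsilon>>0. \<exists>\<^sub>F \<mu> in F. \<forall>f\<in>fs. \<bar>(\<integral>x. f x \<partial>\<mu>) - (\<integral>x. f x \<partial>\<nu>)\<bar> < \<epsilon>))"

definition strong_cauchy :: "('a \<Rightarrow> 'a \<Rightarrow> ennreal) \<Rightarrow> 'a measure filter \<Rightarrow> bool" where
  "strong_cauchy \<kappa> F \<longleftrightarrow> (\<forall>\<epsilon>>0. \<forall>\<^sub>F (\<mu>, \<nu>) in F \<times>\<^sub>F F. sdist \<kappa> \<mu> \<nu> < \<epsilon>)"

definition lsc :: "('b::topological_space \<Rightarrow> ennreal) \<Rightarrow> bool" where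
  "lsc f \<longleftrightarrow> (\<forall>p c. c < f p \<longrightarrow> (\<forall>\<^sub>F q in nhds p. c < f q))"

definition admissible_kernel :: "('a::t2_space \<Rightarrow> 'a \<Rightarrow> ennreal) \<Rightarrow> real \<Rightarrow> bool" where
  "admissible_kernel \<kappa> h \<longleftrightarrow>
     lsc (\<lambda>(x, y). \<kappa> x y) \<and> (\<forall>x y. \<kappa> x y = \<kappa> y x)
     \<comment> \<open>(a) strictly positive definite\<close>
   \<and> (\<forall>P N. inE \<kappa> P N \<longrightarrow> senergy \<kappa> P N \<ge> 0 \<and> (senergy \<kappa> P N = 0 \<longrightarrow> P = N))
     \<comment> \<open>(b) consistent\<close>
   \<and> (\<forall>F :: 'a measure filter. F \<noteq> bot \<longrightarrow> (\<forall>\<^sub>F \<mu> in F. \<mu> \<in> Eplus \<kappa>) \<longrightarrow> strong_cauchy \<kappa> F \<longrightarrow>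
        (\<forall>\<nu>. radon \<nu> \<longrightarrow> vague_cluster F \<nu> \<longrightarrow>
             \<nu> \<in> Eplus \<kappa> \<and> ((\<lambda>\<mu>. sdist \<kappa> \<mu> \<nu>) \<longlongrightarrow> 0) F))
     \<comment> \<open>(c) finite and continuous off the diagonal\<close>
   \<and> (\<forall>x y. x \<noteq> y \<longrightarrow> \<kappa> x y < \<infinity>)
   \<and> continuous_on {p. fst p \<noteq> snd p} (\<lambda>(x, y). \<kappa> x y)
     \<comment> \<open>(d)\<close>
   \<and> (\<forall>\<epsilon>>0. \<forall>K. compact K \<longrightarrow> (\<exists>K'. compact K' \<and>
        (\<forall>x\<in>K. \<forall>y. y \<notin> K' \<longrightarrow> \<kappa> x y < ennreal \<epsilon>)))
     \<comment> \<open>(e) generalized maximum principle with constant h \<ge> 1\<close>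
   \<and> h \<ge> 1
   \<and> (\<forall>\<nu>. radon \<nu> \<and> compact (supp \<nu>) \<longrightarrow>
        (SUP x\<in>supp \<nu>. pot \<kappa> \<nu> x) < \<infinity> \<longrightarrow>
        (\<forall>x. pot \<kappa> \<nu> x \<le> ennreal h * (SUP x\<in>supp \<nu>. pot \<kappa> \<nu> x)))"

definition alpha :: "'i set \<Rightarrow> 'i \<Rightarrow> real" where
  "alpha Ip i = (if i \<in> Ip then 1 else -1)"

definition condenser ::
    "('a::topological_space \<Rightarrow> 'a \<Rightarrow> ennreal) \<Rightarrow> 'i set \<Rightarrow> 'i set \<Rightarrow> ('i \<Rightarrow> 'a set) \<Rightarrow> bool" where
  "condenser \<kappa> Ip In A \<longleftrightarrow>
     countable (Ip \<union> In) \<and> Ip \<inter> In = {}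
   \<and> (\<forall>i\<in>Ip \<union> In. closed (A i) \<and> A i \<noteq> {})
   \<and> (\<forall>x. \<exists>U. open U \<and> x \<in> U \<and> finite {i\<in>Ip \<union> In. A i \<inter> U \<noteq> {}})
   \<and> (\<forall>i\<in>Ip. \<forall>j\<in>In. A i \<inter> A j = {})
   \<and> (SUP p\<in>(\<Union>i\<in>Ip. A i) \<times> (\<Union>j\<in>In. A j). \<kappa> (fst p) (snd p)) < \<infinity>"

definition blockE ::
    "('a \<Rightarrow> 'a \<Rightarrow> ennreal) \<Rightarrow> 'i set \<Rightarrow> 'i set \<Rightarrow> ('i \<Rightarrow> 'a measure) \<Rightarrow> ('i \<Rightarrow> 'a measure) \<Rightarrow> ennreal" where
  "blockE \<kappa> S T \<mu> \<nu> = (\<Sum>\<^sub>\<infinity>(i, j)\<in>S \<times> T. menergy \<kappa> (\<mu> i) (\<nu> j))"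

text \<open>Mutual energy kappa(R mu, R nu) = sum_{i,j} alpha_i alpha_j kappa(mu^i, nu^j).\<close>
definition vmut ::
    "('a \<Rightarrow> 'a \<Rightarrow> ennreal) \<Rightarrow> 'i set \<Rightarrow> 'i set \<Rightarrow> ('i \<Rightarrow> 'a measure) \<Rightarrow> ('i \<Rightarrow> 'a measure) \<Rightarrow> real" where
  "vmut \<kappa> Ip In \<mu> \<nu> = enn2real (blockE \<kappa> Ip Ip \<mu> \<nu>) + enn2real (blockE \<kappa> In In \<mu> \<nu>)
      - enn2real (blockE \<kappa> Ip In \<mu> \<nu>) - enn2real (blockE \<kappa> In Ip \<mu> \<nu>)"

definition EplusA ::
    "('a::topological_space \<Rightarrow> 'a \<Rightarrow> ennreal) \<Rightarrow> 'i set \<Rightarrow> 'i set \<Rightarrow> ('i \<Rightarrow> 'a set) \<Rightarrow> ('i \<Rightarrow> 'a measure) set" where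
  "EplusA \<kappa> Ip In A = {\<mu>. (\<forall>i\<in>Ip \<union> In. radon (\<mu> i) \<and> concentrated (\<mu> i) (A i))
      \<and> blockE \<kappa> Ip Ip \<mu> \<mu> < \<infinity> \<and> blockE \<kappa> In In \<mu> \<mu> < \<infinity> \<and> blockE \<kappa> Ip In \<mu> \<mu> < \<infinity>}"

definition vnorm2 :: "('a \<Rightarrow> 'a \<Rightarrow> ennreal) \<Rightarrow> 'i set \<Rightarrow> 'i set \<Rightarrow> ('i \<Rightarrow> 'a measure) \<Rightarrow> real" where
  "vnorm2 \<kappa> Ip In \<mu> = vmut \<kappa> Ip In \<mu> \<mu>"

definition vdist ::
    "('a \<Rightarrow> 'a \<Rightarrow> ennreal) \<Rightarrow> 'i set \<Rightarrow> 'i set \<Rightarrow> ('i \<Rightarrow> 'a measure) \<Rightarrow> ('i \<Rightarrow> 'a measure) \<Rightarrow> real" where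
  "vdist \<kappa> Ip In \<mu> \<nu> = sqrt (vmut \<kappa> Ip In \<mu> \<mu> - 2 * vmut \<kappa> Ip In \<mu> \<nu> + vmut \<kappa> Ip In \<nu> \<nu>)"

text \<open>chi = chiP - chiN is a bounded signed Radon measure in E (chiP, chiN its mutually singular
positive and negative parts), with S(chi^+) \<inter> A^- = {} and S(chi^-) \<inter> A^+ = {}.\<close>
definition external_field ::
    "('a::topological_space \<Rightarrow> 'a \<Rightarrow> ennreal) \<Rightarrow> 'i set \<Rightarrow> 'i set \<Rightarrow> ('i \<Rightarrow> 'a set)
       \<Rightarrow> 'a measure \<Rightarrow> 'a measure \<Rightarrow> bool" where
  "external_field \<kappa> Ip In A chiP chiN \<longleftrightarrow>
     inE \<kappa> chiP chiN
   \<and> emeasure chiP UNIV < \<infinity> \<and> emeasure chiN UNIV < \<infinity>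
   \<and> (\<exists>B\<in>sets borel. emeasure chiP (UNIV - B) = 0 \<and> emeasure chiN B = 0)
   \<and> supp chiP \<inter> (\<Union>j\<in>In. A j) = {} \<and> supp chiN \<inter> (\<Union>i\<in>Ip. A i) = {}"

text \<open>kappa(chi, R mu) = sum_i alpha_i (kappa(chi^+, mu^i) - kappa(chi^-, mu^i)).\<close>
definition chimut ::
    "('a \<Rightarrow> 'a \<Rightarrow> ennreal) \<Rightarrow> 'i set \<Rightarrow> 'i set \<Rightarrow> 'a measure \<Rightarrow> 'a measure \<Rightarrow> ('i \<Rightarrow> 'a measure) \<Rightarrow> real" where
  "chimut \<kappa> Ip In chiP chiN \<mu> =
      enn2real (\<Sum>\<^sub>\<infinity>i\<in>Ip. menergy \<kappa> chiP (\<mu> i)) - enn2real (\<Sum>\<^sub>\<infinity>i\<in>Ip. menergy \<kappa> chiN (\<mu> i))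
    - enn2real (\<Sum>\<^sub>\<infinity>i\<in>In. menergy \<kappa> chiP (\<mu> i)) + enn2real (\<Sum>\<^sub>\<infinity>i\<in>In. menergy \<kappa> chiN (\<mu> i))"

definition Gchi ::
    "('a \<Rightarrow> 'a \<Rightarrow> ennreal) \<Rightarrow> 'i set \<Rightarrow> 'i set \<Rightarrow> 'a measure \<Rightarrow> 'a measure \<Rightarrow> ('i \<Rightarrow> 'a measure) \<Rightarrow> real" where
  "Gchi \<kappa> Ip In chiP chiN \<mu> = vnorm2 \<kappa> Ip In \<mu> + 2 * chimut \<kappa> Ip In chiP chiN \<mu>"

definition EplusAag ::
    "('a::topological_space \<Rightarrow> 'a \<Rightarrow> ennreal) \<Rightarrow> 'i set \<Rightarrow> 'i set \<Rightarrow> ('i \<Rightarrow> 'a set) \<Rightarrow> ('i \<Rightarrow> real)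
       \<Rightarrow> ('a \<Rightarrow> real) \<Rightarrow> 'i set \<Rightarrow> ('i \<Rightarrow> 'a measure) set" where
  "EplusAag \<kappa> Ip In A a g J = {\<mu>\<in>EplusA \<kappa> Ip In A. \<forall>i\<in>J. (\<integral>\<^sup>+ x. ennreal (g x) \<partial>(\<mu> i)) = ennreal (a i)}"

text \<open>G_chi(A, a, g, J) = inf of G_chi over E^+(A, a, g, J) (extended real; +\<infinity> if empty).\<close>
definition Ginf ::
    "('a::topological_space \<Rightarrow> 'a \<Rightarrow> ennreal) \<Rightarrow> 'i set \<Rightarrow> 'i set \<Rightarrow> ('i \<Rightarrow> 'a set) \<Rightarrow> 'a measure \<Rightarrow> 'a measure
       \<Rightarrow> ('i \<Rightarrow> real) \<Rightarrow> ('a \<Rightarrow> real) \<Rightarrow> 'i set \<Rightarrow> ereal" where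
  "Ginf \<kappa> Ip In A chiP chiN a g J =
     (INF \<mu>\<in>EplusAag \<kappa> Ip In A a g J. ereal (Gchi \<kappa> Ip In chiP chiN \<mu>))"

definition Hconst ::
    "real \<Rightarrow> 'i set \<Rightarrow> ('i \<Rightarrow> 'a set) \<Rightarrow> 'a measure \<Rightarrow> ('i \<Rightarrow> real) \<Rightarrow> ('a \<Rightarrow> real) \<Rightarrow> 'i set \<Rightarrow> real" where
  "Hconst h I A chiP a g J =
     h * (measure chiP UNIV + 2 / (INF x\<in>(\<Union>i\<in>I. A i). g x) * (\<Sum>\<^sub>\<infinity>i\<in>J. a i))"

text \<open>Extremal measures: limits, both strongly and vaguely, of minimizing nets
(a net is represented by its image filter on vector measures).\<close>
definition extremal ::
    "('a::topological_space \<Rightarrow> 'a \<Rightarrow> ennreal) \<Rightarrow> real \<Rightarrow> 'i set \<Rightarrow> 'i set \<Rightarrow> ('i \<Rightarrow> 'a set) \<Rightarrow> 'a measure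
       \<Rightarrow> 'a measure \<Rightarrow> ('i \<Rightarrow> real) \<Rightarrow> ('a \<Rightarrow> real) \<Rightarrow> 'i set \<Rightarrow> ('i \<Rightarrow> 'a measure) set" where
  "extremal \<kappa> h Ip In A chiP chiN a g J = {\<gamma>\<in>EplusA \<kappa> Ip In A.
     \<exists>F :: ('i \<Rightarrow> 'a measure) filter. F \<noteq> bot
       \<and> (\<forall>\<^sub>F \<mu> in F. \<mu> \<in> EplusAag \<kappa> Ip In A a g J
            \<and> (\<Sum>\<^sub>\<infinity>i\<in>Ip \<union> In. emeasure (\<mu> i) UNIV) \<le> ennreal (Hconst h (Ip \<union> In) A chiP a g J))
       \<and> ((\<lambda>\<mu>. ereal (Gchi \<kappa> Ip In chiP chiN \<mu>)) \<longlongrightarrow> Ginf \<kappa> Ip In A chiP chiN a g J) F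
       \<and> ((\<lambda>\<mu>. vdist \<kappa> Ip In \<mu> \<gamma>) \<longlongrightarrow> 0) F
       \<and> (\<forall>i\<in>Ip \<union> In. \<forall>f\<in>Cc. ((\<lambda>\<mu>. \<integral>x. f x \<partial>(\<mu> i)) \<longlongrightarrow> (\<integral>x. f x \<partial>(\<gamma> i))) F)}"

text \<open>Weighted potential W^i_mu(x) = alpha_i kappa(x, chi + R mu).\<close>
definition Wpot ::
    "('a \<Rightarrow> 'a \<Rightarrow> ennreal) \<Rightarrow> 'i set \<Rightarrow> 'i set \<Rightarrow> 'a measure \<Rightarrow> 'a measure \<Rightarrow> ('i \<Rightarrow> 'a measure)
       \<Rightarrow> 'i \<Rightarrow> 'a \<Rightarrow> ereal" where
  "Wpot \<kappa> Ip In chiP chiN \<mu> i x = ereal (alpha Ip i) *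
     (enn2ereal (pot \<kappa> chiP x + (\<Sum>\<^sub>\<infinity>j\<in>Ip. pot \<kappa> (\<mu> j) x))
      - enn2ereal (pot \<kappa> chiN x + (\<Sum>\<^sub>\<infinity>j\<in>In. pot \<kappa> (\<mu> j) x)))"

definition intW ::
    "('a \<Rightarrow> 'a \<Rightarrow> ennreal) \<Rightarrow> 'i set \<Rightarrow> 'i set \<Rightarrow> 'a measure \<Rightarrow> 'a measure \<Rightarrow> ('i \<Rightarrow> 'a measure) \<Rightarrow> 'i \<Rightarrow> real" where
  "intW \<kappa> Ip In chiP chiN \<mu> i = (\<integral>x. real_of_ereal (Wpot \<kappa> Ip In chiP chiN \<mu> i x) \<partial>(\<mu> i))"

definition admissible_g ::
    "('a::topological_space \<Rightarrow> 'a \<Rightarrow> ennreal) \<Rightarrow> 'i set \<Rightarrow> ('i \<Rightarrow> 'a set) \<Rightarrow> ('a \<Rightarrow> real) \<Rightarrow> bool" where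
  "admissible_g \<kappa> I A g \<longleftrightarrow>
     continuous_on (\<Union>i\<in>I. A i) g
   \<and> (\<exists>c>0. \<forall>x\<in>(\<Union>i\<in>I. A i). c \<le> g x)
   \<and> (\<forall>i\<in>I. bounded (g ` A i)
        \<or> (\<exists>r>1. \<exists>P N. inE \<kappa> P N \<and>
              nearly_everywhere \<kappa> (A i) (\<lambda>x. ereal (g x powr r) \<le> spot \<kappa> P N x)))"

end

theory Submission
  imports Defs
begin

text \<open>
  The constraints force every component of an admissible vector measure to have mass at most
  \<open>a i / c\<close>, where \<open>c\<close> is a positive lower bound of \<open>g\<close>, so all measures in play are finite. Since the
  kernel is bounded on \<open>A\<^sup>+ \<times> A\<^sup>-\<close>, the components of a strongly convergent minimizing net have bounded
  energy; by consistency, energy-bounded nets that converge vaguely also converge weakly, so that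
  \<open>\<integral> W\<^sup>i d\<mu>\<^sup>i \<rightarrow> \<integral> W\<^sup>i d\<gamma>\<^sup>i\<close> along the net although the limit \<open>\<gamma>\<close> itself may violate the constraints.
  Strong continuity of \<open>G\<close> gives \<open>G(\<gamma>) = inf G\<close> and hence the value of the sum. Replacing \<open>\<mu>\<^sup>i\<close> by
  \<open>(1 - t) \<mu>\<^sup>i + t \<nu>\<close>, passing to the limit along the net and then \<open>t \<rightarrow> 0\<close> yields
  \<open>\<integral> W\<^sup>i d\<nu> \<ge> \<integral> W\<^sup>i d\<gamma>\<^sup>i\<close> for all admissible \<open>\<nu>\<close> on \<open>A i\<close>, which is the inequality nearly everywhere.
  Conversely any \<open>\<eta>\<close> with \<open>a i W\<^sup>i \<ge> \<eta> i g\<close> nearly everywhere satisfies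
  \<open>\<eta> i \<le> \<integral> W\<^sup>i d\<mu>\<^sup>i\<close> along the net, hence \<open>\<eta> i \<le> \<integral> W\<^sup>i d\<gamma>\<^sup>i\<close>, and equality of the sums forces
  equality of the terms.
\<close>

section \<open>Sums over countable index sets\<close>

lemma nn_integral_count_space_eq_suminf:
  fixes f :: "'i \<Rightarrow> ennreal"
  assumes S: "countable S"
  shows "(\<integral>\<^sup>+ i. f i \<partial>count_space S)
    = (\<Sum>n. f (from_nat_into S n) * indicator (to_nat_on S ` S) n)"
proof -
  have "(\<integral>\<^sup>+ i. f i \<partial>count_space S) = (\<integral>\<^sup>+ i. f (from_nat_into S (to_nat_on S i)) \<partial>count_space S)"
    using S by (intro nn_integral_cong) simp
  also have "\<dots> = (\<integral>\<^sup>+ n. f (from_nat_into S n) \<partial>count_space (to_nat_on S ` S))"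
    using S by (intro nn_integral_bij_count_space) (simp add: bij_betw_def inj_on_to_nat_on)
  also have "\<dots> = (\<integral>\<^sup>+ n. f (from_nat_into S n) * indicator (to_nat_on S ` S) n \<partial>count_space UNIV)"
    by (rule nn_integral_count_space_indicator) simp
  finally show ?thesis by (simp add: nn_integral_count_space_nat)
qed

lemma nn_integral_count_space_SUP_directed:
  fixes f :: "'k \<Rightarrow> 'i \<Rightarrow> ennreal"
  assumes S: "countable S"
    and directed: "\<And>k l. k \<in> I \<Longrightarrow> l \<in> I \<Longrightarrow> \<exists>m\<in>I. \<forall>i\<in>S. f k i \<le> f m i \<and> f l i \<le> f m i"
  shows "(\<integral>\<^sup>+ i. (SUP k\<in>I. f k i) \<partial>count_space S) = (SUP k\<in>I. \<integral>\<^sup>+ i. f k i \<partial>count_space S)"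
proof -
  let ?f = "\<lambda>k n. f k (from_nat_into S n) * indicator (to_nat_on S ` S) n"
  have "(\<Sum>n. SUP k\<in>I. ?f k n) = (SUP k\<in>I. \<Sum>n. ?f k n)"
  proof (rule ennreal_suminf_SUP_eq_directed)
    fix N :: "nat set" and k l assume "k \<in> I" "l \<in> I"
    then obtain m where m: "m \<in> I" "\<forall>i\<in>S. f k i \<le> f m i \<and> f l i \<le> f m i"
      using directed by blast
    have "?f k n \<le> ?f m n \<and> ?f l n \<le> ?f m n" for n
      using m(2) S by (auto split: split_indicator)
    with m(1) show "\<exists>m\<in>I. \<forall>n\<in>N. ?f k n \<le> ?f m n \<and> ?f l n \<le> ?f m n" by blast
  qed
  then show ?thesis
    by (simp add: nn_integral_count_space_eq_suminf[OF S] SUP_mult_right_ennreal)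
qed

lemma infsum_eq_nn_integral_count_space:
  fixes f :: "'i \<Rightarrow> ennreal"
  assumes S: "countable S"
  shows "infsum f S = (\<integral>\<^sup>+ i. f i \<partial>count_space S)"
proof -
  let ?I = "{F. finite F \<and> F \<subseteq> S}"
  have "(\<integral>\<^sup>+ i. f i \<partial>count_space S) = (\<integral>\<^sup>+ i. (SUP F\<in>?I. f i * indicator F i) \<partial>count_space S)"
  proof (rule nn_integral_cong, rule antisym)
    fix i assume "i \<in> space (count_space S)"
    then show "f i \<le> (SUP F\<in>?I. f i * indicator F i)"
      by (intro SUP_upper2[of "{i}"]) auto
  qed (auto intro!: SUP_least split: split_indicator)
  also have "\<dots> = (SUP F\<in>?I. \<integral>\<^sup>+ i. f i * indicator F i \<partial>count_space S)"
  proof (rule nn_integral_count_space_SUP_directed[OF S])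
    fix F G assume "F \<in> ?I" "G \<in> ?I"
    then show "\<exists>H\<in>?I. \<forall>i\<in>S. f i * indicator F i \<le> f i * indicator H i
        \<and> f i * indicator G i \<le> f i * indicator H i"
      by (intro bexI[of _ "F \<union> G"]) (auto split: split_indicator)
  qed
  also have "\<dots> = (SUP F\<in>?I. sum f F)"
  proof (intro SUP_cong refl)
    fix F assume "F \<in> ?I"
    then show "(\<integral>\<^sup>+ i. f i * indicator F i \<partial>count_space S) = sum f F"
      by (subst nn_integral_count_space'[where A = F]) (auto simp: indicator_def intro!: sum.cong)
  qed
  also have "\<dots> = infsum f S"
    by (rule nonneg_infsum_complete[symmetric]) simp
  finally show ?thesis ..
qed

lemma has_sum_iff_nn_integral_count_space:
  fixes f :: "'i \<Rightarrow> real"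
  assumes f: "\<And>i. i \<in> S \<Longrightarrow> 0 \<le> f i" and r: "0 \<le> r"
  shows "(f has_sum r) S \<longleftrightarrow> (\<integral>\<^sup>+ i. ennreal (f i) \<partial>count_space S) = ennreal r"
proof -
  have summable_iff: "f summable_on S \<longleftrightarrow> integrable (count_space S) f"
    by (metis summable_on_iff_abs_summable_on_real abs_summable_equivalent
        Infinite_Set_Sum.abs_summable_on_def)
  have nn_integral: "(\<integral>\<^sup>+ i. ennreal (f i) \<partial>count_space S) = ennreal (infsum f S)" if "f summable_on S"
    using that f nn_integral_conv_infsetsum[of f S] infsetsum_infsum[of f S]
    unfolding summable_iff Infinite_Set_Sum.abs_summable_on_def by simp
  have nonneg: "0 \<le> infsum f S"
    using f by (rule infsum_nonneg)
  show ?thesis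
  proof
    assume "(f has_sum r) S"
    then show "(\<integral>\<^sup>+ i. ennreal (f i) \<partial>count_space S) = ennreal r"
      using nn_integral by (auto simp: summable_on_def dest: infsumI)
  next
    assume eq: "(\<integral>\<^sup>+ i. ennreal (f i) \<partial>count_space S) = ennreal r"
    have "f summable_on S"
      unfolding summable_iff using eq f by (intro integrableI_nonneg) (auto simp: AE_count_space)
    then show "(f has_sum r) S"
      using eq nn_integral r nonneg by (metis ennreal_inj has_sum_infsum)
  qed
qed

lemma has_sum_diff:
  fixes f g :: "'i \<Rightarrow> 'b::topological_ab_group_add"
  assumes "(f has_sum s) S" "(g has_sum t) S"
  shows "((\<lambda>i. f i - g i) has_sum (s - t)) S"
  using has_sum_add[OF assms(1), of "\<lambda>i. - g i" "- t"] assms(2) by (simp add: has_sum_uminus)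

section \<open>Finite Radon measures\<close>

definition finite_radon :: "'a::t2_space measure \<Rightarrow> bool" where
  "finite_radon M \<longleftrightarrow> radon M \<and> emeasure M UNIV < \<infinity>"

lemma finite_radon_sets: "finite_radon M \<Longrightarrow> sets M = sets borel"
  by (simp add: finite_radon_def radon_def)

lemma finite_radon_space: "finite_radon M \<Longrightarrow> space M = UNIV"
  using sets_eq_imp_space_eq[of M borel] by (simp add: finite_radon_sets)

lemma finite_radon_finite_measure: "finite_radon M \<Longrightarrow> finite_measure M"
  by (rule finite_measureI) (auto simp: finite_radon_space finite_radon_def)

lemma borel_measurable_finite_radon:
  "finite_radon M \<Longrightarrow> f \<in> borel_measurable M \<longleftrightarrow> f \<in> borel_measurable borel"
  by (simp add: finite_radon_sets cong: measurable_cong_sets)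

lemma AE_mem_iff_emeasure_Compl:
  assumes "sets M = sets borel" "B \<in> sets borel"
  shows "(AE x in M. x \<in> B) \<longleftrightarrow> emeasure M (- B) = 0"
  using assms sets_eq_imp_space_eq[OF assms(1)] by (intro AE_iff_measurable) auto

lemma finite_radon_compact_approx:
  fixes M :: "'a::t2_space measure"
  assumes M: "finite_radon M" and e: "0 < e"
  obtains K where "compact K" "emeasure M (- K) \<le> ennreal e"
proof -
  interpret finite_measure M using M by (rule finite_radon_finite_measure)
  note [simp] = finite_radon_sets[OF M] finite_radon_space[OF M]
  have "emeasure M UNIV = (SUP K\<in>{K. compact K \<and> K \<subseteq> UNIV}. emeasure M K)"
    using M unfolding finite_radon_def radon_def by (metis open_UNIV)
  from SUP_approx_ennreal[OF e _ this]
  obtain K where K: "compact K" "emeasure M UNIV < emeasure M K + ennreal e"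
    by (auto simp: emeasure_eq_measure intro: compact_empty)
  have "emeasure M (- K) = emeasure M UNIV - emeasure M K"
    using K(1) emeasure_compl[of K M] by (simp add: borel_compact Compl_eq_Diff_UNIV)
  also have "\<dots> \<le> ennreal e"
    using K(2) by (simp add: ennreal_minus_le_iff add.commute less_imp_le)
  finally show thesis using K(1) that by blast
qed

lemma finite_radon_inner_regular:
  assumes M: "finite_radon M" and B: "B \<in> sets borel"
  shows "emeasure M B = (SUP K\<in>{K. compact K \<and> K \<subseteq> B}. emeasure M K)"
proof (rule antisym[OF ennreal_le_epsilon])
  interpret finite_measure M using M by (rule finite_radon_finite_measure)
  note [simp] = finite_radon_sets[OF M] finite_radon_space[OF M]
  note [measurable] = B
  show "(SUP K\<in>{K. compact K \<and> K \<subseteq> B}. emeasure M K) \<le> emeasure M B"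
    by (auto intro!: SUP_least emeasure_mono)
  fix e :: real assume "0 < e"
  then have e: "0 < e / 2" by simp
  have "emeasure M (- B) = (INF U\<in>{U. open U \<and> - B \<subseteq> U}. emeasure M U)"
    using M B unfolding finite_radon_def radon_def by auto
  from INF_approx_ennreal[OF e this]
  obtain U where U: "open U" "- B \<subseteq> U" "emeasure M U < emeasure M (- B) + ennreal (e / 2)"
    by auto
  have [measurable]: "U \<in> sets borel" using U(1) by simp
  obtain L where L: "compact L" "emeasure M (- L) \<le> ennreal (e / 2)"
    using finite_radon_compact_approx[OF M e] .
  have [measurable]: "L \<in> sets borel" using L(1) by (rule borel_compact)
  have UB: "emeasure M (U \<inter> B) \<le> ennreal (e / 2)"
  proof -
    have "emeasure M U = emeasure M (- B) + emeasure M (U \<inter> B)"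
      using U(2) by (subst plus_emeasure) (auto intro!: arg_cong[where f = "emeasure M"])
    with U(3) have "emeasure M (U \<inter> B) < ennreal (e / 2)"
      by (simp add: ennreal_add_left_cancel_less)
    then show ?thesis by (rule less_imp_le)
  qed
  have "emeasure M B \<le> emeasure M ((L - U) \<union> ((U \<inter> B) \<union> - L))"
    by (rule emeasure_mono) auto
  also have "\<dots> \<le> emeasure M (L - U) + (emeasure M (U \<inter> B) + emeasure M (- L))"
    by (intro order_trans[OF emeasure_subadditive] add_mono) auto
  also have "\<dots> \<le> emeasure M (L - U) + (ennreal (e / 2) + ennreal (e / 2))"
    using UB L(2) by (intro add_mono) auto
  also have "\<dots> \<le> (SUP K\<in>{K. compact K \<and> K \<subseteq> B}. emeasure M K) + ennreal e"
  proof (intro add_mono SUP_upper)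
    show "L - U \<in> {K. compact K \<and> K \<subseteq> B}" using L(1) U(1,2) by (auto intro: compact_diff)
  qed (use \<open>0 < e\<close> in \<open>simp flip: ennreal_plus\<close>)
  finally show "emeasure M B \<le> (SUP K\<in>{K. compact K \<and> K \<subseteq> B}. emeasure M K) + ennreal e" .
qed

lemma finite_radonI:
  fixes M :: "'a::t2_space measure"
  assumes sets: "sets M = sets borel" and fin: "emeasure M UNIV < \<infinity>"
    and inner: "\<And>B. B \<in> sets borel \<Longrightarrow> emeasure M B \<le> (SUP K\<in>{K. compact K \<and> K \<subseteq> B}. emeasure M K)"
  shows "finite_radon M"
proof -
  note [simp] = sets sets_eq_imp_space_eq[OF sets]
  interpret finite_measure M using fin by (intro finite_measureI) auto
  have inner_eq: "emeasure M B = (SUP K\<in>{K. compact K \<and> K \<subseteq> B}. emeasure M K)" if "B \<in> sets borel" for B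
    using that by (intro antisym inner) (auto intro!: SUP_least emeasure_mono)
  have "emeasure M B = (INF U\<in>{U. open U \<and> B \<subseteq> U}. emeasure M U)"
    if [measurable]: "B \<in> sets borel" for B
  proof (rule antisym[OF _ ennreal_le_epsilon])
    fix e :: real assume e: "0 < e"
    from SUP_approx_ennreal[OF e _ inner_eq[of "- B"]]
    obtain K where K: "compact K" "K \<subseteq> - B" "emeasure M (- B) < emeasure M K + ennreal e"
      by (auto simp: emeasure_eq_measure)
    have "emeasure M (- K) + emeasure M K = emeasure M B + emeasure M (- B)"
      using borel_compact[OF K(1)] by (subst (1 2) plus_emeasure) auto
    also have "\<dots> \<le> emeasure M B + (emeasure M K + ennreal e)"
      using K(3) by (intro add_left_mono less_imp_le)
    finally have "emeasure M (- K) \<le> emeasure M B + ennreal e"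
      using e by (simp add: emeasure_eq_measure flip: ennreal_plus)
    then show "(INF U\<in>{U. open U \<and> B \<subseteq> U}. emeasure M U) \<le> emeasure M B + ennreal e"
      using K(1,2) by (intro INF_lower2[of "- K"]) (auto simp: compact_imp_closed open_Compl)
  qed (auto intro!: INF_greatest emeasure_mono)
  then show ?thesis
    using inner_eq sets fin by (simp add: finite_radon_def radon_def emeasure_eq_measure)
qed

lemma finite_radon_sigma_compact:
  assumes M: "finite_radon M"
  obtains L :: "nat \<Rightarrow> 'a::t2_space set"
  where "incseq L" "\<And>n. compact (L n)" "AE x in M. x \<in> (\<Union>n. L n)"
proof -
  interpret finite_measure M using M by (rule finite_radon_finite_measure)
  note [simp] = finite_radon_sets[OF M]
  have "\<exists>K. compact K \<and> emeasure M (- K) \<le> ennreal (1 / Suc n)" for n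
    using finite_radon_compact_approx[OF M, of "1 / Suc n"] by auto
  then obtain K where K: "\<And>n. compact (K n)" "\<And>n. emeasure M (- K n) \<le> ennreal (1 / Suc n)"
    by metis
  have [measurable]: "K n \<in> sets borel" for n using K(1) by (rule borel_compact)
  have "measure M (- (\<Union>n. K n)) \<le> 1 / Suc n" for n
  proof -
    have "emeasure M (- (\<Union>n. K n)) \<le> emeasure M (- K n)" by (rule emeasure_mono) auto
    from this K(2)[of n] have "emeasure M (- (\<Union>n. K n)) \<le> ennreal (1 / Suc n)" by (rule order_trans)
    then show ?thesis by (simp add: emeasure_eq_measure)
  qed
  then have "measure M (- (\<Union>n. K n)) \<le> 0"
    using LIMSEQ_inverse_real_of_nat by (intro LIMSEQ_le_const) (auto simp: inverse_eq_divide)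
  then have "AE x in M. x \<in> (\<Union>n. K n)"
    by (subst AE_mem_iff_emeasure_Compl) (auto simp: emeasure_eq_measure measure_le_0_iff)
  then have "AE x in M. x \<in> (\<Union>n. \<Union>m\<le>n. K m)"
    by eventually_elim blast
  moreover have "incseq (\<lambda>n. \<Union>m\<le>n. K m)"
    by (intro monoI UN_mono) auto
  moreover have "compact (\<Union>m\<le>n. K m)" for n
    using K(1) by (intro compact_UN) auto
  ultimately show thesis by (intro that)
qed

lemma concentrated_iff_AE:
  assumes "sets M = sets borel"
  shows "concentrated M E \<longleftrightarrow> (AE x in M. x \<in> E)"
  unfolding concentrated_def eventually_ae_filter
  using sets_eq_imp_space_eq[OF assms] by (intro bex_cong) auto

section \<open>Sums, multiples and restrictions of measures\<close>

definition sum_measure :: "'i set \<Rightarrow> ('i \<Rightarrow> 'a::topological_space measure) \<Rightarrow> 'a measure" where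
  "sum_measure S \<mu> = measure_of UNIV (sets borel) (\<lambda>B. \<integral>\<^sup>+ i. emeasure (\<mu> i) B \<partial>count_space S)"

lemma sets_sum_measure [simp, measurable_cong]: "sets (sum_measure S \<mu>) = sets borel"
  unfolding sum_measure_def using sets.sets_measure_of_eq[of borel] by simp

lemma space_sum_measure [simp]: "space (sum_measure S \<mu>) = UNIV"
  unfolding sum_measure_def by simp

lemma sum_measure_cong: "(\<And>i. i \<in> S \<Longrightarrow> \<mu> i = \<nu> i) \<Longrightarrow> sum_measure S \<mu> = sum_measure S \<nu>"
  unfolding sum_measure_def
  by (intro arg_cong[where f = "measure_of UNIV (sets borel)"] ext nn_integral_cong) simp

lemma emeasure_sum_measure:
  fixes \<mu> :: "'i \<Rightarrow> 'a::topological_space measure"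
  assumes "\<And>i. i \<in> S \<Longrightarrow> sets (\<mu> i) = sets borel" "B \<in> sets borel"
  shows "emeasure (sum_measure S \<mu>) B = (\<integral>\<^sup>+ i. emeasure (\<mu> i) B \<partial>count_space S)"
  unfolding sum_measure_def
proof (rule emeasure_measure_of_sigma)
  show "sigma_algebra UNIV (sets (borel :: 'a measure))"
    using sets.sigma_algebra_axioms[of "borel :: 'a measure"] by simp
  show "countably_additive (sets borel) (\<lambda>B. \<integral>\<^sup>+ i. emeasure (\<mu> i) B \<partial>count_space S)"
  proof (rule countably_additiveI)
    fix A :: "nat \<Rightarrow> 'a set" assume A: "range A \<subseteq> sets borel" "disjoint_family A"
    have "(\<Sum>n. \<integral>\<^sup>+ i. emeasure (\<mu> i) (A n) \<partial>count_space S) =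
        (\<integral>\<^sup>+ i. (\<Sum>n. emeasure (\<mu> i) (A n)) \<partial>count_space S)"
      by (rule nn_integral_suminf[symmetric]) simp
    also have "\<dots> = (\<integral>\<^sup>+ i. emeasure (\<mu> i) (\<Union>n. A n) \<partial>count_space S)"
      using A assms by (intro nn_integral_cong suminf_emeasure) auto
    finally show "(\<Sum>n. \<integral>\<^sup>+ i. emeasure (\<mu> i) (A n) \<partial>count_space S) =
        (\<integral>\<^sup>+ i. emeasure (\<mu> i) (\<Union>n. A n) \<partial>count_space S)" .
  qed
qed (use assms in \<open>auto simp: positive_def\<close>)

lemma nn_integral_sum_measure:
  fixes \<mu> :: "'i \<Rightarrow> 'a::topological_space measure"
  assumes sets: "\<And>i. i \<in> S \<Longrightarrow> sets (\<mu> i) = sets borel" and f: "f \<in> borel_measurable borel"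
  shows "(\<integral>\<^sup>+ x. f x \<partial>sum_measure S \<mu>) = (\<integral>\<^sup>+ i. (\<integral>\<^sup>+ x. f x \<partial>\<mu> i) \<partial>count_space S)"
  using f
proof (induction f rule: borel_measurable_induct)
  case (cong f g)
  then show ?case using sets_eq_imp_space_eq[OF sets] by (simp cong: nn_integral_cong_simp)
next
  case (set A)
  then show ?case using sets by (simp add: emeasure_sum_measure cong: nn_integral_cong_simp)
next
  case (mult u c)
  have [measurable]: "u \<in> borel_measurable borel" by fact
  have "(\<integral>\<^sup>+ i. (\<integral>\<^sup>+ x. c * u x \<partial>\<mu> i) \<partial>count_space S) = (\<integral>\<^sup>+ i. c * (\<integral>\<^sup>+ x. u x \<partial>\<mu> i) \<partial>count_space S)"
    using sets by (intro nn_integral_cong nn_integral_cmult) (simp cong: measurable_cong_sets)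
  with mult show ?case by (simp add: nn_integral_cmult)
next
  case (add u v)
  have [measurable]: "u \<in> borel_measurable borel" "v \<in> borel_measurable borel" by fact+
  have "(\<integral>\<^sup>+ i. (\<integral>\<^sup>+ x. v x + u x \<partial>\<mu> i) \<partial>count_space S)
      = (\<integral>\<^sup>+ i. (\<integral>\<^sup>+ x. v x \<partial>\<mu> i) + (\<integral>\<^sup>+ x. u x \<partial>\<mu> i) \<partial>count_space S)"
    using sets by (intro nn_integral_cong nn_integral_add) (simp_all cong: measurable_cong_sets)
  with add show ?case by (simp add: nn_integral_add)
next
  case (seq U)
  have [measurable]: "U n \<in> borel_measurable borel" for n by fact
  have "(\<integral>\<^sup>+ i. (\<integral>\<^sup>+ x. (SUP n. U n x) \<partial>\<mu> i) \<partial>count_space S)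
      = (\<integral>\<^sup>+ i. (SUP n. \<integral>\<^sup>+ x. U n x \<partial>\<mu> i) \<partial>count_space S)"
    using sets seq by (intro nn_integral_cong nn_integral_monotone_convergence_SUP)
      (simp_all cong: measurable_cong_sets)
  also have "\<dots> = (SUP n. \<integral>\<^sup>+ i. (\<integral>\<^sup>+ x. U n x \<partial>\<mu> i) \<partial>count_space S)"
    using seq by (intro nn_integral_monotone_convergence_SUP)
      (auto simp: incseq_def le_fun_def intro!: nn_integral_mono)
  finally show ?case
    using seq by (simp add: image_comp nn_integral_monotone_convergence_SUP)
qed

lemma AE_sum_measure:
  assumes "\<And>i. i \<in> S \<Longrightarrow> sets (\<mu> i) = sets borel" "B \<in> sets borel"
    and "\<And>i. i \<in> S \<Longrightarrow> AE x in \<mu> i. x \<in> B"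
  shows "AE x in sum_measure S \<mu>. x \<in> B"
  using assms
  by (simp add: AE_mem_iff_emeasure_Compl emeasure_sum_measure cong: nn_integral_cong_simp)

lemma le_sum_measure:
  assumes "\<And>j. j \<in> S \<Longrightarrow> sets (\<mu> j) = sets borel" "i \<in> S"
  shows "\<mu> i \<le> sum_measure S \<mu>"
  using assms nn_integral_ge_point[OF assms(2)]
  by (subst le_measure) (auto simp: emeasure_sum_measure)

lemma finite_radon_sum_measure:
  fixes \<mu> :: "'i \<Rightarrow> 'a::t2_space measure"
  assumes \<mu>: "\<And>i. i \<in> S \<Longrightarrow> finite_radon (\<mu> i)" and S: "countable S"
    and fin: "(\<integral>\<^sup>+ i. emeasure (\<mu> i) UNIV \<partial>count_space S) < \<infinity>"
  shows "finite_radon (sum_measure S \<mu>)"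
proof (rule finite_radonI)
  have sets: "sets (\<mu> i) = sets borel" if "i \<in> S" for i
    using \<mu>[OF that] by (rule finite_radon_sets)
  show "emeasure (sum_measure S \<mu>) UNIV < \<infinity>"
    using fin sets by (simp add: emeasure_sum_measure)
  fix B :: "'a set" assume B: "B \<in> sets borel"
  let ?\<K> = "{K. compact K \<and> K \<subseteq> B}"
  have "emeasure (sum_measure S \<mu>) B = (\<integral>\<^sup>+ i. (SUP K\<in>?\<K>. emeasure (\<mu> i) K) \<partial>count_space S)"
    using B sets
    by (simp add: emeasure_sum_measure finite_radon_inner_regular[OF \<mu>] cong: nn_integral_cong_simp)
  also have "\<dots> = (SUP K\<in>?\<K>. \<integral>\<^sup>+ i. emeasure (\<mu> i) K \<partial>count_space S)"
  proof (rule nn_integral_count_space_SUP_directed[OF S])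
    fix K L assume "K \<in> ?\<K>" "L \<in> ?\<K>"
    then show "\<exists>J\<in>?\<K>. \<forall>i\<in>S. emeasure (\<mu> i) K \<le> emeasure (\<mu> i) J \<and> emeasure (\<mu> i) L \<le> emeasure (\<mu> i) J"
      using sets by (intro bexI[of _ "K \<union> L"]) (auto intro!: emeasure_mono borel_compact)
  qed
  also have "\<dots> = (SUP K\<in>?\<K>. emeasure (sum_measure S \<mu>) K)"
    using sets by (intro SUP_cong) (auto simp: emeasure_sum_measure borel_compact)
  finally show "emeasure (sum_measure S \<mu>) B \<le> (SUP K\<in>?\<K>. emeasure (sum_measure S \<mu>) K)" by simp
qed simp

definition add_measure :: "'a::topological_space measure \<Rightarrow> 'a measure \<Rightarrow> 'a measure" where
  "add_measure M N = sum_measure UNIV (\<lambda>b. if b then M else N)"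

lemma sets_add_measure [simp, measurable_cong]: "sets (add_measure M N) = sets borel"
  by (simp add: add_measure_def)

lemma emeasure_add_measure:
  assumes "sets M = sets borel" "sets N = sets borel" "B \<in> sets borel"
  shows "emeasure (add_measure M N) B = emeasure M B + emeasure N B"
  unfolding add_measure_def using assms
  by (subst emeasure_sum_measure) (auto simp: nn_integral_count_space_finite UNIV_bool)

lemma nn_integral_add_measure:
  assumes "sets M = sets borel" "sets N = sets borel" "f \<in> borel_measurable borel"
  shows "(\<integral>\<^sup>+ x. f x \<partial>add_measure M N) = (\<integral>\<^sup>+ x. f x \<partial>M) + (\<integral>\<^sup>+ x. f x \<partial>N)"
  unfolding add_measure_def using assms
  by (subst nn_integral_sum_measure) (auto simp: nn_integral_count_space_finite UNIV_bool)

lemma finite_radon_add_measure: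
  "finite_radon M \<Longrightarrow> finite_radon N \<Longrightarrow> finite_radon (add_measure M N)"
  unfolding add_measure_def
  by (rule finite_radon_sum_measure)
    (auto simp: nn_integral_count_space_finite UNIV_bool finite_radon_def)

lemma finite_radon_scale_measure:
  assumes M: "finite_radon M" and c: "c < \<infinity>"
  shows "finite_radon (scale_measure c M)"
proof (rule finite_radonI)
  show "sets (scale_measure c M) = sets borel" using M by (simp add: finite_radon_sets)
  show "emeasure (scale_measure c M) UNIV < \<infinity>"
    using M c by (simp add: finite_radon_def ennreal_mult_less_top)
  show "emeasure (scale_measure c M) B \<le> (SUP K\<in>{K. compact K \<and> K \<subseteq> B}. emeasure (scale_measure c M) K)"
    if "B \<in> sets borel" for B
    using finite_radon_inner_regular[OF M that] by (simp add: SUP_mult_left_ennreal)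
qed

lemma AE_scale_measure: "AE x in M. P x \<Longrightarrow> AE x in scale_measure c M. P x"
  by (auto simp: eventually_ae_filter space_scale_measure null_sets_def)

lemma finite_radon_null_measure: "finite_radon (null_measure borel)"
  by (rule finite_radonI) auto

definition mix :: "real \<Rightarrow> 'a::topological_space measure \<Rightarrow> 'a measure \<Rightarrow> 'a measure" where
  "mix t M N = add_measure (scale_measure (ennreal (1 - t)) M) (scale_measure (ennreal t) N)"

lemma sets_mix [simp, measurable_cong]: "sets (mix t M N) = sets borel"
  by (simp add: mix_def)

lemma nn_integral_mix:
  assumes "sets M = sets borel" "sets N = sets borel" "f \<in> borel_measurable borel"
  shows "(\<integral>\<^sup>+ x. f x \<partial>mix t M N) = ennreal (1 - t) * (\<integral>\<^sup>+ x. f x \<partial>M) + ennreal t * (\<integral>\<^sup>+ x. f x \<partial>N)"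
  unfolding mix_def using assms
  by (subst nn_integral_add_measure) (auto simp: nn_integral_scale_measure cong: measurable_cong_sets)

lemma AE_mix:
  assumes "sets M = sets borel" "sets N = sets borel" "B \<in> sets borel"
    and "AE x in M. x \<in> B" "AE x in N. x \<in> B"
  shows "AE x in mix t M N. x \<in> B"
  using assms by (simp add: AE_mem_iff_emeasure_Compl) (simp add: mix_def emeasure_add_measure)

lemma integral_mix:
  assumes M: "sets M = sets borel" "integrable M f" and N: "sets N = sets borel" "integrable N f"
    and t: "0 \<le> t" "t \<le> 1"
  shows "(\<integral>x. f x \<partial>mix t M N) = (1 - t) * (\<integral>x. f x \<partial>M) + t * (\<integral>x. f x \<partial>N)"
proof -
  have f: "f \<in> borel_measurable borel"
    using borel_measurable_integrable[OF M(2)] M(1) by (simp cong: measurable_cong_sets)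
  have nn_integral: "(\<integral>\<^sup>+ x. ennreal (h x) \<partial>mix t M N)
      = ennreal (1 - t) * (\<integral>\<^sup>+ x. ennreal (h x) \<partial>M) + ennreal t * (\<integral>\<^sup>+ x. ennreal (h x) \<partial>N)"
    if "h \<in> borel_measurable borel" for h :: "'a \<Rightarrow> real"
    using that M(1) N(1) by (intro nn_integral_mix) auto
  have finite: "(\<integral>\<^sup>+ x. ennreal (f x) \<partial>L) < top" "(\<integral>\<^sup>+ x. ennreal (- f x) \<partial>L) < top"
    if "integrable L f" for L
    using that by (auto simp: real_integrable_def less_top)
  have mix: "integrable (mix t M N) f"
    unfolding real_integrable_def using f finite[OF M(2)] finite[OF N(2)]
    by (simp add: nn_integral ennreal_mult_eq_top_iff less_imp_neq cong: measurable_cong_sets)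
  have enn2real:
    "enn2real (ennreal (1 - t) * u + ennreal t * v) = (1 - t) * enn2real u + t * enn2real v"
    if "u < top" "v < top" for u v
    using that t by (simp add: enn2real_plus enn2real_mult ennreal_mult_less_top)
  show ?thesis
    using f by (simp add: real_lebesgue_integral_def[OF mix] real_lebesgue_integral_def[OF M(2)]
        real_lebesgue_integral_def[OF N(2)] nn_integral enn2real finite[OF M(2)] finite[OF N(2)]
        right_diff_distrib)
qed

definition restrict_measure :: "'a measure \<Rightarrow> 'a set \<Rightarrow> 'a measure" where
  "restrict_measure M B = density M (indicator B)"

lemma sets_restrict_measure [simp, measurable_cong]: "sets (restrict_measure M B) = sets M"
  by (simp add: restrict_measure_def)

lemma emeasure_restrict_measure:
  "B \<in> sets M \<Longrightarrow> C \<in> sets M \<Longrightarrow> emeasure (restrict_measure M B) C = emeasure M (B \<inter> C)"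
  unfolding restrict_measure_def by (subst emeasure_density) (auto simp flip: indicator_inter_arith)

lemma nn_integral_restrict_measure:
  "B \<in> sets M \<Longrightarrow> f \<in> borel_measurable M \<Longrightarrow>
    (\<integral>\<^sup>+ x. f x \<partial>restrict_measure M B) = (\<integral>\<^sup>+ x. f x * indicator B x \<partial>M)"
  unfolding restrict_measure_def by (subst nn_integral_density) (auto simp: mult.commute)

lemma restrict_measure_le: "B \<in> sets M \<Longrightarrow> restrict_measure M B \<le> M"
  by (subst le_measure) (auto simp: emeasure_restrict_measure intro: emeasure_mono)

lemma AE_restrict_measure:
  "B \<in> sets M \<Longrightarrow> (AE x in restrict_measure M B. P x) \<longleftrightarrow> (AE x in M. x \<in> B \<longrightarrow> P x)"
  unfolding restrict_measure_def by (subst AE_density) (auto simp: indicator_def)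

lemma finite_radon_restrict_measure:
  fixes M :: "'a::t2_space measure"
  assumes M: "finite_radon M" and B: "B \<in> sets borel"
  shows "finite_radon (restrict_measure M B)"
proof (rule finite_radonI)
  note [simp] = finite_radon_sets[OF M]
  show "sets (restrict_measure M B) = sets borel" by simp
  have "emeasure (restrict_measure M B) UNIV \<le> emeasure M UNIV"
    using B by (simp add: emeasure_restrict_measure emeasure_mono)
  then show "emeasure (restrict_measure M B) UNIV < \<infinity>"
    using M by (auto simp: finite_radon_def)
  fix C :: "'a set" assume C: "C \<in> sets borel"
  have "emeasure (restrict_measure M B) C = (SUP K\<in>{K. compact K \<and> K \<subseteq> B \<inter> C}. emeasure M K)"
    using B C finite_radon_inner_regular[OF M, of "B \<inter> C"] by (simp add: emeasure_restrict_measure)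
  also have "\<dots> \<le> (SUP K\<in>{K. compact K \<and> K \<subseteq> C}. emeasure (restrict_measure M B) K)"
    using B by (intro SUP_mono)
      (auto simp: emeasure_restrict_measure borel_compact Int_absorb1 intro!: exI)
  finally show "emeasure (restrict_measure M B) C
      \<le> (SUP K\<in>{K. compact K \<and> K \<subseteq> C}. emeasure (restrict_measure M B) K)" .
qed

section \<open>Lower semicontinuous functions\<close>

lemma lsc_iff_open: "lsc f \<longleftrightarrow> (\<forall>c. open {x. c < f x})"
  unfolding lsc_def eventually_nhds by (subst open_subopen) fastforce

lemma lsc_borel_measurable: "lsc f \<Longrightarrow> f \<in> borel_measurable borel"
  by (rule borel_measurableI_greater) (simp add: lsc_iff_open borel_open)

lemma lsc_SUP: "(\<And>i. i \<in> I \<Longrightarrow> lsc (f i)) \<Longrightarrow> lsc (\<lambda>x. SUP i\<in>I. f i x)"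
  unfolding lsc_iff_open by (auto simp: less_SUP_iff Collect_bex_eq)

lemma lsc_max: "lsc f \<Longrightarrow> lsc g \<Longrightarrow> lsc (\<lambda>x. max (f x) (g x))"
  unfolding lsc_iff_open by (auto simp: less_max_iff_disj Collect_disj_eq)

lemma lsc_cmult:
  assumes f: "lsc f" shows "lsc (\<lambda>x. of_nat m * f x)"
proof (cases "m = 0")
  case True
  then show ?thesis by (simp add: lsc_iff_open)
next
  case False
  have "c < of_nat m * y \<longleftrightarrow> c / of_nat m < y" for c y :: ennreal
  proof -
    have "of_nat m * (c / of_nat m) = c"
      using False mult_divide_eq_ennreal[of "of_nat m" c]
      by (simp add: ennreal_times_divide mult.commute)
    then have "c < of_nat m * y \<longleftrightarrow> \<not> of_nat m * y \<le> of_nat m * (c / of_nat m)"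
      by (simp add: not_le)
    also have "\<dots> \<longleftrightarrow> \<not> y \<le> c / of_nat m"
      using False by (subst ennreal_mult_le_mult_iff) auto
    finally show ?thesis by (simp add: not_le)
  qed
  with f show ?thesis by (simp add: lsc_iff_open)
qed

lemma lsc_slice: "lsc (\<lambda>(x, y). k x y) \<Longrightarrow> lsc (k x)"
  unfolding lsc_iff_open
proof
  fix c assume "\<forall>c. open {p. c < (\<lambda>(x, y). k x y) p}"
  then have "open (Pair x -` {p. c < (\<lambda>(x, y). k x y) p})"
    by (intro open_vimage continuous_on_Pair continuous_on_const continuous_on_id) blast
  then show "open {y. c < k x y}" by (simp add: vimage_def)
qed

lemma radon_Union_directed:
  assumes M: "radon M" and U: "\<And>i. i \<in> I \<Longrightarrow> open (U i)" and ne: "I \<noteq> {}"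
    and directed: "\<And>i j. i \<in> I \<Longrightarrow> j \<in> I \<Longrightarrow> \<exists>k\<in>I. U i \<subseteq> U k \<and> U j \<subseteq> U k"
  shows "emeasure M (\<Union>i\<in>I. U i) = (SUP i\<in>I. emeasure M (U i))"
proof (rule antisym)
  have sets: "sets M = sets borel" using M by (simp add: radon_def)
  have finite_bound: "\<exists>k\<in>I. (\<Union>i\<in>J. U i) \<subseteq> U k" if "finite J" "J \<subseteq> I" for J
    using that
  proof (induction J)
    case empty
    then show ?case using ne by auto
  next
    case (insert j J)
    then obtain k where "k \<in> I" "(\<Union>i\<in>J. U i) \<subseteq> U k" by auto
    moreover obtain l where "l \<in> I" "U j \<subseteq> U l" "U k \<subseteq> U l"
      using directed[of j k] insert.prems \<open>k \<in> I\<close> by auto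
    ultimately show ?case by (intro bexI[of _ l]) auto
  qed
  have "emeasure M (\<Union>i\<in>I. U i) = (SUP K\<in>{K. compact K \<and> K \<subseteq> (\<Union>i\<in>I. U i)}. emeasure M K)"
    using M U unfolding radon_def by (metis open_UN)
  also have "\<dots> \<le> (SUP i\<in>I. emeasure M (U i))"
  proof (rule SUP_least, clarify)
    fix K assume "compact K" "K \<subseteq> (\<Union>i\<in>I. U i)"
    then obtain J where J: "finite J" "J \<subseteq> I" "K \<subseteq> (\<Union>i\<in>J. U i)"
      using U by (metis compactE_image)
    obtain k where k: "k \<in> I" "(\<Union>i\<in>J. U i) \<subseteq> U k"
      using finite_bound[OF J(1,2)] by (elim bexE)
    from order_trans[OF J(3) k(2)] have "emeasure M K \<le> emeasure M (U k)"
      using U[OF k(1)] sets by (intro emeasure_mono) auto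
    also have "\<dots> \<le> (SUP i\<in>I. emeasure M (U i))" using k(1) by (rule SUP_upper)
    finally show "emeasure M K \<le> (SUP i\<in>I. emeasure M (U i))" .
  qed
  finally show "emeasure M (\<Union>i\<in>I. U i) \<le> (SUP i\<in>I. emeasure M (U i))" .
  show "(SUP i\<in>I. emeasure M (U i)) \<le> emeasure M (\<Union>i\<in>I. U i)"
    using U sets by (intro SUP_least emeasure_mono) (auto intro!: borel_open)
qed

definition staircase :: "ennreal \<Rightarrow> ennreal" where
  "staircase y = (\<Sum>k. indicator {of_nat (Suc k)<..} y)"

lemma staircase_bounds: "staircase y \<le> y" "y \<le> staircase y + 1"
proof -
  have "staircase y \<le> y \<and> y \<le> staircase y + 1"
  proof (cases y)
    case (real r)
    define n where "n = nat (\<lceil>r\<rceil> - 1)"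
    have "indicator {of_nat (Suc k)<..} y = (if k < n then 1 else 0 :: ennreal)" for k
    proof -
      have "of_nat (Suc k) < y \<longleftrightarrow> real (Suc k) < r"
        using real by (simp add: ennreal_of_nat_eq_real_of_nat ennreal_less_iff del: of_nat_Suc)
      also have "\<dots> \<longleftrightarrow> k < n" unfolding n_def by linarith
      finally show ?thesis by (simp add: indicator_def)
    qed
    then have "staircase y = (\<Sum>k<n. 1)"
      unfolding staircase_def by (subst suminf_finite[of "{..<n}"]) auto
    then have "staircase y = ennreal (real n)"
      by (simp add: ennreal_of_nat_eq_real_of_nat)
    moreover have "ennreal (real n) + 1 = ennreal (real n + 1)"
      by (simp add: ennreal_plus)
    moreover have "real n \<le> r" "r \<le> real n + 1"
      unfolding n_def using real(1) by linarith+
    ultimately show ?thesis using real(2) by (metis ennreal_leI)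
  next
    case top
    have "staircase top = (\<Sum>k. 1)"
      unfolding staircase_def by (intro suminf_cong) (simp add: of_nat_less_top)
    also have "\<dots> = top"
      by (simp add: suminf_eq_SUP ennreal_SUP_of_nat_eq_top)
    finally show ?thesis using top by simp
  qed
  then show "staircase y \<le> y" "y \<le> staircase y + 1" by auto
qed

lemma nn_integral_staircase:
  assumes f: "f \<in> borel_measurable M"
  shows "(\<integral>\<^sup>+ x. staircase (f x) \<partial>M) = (\<Sum>k. emeasure M {x\<in>space M. of_nat (Suc k) < f x})"
proof -
  note [measurable] = f
  have "(\<integral>\<^sup>+ x. staircase (f x) \<partial>M)
      = (\<integral>\<^sup>+ x. (\<Sum>k. indicator {x\<in>space M. of_nat (Suc k) < f x} x) \<partial>M)"
    unfolding staircase_def by (intro nn_integral_cong suminf_cong) (auto simp: indicator_def)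
  also have "\<dots> = (\<Sum>k. emeasure M {x\<in>space M. of_nat (Suc k) < f x})"
    by (subst nn_integral_suminf) simp_all
  finally show ?thesis .
qed

lemma emeasure_level_SUP_directed_lsc:
  assumes M: "radon M" and f: "\<And>i. i \<in> I \<Longrightarrow> lsc (f i)" and ne: "I \<noteq> {}"
    and directed: "\<And>i j. i \<in> I \<Longrightarrow> j \<in> I \<Longrightarrow> \<exists>k\<in>I. f i \<le> f k \<and> f j \<le> f k"
  shows "emeasure M {x. c < (SUP i\<in>I. f i x)} = (SUP i\<in>I. emeasure M {x. c < f i x})"
proof -
  have "{x. c < (SUP i\<in>I. f i x)} = (\<Union>i\<in>I. {x. c < f i x})" by (auto simp: less_SUP_iff)
  also have "emeasure M \<dots> = (SUP i\<in>I. emeasure M {x. c < f i x})"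
  proof (rule radon_Union_directed[OF M _ ne])
    show "open {x. c < f i x}" if "i \<in> I" for i using f[OF that] by (simp add: lsc_iff_open)
    fix i j assume "i \<in> I" "j \<in> I"
    from directed[OF this] obtain k where "k \<in> I" "f i \<le> f k" "f j \<le> f k" by blast
    then show "\<exists>k\<in>I. {x. c < f i x} \<subseteq> {x. c < f k x} \<and> {x. c < f j x} \<subseteq> {x. c < f k x}"
      by (intro bexI[of _ k]) (auto simp: le_fun_def intro: less_le_trans)
  qed
  finally show ?thesis .
qed

text \<open>The error bound does not depend on \<open>f\<close>, so that it disappears when \<open>f\<close> is replaced by
  a large multiple.\<close>

lemma nn_integral_SUP_directed_lsc_approx:
  assumes M: "finite_radon M" and f: "\<And>i. i \<in> I \<Longrightarrow> lsc (f i)" and ne: "I \<noteq> {}"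
    and directed: "\<And>i j. i \<in> I \<Longrightarrow> j \<in> I \<Longrightarrow> \<exists>k\<in>I. f i \<le> f k \<and> f j \<le> f k"
  shows "(\<integral>\<^sup>+ x. (SUP i\<in>I. f i x) \<partial>M) \<le> (SUP i\<in>I. \<integral>\<^sup>+ x. f i x \<partial>M) + emeasure M UNIV"
proof -
  have [simp]: "space M = UNIV" using M by (rule finite_radon_space)
  let ?F = "\<lambda>x. SUP i\<in>I. f i x" and ?U = "\<lambda>k g. {x. of_nat (Suc k) < g x}"
  have f_meas: "f i \<in> borel_measurable M" if "i \<in> I" for i
    using lsc_borel_measurable[OF f[OF that]] by (simp add: borel_measurable_finite_radon[OF M])
  have F_meas: "?F \<in> borel_measurable M"
    using lsc_borel_measurable[OF lsc_SUP[OF f]] by (simp add: borel_measurable_finite_radon[OF M])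
  have level_mono: "emeasure M (?U k (f i)) \<le> emeasure M (?U k (f j))" if "f i \<le> f j" "j \<in> I" for i j k
  proof (rule emeasure_mono)
    show "?U k (f i) \<subseteq> ?U k (f j)"
      using that(1) by (auto simp: le_fun_def intro: less_le_trans)
    have [measurable]: "f j \<in> borel_measurable M" using that(2) by (rule f_meas)
    have "{x\<in>space M. of_nat (Suc k) < f j x} \<in> sets M" by measurable
    then show "?U k (f j) \<in> sets M" by simp
  qed
  have "radon M" using M by (simp add: finite_radon_def)
  note level = emeasure_level_SUP_directed_lsc[OF this f ne directed]
  have "(\<integral>\<^sup>+ x. ?F x \<partial>M) \<le> (\<integral>\<^sup>+ x. staircase (?F x) + 1 \<partial>M)"
    by (intro nn_integral_mono staircase_bounds)
  also have "\<dots> = (\<integral>\<^sup>+ x. staircase (?F x) \<partial>M) + emeasure M UNIV"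
    unfolding staircase_def using F_meas by (subst nn_integral_add) auto
  also have "(\<integral>\<^sup>+ x. staircase (?F x) \<partial>M) = (\<Sum>k. SUP i\<in>I. emeasure M (?U k (f i)))"
    using nn_integral_staircase[OF F_meas] level by simp
  also have "\<dots> = (SUP i\<in>I. \<Sum>k. emeasure M (?U k (f i)))"
  proof (rule ennreal_suminf_SUP_eq_directed)
    fix N :: "nat set" and i j assume "i \<in> I" "j \<in> I"
    from directed[OF this] obtain l where "l \<in> I" "f i \<le> f l" "f j \<le> f l" by blast
    then show "\<exists>l\<in>I. \<forall>k\<in>N. emeasure M (?U k (f i)) \<le> emeasure M (?U k (f l))
        \<and> emeasure M (?U k (f j)) \<le> emeasure M (?U k (f l))"
      by (intro bexI[of _ l] ballI conjI level_mono)
  qed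
  also have "\<dots> = (SUP i\<in>I. \<integral>\<^sup>+ x. staircase (f i x) \<partial>M)"
    using nn_integral_staircase[OF f_meas] by (intro SUP_cong) simp_all
  also have "\<dots> \<le> (SUP i\<in>I. \<integral>\<^sup>+ x. f i x \<partial>M)"
    by (intro SUP_mono' nn_integral_mono staircase_bounds)
  finally show ?thesis by (simp add: add_right_mono)
qed

lemma nn_integral_SUP_directed_lsc:
  assumes M: "finite_radon M" and f: "\<And>i. i \<in> I \<Longrightarrow> lsc (f i)" and ne: "I \<noteq> {}"
    and directed: "\<And>i j. i \<in> I \<Longrightarrow> j \<in> I \<Longrightarrow> \<exists>k\<in>I. f i \<le> f k \<and> f j \<le> f k"
  shows "(\<integral>\<^sup>+ x. (SUP i\<in>I. f i x) \<partial>M) = (SUP i\<in>I. \<integral>\<^sup>+ x. f i x \<partial>M)" (is "?L = ?S")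
proof (rule antisym[OF ennreal_le_epsilon])
  interpret finite_measure M using M by (rule finite_radon_finite_measure)
  have f_meas: "f i \<in> borel_measurable M" if "i \<in> I" for i
    using lsc_borel_measurable[OF f[OF that]] by (simp add: borel_measurable_finite_radon[OF M])
  have F_meas: "(\<lambda>x. SUP i\<in>I. f i x) \<in> borel_measurable M"
    using lsc_borel_measurable[OF lsc_SUP[OF f]] by (simp add: borel_measurable_finite_radon[OF M])
  fix e :: real assume e: "0 < e"
  obtain m :: nat where m: "0 < m" "measure M UNIV \<le> m * e"
  proof -
    obtain m :: nat where "measure M UNIV / e < m" using reals_Archimedean2 by blast
    then show thesis using e that[of "Suc m"] by (simp add: field_simps)
  qed
  have "of_nat m * ?L = (\<integral>\<^sup>+ x. (SUP i\<in>I. of_nat m * f i x) \<partial>M)"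
    using F_meas by (simp add: nn_integral_cmult flip: SUP_mult_left_ennreal)
  also have "\<dots> \<le> (SUP i\<in>I. \<integral>\<^sup>+ x. of_nat m * f i x \<partial>M) + emeasure M UNIV"
  proof (rule nn_integral_SUP_directed_lsc_approx[OF M lsc_cmult[OF f] ne])
    fix i j assume "i \<in> I" "j \<in> I"
    from directed[OF this] obtain k where "k \<in> I" "f i \<le> f k" "f j \<le> f k" by blast
    then show "\<exists>k\<in>I. (\<lambda>x. of_nat m * f i x :: ennreal) \<le> (\<lambda>x. of_nat m * f k x)
        \<and> (\<lambda>x. of_nat m * f j x :: ennreal) \<le> (\<lambda>x. of_nat m * f k x)"
      by (intro bexI[of _ k]) (auto simp: le_fun_def mult_left_mono)
  qed auto
  also have "\<dots> \<le> of_nat m * ?S + of_nat m * ennreal e"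
    using m(2) e f_meas
    by (intro add_mono) (auto simp: nn_integral_cmult SUP_mult_left_ennreal emeasure_eq_measure
        ennreal_of_nat_eq_real_of_nat ennreal_leI simp flip: ennreal_mult)
  finally have "of_nat m * ?L \<le> of_nat m * (?S + ennreal e)" by (simp add: distrib_left)
  then show "?L \<le> ?S + ennreal e"
    using m(1) by (simp add: ennreal_mult_le_mult_iff of_nat_less_top)
next
  show "?S \<le> ?L"
    by (intro SUP_least nn_integral_mono SUP_upper)
qed

section \<open>Lower semicontinuous kernels\<close>

inductive_set rect_minorants :: "('a::topological_space \<Rightarrow> 'a \<Rightarrow> ennreal) \<Rightarrow> ('a \<Rightarrow> 'a \<Rightarrow> ennreal) set"
  for k :: "'a \<Rightarrow> 'a \<Rightarrow> ennreal" where
  rect: "open U \<Longrightarrow> open V \<Longrightarrow> (\<And>x y. x \<in> U \<Longrightarrow> y \<in> V \<Longrightarrow> c \<le> k x y) \<Longrightarrow>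
    (\<lambda>x y. c * indicator U x * indicator V y) \<in> rect_minorants k"
| max: "u \<in> rect_minorants k \<Longrightarrow> v \<in> rect_minorants k \<Longrightarrow>
    (\<lambda>x y. max (u x y) (v x y)) \<in> rect_minorants k"

lemma rect_minorants_nonempty: "rect_minorants k \<noteq> {}"
  using rect_minorants.rect[of "{}" "{}" 0 k] by auto

lemma rect_minorants_le: "u \<in> rect_minorants k \<Longrightarrow> u x y \<le> k x y"
  by (induction rule: rect_minorants.induct) (auto split: split_indicator)

lemma rect_minorants_lsc: "u \<in> rect_minorants k \<Longrightarrow> lsc (u x)"
proof (induction rule: rect_minorants.induct)
  case (rect U V c)
  have "{y. d < c * indicator U x * indicator V y} = (if d < c * indicator U x then V else {})" for d
    by (auto split: split_indicator split_indicator_asm)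
  with rect(2) show ?case by (simp add: lsc_iff_open)
qed (rule lsc_max)

lemma rect_minorants_locally_minimal:
  "u \<in> rect_minorants k \<Longrightarrow> \<exists>W. open W \<and> x \<in> W \<and> (\<forall>x'\<in>W. u x \<le> u x')"
proof (induction rule: rect_minorants.induct)
  case (rect U V c)
  then show ?case
    by (intro exI[of _ "if x \<in> U then U else UNIV"]) (auto simp: le_fun_def)
next
  case (max u v)
  then obtain W W' where "open W" "x \<in> W" "\<forall>x'\<in>W. u x \<le> u x'"
    "open W'" "x \<in> W'" "\<forall>x'\<in>W'. v x \<le> v x'" by blast
  then show ?case
    by (intro exI[of _ "W \<inter> W'"]) (auto simp: le_fun_def intro: max.coboundedI1 max.coboundedI2)
qed

lemma rect_minorants_measurable:
  assumes "u \<in> rect_minorants k" "sets M = sets borel" "sets N = sets borel"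
  shows "(\<lambda>(x, y). u x y) \<in> borel_measurable (M \<Otimes>\<^sub>M N)"
  using assms(1)
proof (induction rule: rect_minorants.induct)
  case (rect U V c)
  have [measurable]: "U \<in> sets M" "V \<in> sets N" using rect(1,2) assms(2,3) by auto
  show ?case by measurable
next
  case (max u v)
  then show ?case by (simp add: case_prod_beta' borel_measurable_max)
qed

lemma rect_minorants_swap:
  assumes "\<And>x y. k x y = k y x"
  shows "u \<in> rect_minorants k \<Longrightarrow> (\<lambda>x y. u y x) \<in> rect_minorants k"
proof (induction rule: rect_minorants.induct)
  case (rect U V c)
  then have "(\<lambda>x y. c * indicator V x * indicator U y) \<in> rect_minorants k"
    by (intro rect_minorants.rect) (auto intro: ord_le_eq_trans[OF _ assms])
  then show ?case by (simp add: mult_ac)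
qed (rule rect_minorants.max)

lemma SUP_rect_minorants:
  fixes k :: "'a::topological_space \<Rightarrow> 'a \<Rightarrow> ennreal"
  assumes k: "lsc (\<lambda>(x, y). k x y)"
  shows "(SUP u\<in>rect_minorants k. u x y) = k x y"
proof (rule antisym)
  show "(SUP u\<in>rect_minorants k. u x y) \<le> k x y"
    by (intro SUP_least rect_minorants_le)
  show "k x y \<le> (SUP u\<in>rect_minorants k. u x y)"
  proof (rule dense_le)
    fix c assume "c < k x y"
    then have "(x, y) \<in> {p. c < (\<lambda>(x, y). k x y) p}" by simp
    then obtain U V where UV: "open U" "open V" "x \<in> U" "y \<in> V"
        "U \<times> V \<subseteq> {p. c < (\<lambda>(x, y). k x y) p}"
      using k unfolding lsc_iff_open by (metis open_prod_elim mem_Sigma_iff)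
    then have "(\<lambda>x y. c * indicator U x * indicator V y) \<in> rect_minorants k"
      by (intro rect_minorants.rect) (auto intro: less_imp_le)
    then show "c \<le> (SUP u\<in>rect_minorants k. u x y)"
      using UV(3,4) by (intro SUP_upper2) auto
  qed
qed

lemma lsc_integral_rect_minorant:
  assumes u: "u \<in> rect_minorants k" shows "lsc (\<lambda>x. \<integral>\<^sup>+ y. u x y \<partial>N)"
  unfolding lsc_def
proof (intro allI impI)
  fix x c assume c: "c < (\<integral>\<^sup>+ y. u x y \<partial>N)"
  obtain W where W: "open W" "x \<in> W" "\<forall>x'\<in>W. u x \<le> u x'"
    using rect_minorants_locally_minimal[OF u] by blast
  have "c < (\<integral>\<^sup>+ y. u x' y \<partial>N)" if "x' \<in> W" for x'
    using c W(3) that by (auto simp: le_fun_def intro: less_le_trans nn_integral_mono)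
  with W(1,2) show "\<forall>\<^sub>F x' in nhds x. c < (\<integral>\<^sup>+ y. u x' y \<partial>N)"
    unfolding eventually_nhds by blast
qed

lemma pot_eq_SUP_rect_minorants:
  assumes k: "lsc (\<lambda>(x, y). k x y)" and N: "finite_radon N"
  shows "pot k N x = (SUP u\<in>rect_minorants k. \<integral>\<^sup>+ y. u x y \<partial>N)"
proof -
  have "pot k N x = (\<integral>\<^sup>+ y. (SUP u\<in>rect_minorants k. u x y) \<partial>N)"
    by (simp add: pot_def SUP_rect_minorants[OF k])
  also have "\<dots> = (SUP u\<in>rect_minorants k. \<integral>\<^sup>+ y. u x y \<partial>N)"
  proof (rule nn_integral_SUP_directed_lsc[OF N rect_minorants_lsc rect_minorants_nonempty])
    fix u v assume "u \<in> rect_minorants k" "v \<in> rect_minorants k"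
    from rect_minorants.max[OF this]
    show "\<exists>w\<in>rect_minorants k. u x \<le> w x \<and> v x \<le> w x"
      by (intro bexI) (auto simp: le_fun_def)
  qed
  finally show ?thesis .
qed

lemma lsc_pot:
  assumes "lsc (\<lambda>(x, y). k x y)" "finite_radon N"
  shows "lsc (pot k N)"
  unfolding pot_eq_SUP_rect_minorants[OF assms] by (intro lsc_SUP lsc_integral_rect_minorant)

lemma menergy_eq_SUP_rect_minorants:
  assumes k: "lsc (\<lambda>(x, y). k x y)" and M: "finite_radon M" and N: "finite_radon N"
  shows "menergy k M N = (SUP u\<in>rect_minorants k. \<integral>\<^sup>+ x. \<integral>\<^sup>+ y. u x y \<partial>N \<partial>M)"
  unfolding menergy_def pot_eq_SUP_rect_minorants[OF k N]
proof (rule nn_integral_SUP_directed_lsc[OF M lsc_integral_rect_minorant rect_minorants_nonempty])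
  fix u v assume "u \<in> rect_minorants k" "v \<in> rect_minorants k"
  from rect_minorants.max[OF this]
  show "\<exists>w\<in>rect_minorants k. (\<lambda>x. \<integral>\<^sup>+ y. u x y \<partial>N) \<le> (\<lambda>x. \<integral>\<^sup>+ y. w x y \<partial>N)
      \<and> (\<lambda>x. \<integral>\<^sup>+ y. v x y \<partial>N) \<le> (\<lambda>x. \<integral>\<^sup>+ y. w x y \<partial>N)"
    by (intro bexI) (auto simp: le_fun_def intro!: nn_integral_mono)
qed

text \<open>No countable base is assumed, so the kernel need not be measurable for the product of the
  Borel algebras; Tonelli's theorem is available for its rectangular minorants.\<close>

lemma menergy_commute:
  fixes k :: "'a::t2_space \<Rightarrow> 'a \<Rightarrow> ennreal"
  assumes k: "lsc (\<lambda>(x, y). k x y)" and sym: "\<And>x y. k x y = k y x"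
    and "finite_radon M" "finite_radon N"
  shows "menergy k M N = menergy k N M"
proof -
  have mutual_le: "menergy k M N \<le> menergy k N M" if M: "finite_radon M" and N: "finite_radon N" for M N
    unfolding menergy_eq_SUP_rect_minorants[OF k M N] menergy_eq_SUP_rect_minorants[OF k N M]
  proof (rule SUP_mono)
    interpret M: finite_measure M using M by (rule finite_radon_finite_measure)
    interpret N: finite_measure N using N by (rule finite_radon_finite_measure)
    interpret pair_sigma_finite M N ..
    fix u assume u: "u \<in> rect_minorants k"
    have "(\<integral>\<^sup>+ x. \<integral>\<^sup>+ y. u x y \<partial>N \<partial>M) = (\<integral>\<^sup>+ y. \<integral>\<^sup>+ x. u x y \<partial>M \<partial>N)"
      using rect_minorants_measurable[OF u finite_radon_sets[OF M] finite_radon_sets[OF N]]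
      by (rule Fubini'[symmetric])
    then show "\<exists>v\<in>rect_minorants k. (\<integral>\<^sup>+ x. \<integral>\<^sup>+ y. u x y \<partial>N \<partial>M) \<le> (\<integral>\<^sup>+ x. \<integral>\<^sup>+ y. v x y \<partial>M \<partial>N)"
      using rect_minorants_swap[OF sym u] by auto
  qed
  show ?thesis using assms(3,4) by (intro antisym mutual_le)
qed

section \<open>Potentials and mutual energies\<close>

locale lsc_kernel =
  fixes \<kappa> :: "'a::t2_space \<Rightarrow> 'a \<Rightarrow> ennreal"
  assumes kernel_lsc: "lsc (\<lambda>(x, y). \<kappa> x y)" and kernel_sym: "\<kappa> x y = \<kappa> y x"
begin

lemma kernel_measurable: "\<kappa> x \<in> borel_measurable borel"
  using lsc_slice[OF kernel_lsc] by (rule lsc_borel_measurable)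

lemma pot_lsc: "finite_radon \<nu> \<Longrightarrow> lsc (pot \<kappa> \<nu>)"
  using kernel_lsc by (rule lsc_pot)

lemma pot_measurable: "finite_radon \<nu> \<Longrightarrow> pot \<kappa> \<nu> \<in> borel_measurable borel"
  by (intro lsc_borel_measurable pot_lsc)

lemma mutual_energy_commute:
  "finite_radon \<mu> \<Longrightarrow> finite_radon \<nu> \<Longrightarrow> menergy \<kappa> \<mu> \<nu> = menergy \<kappa> \<nu> \<mu>"
  using kernel_lsc kernel_sym by (rule menergy_commute)

lemma pot_mono: "sets \<mu> = sets \<nu> \<Longrightarrow> \<mu> \<le> \<nu> \<Longrightarrow> pot \<kappa> \<mu> x \<le> pot \<kappa> \<nu> x"
  unfolding pot_def by (rule nn_integral_mono_measure)

lemma menergy_mono_left: "sets \<mu> = sets \<nu> \<Longrightarrow> \<mu> \<le> \<nu> \<Longrightarrow> menergy \<kappa> \<mu> \<xi> \<le> menergy \<kappa> \<nu> \<xi>"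
  unfolding menergy_def by (rule nn_integral_mono_measure)

lemma menergy_self_mono:
  assumes \<mu>: "finite_radon \<mu>" and \<nu>: "finite_radon \<nu>" and \<mu>_le: "\<mu> \<le> \<nu>"
  shows "menergy \<kappa> \<mu> \<mu> \<le> menergy \<kappa> \<nu> \<nu>"
proof -
  have sets: "sets \<mu> = sets \<nu>" using \<mu> \<nu> by (simp add: finite_radon_sets)
  have "menergy \<kappa> \<mu> \<mu> \<le> menergy \<kappa> \<nu> \<mu>" using sets \<mu>_le by (rule menergy_mono_left)
  also have "\<dots> = menergy \<kappa> \<mu> \<nu>" using \<nu> \<mu> by (rule mutual_energy_commute)
  also have "\<dots> \<le> menergy \<kappa> \<nu> \<nu>" using sets \<mu>_le by (rule menergy_mono_left)
  finally show ?thesis .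
qed

lemma pot_sum_measure:
  assumes "\<And>i. i \<in> S \<Longrightarrow> sets (\<mu> i) = sets borel" "countable S"
  shows "pot \<kappa> (sum_measure S \<mu>) x = (\<Sum>\<^sub>\<infinity>i\<in>S. pot \<kappa> (\<mu> i) x)"
  unfolding pot_def infsum_eq_nn_integral_count_space[OF assms(2)]
  by (rule nn_integral_sum_measure[OF assms(1) kernel_measurable])

lemma menergy_sum_measure_left:
  assumes "\<And>i. i \<in> S \<Longrightarrow> sets (\<mu> i) = sets borel" "finite_radon \<nu>"
  shows "menergy \<kappa> (sum_measure S \<mu>) \<nu> = (\<integral>\<^sup>+ i. menergy \<kappa> (\<mu> i) \<nu> \<partial>count_space S)"
  unfolding menergy_def by (rule nn_integral_sum_measure[OF assms(1) pot_measurable[OF assms(2)]])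

lemma menergy_sum_measure_right:
  assumes S: "countable S" and \<nu>: "\<And>j. j \<in> S \<Longrightarrow> finite_radon (\<nu> j)"
    and sum: "finite_radon (sum_measure S \<nu>)" and \<mu>: "finite_radon \<mu>"
  shows "menergy \<kappa> \<mu> (sum_measure S \<nu>) = (\<Sum>\<^sub>\<infinity>j\<in>S. menergy \<kappa> \<mu> (\<nu> j))"
proof -
  have "menergy \<kappa> \<mu> (sum_measure S \<nu>) = (\<integral>\<^sup>+ j. menergy \<kappa> (\<nu> j) \<mu> \<partial>count_space S)"
    unfolding mutual_energy_commute[OF \<mu> sum]
    using \<nu> \<mu> by (intro menergy_sum_measure_left) (auto simp: finite_radon_sets)
  also have "\<dots> = (\<integral>\<^sup>+ j. menergy \<kappa> \<mu> (\<nu> j) \<partial>count_space S)"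
    using \<nu> \<mu> by (intro nn_integral_cong mutual_energy_commute) auto
  finally show ?thesis by (simp add: infsum_eq_nn_integral_count_space[OF S])
qed

lemma blockE_eq_menergy:
  assumes S: "countable S" and T: "countable T"
    and \<mu>: "\<And>i. i \<in> S \<Longrightarrow> finite_radon (\<mu> i)" and \<nu>: "\<And>j. j \<in> T \<Longrightarrow> finite_radon (\<nu> j)"
    and sum: "finite_radon (sum_measure T \<nu>)"
  shows "blockE \<kappa> S T \<mu> \<nu> = menergy \<kappa> (sum_measure S \<mu>) (sum_measure T \<nu>)"
proof -
  interpret T: sigma_finite_measure "count_space T"
    using T by (rule sigma_finite_measure_count_space_countable)
  note pair = pair_measure_countable[OF S T]
  have "blockE \<kappa> S T \<mu> \<nu>
      = (\<integral>\<^sup>+ p. menergy \<kappa> (\<mu> (fst p)) (\<nu> (snd p)) \<partial>(count_space S \<Otimes>\<^sub>M count_space T))"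
    unfolding blockE_def pair using S T by (simp add: infsum_eq_nn_integral_count_space case_prod_beta')
  also have "\<dots> = (\<integral>\<^sup>+ i. \<integral>\<^sup>+ j. menergy \<kappa> (\<mu> i) (\<nu> j) \<partial>count_space T \<partial>count_space S)"
    by (subst T.nn_integral_fst[symmetric]) (auto simp: pair)
  also have "\<dots> = (\<integral>\<^sup>+ i. menergy \<kappa> (\<mu> i) (sum_measure T \<nu>) \<partial>count_space S)"
    using \<mu> \<nu> sum T by (intro nn_integral_cong)
      (simp add: menergy_sum_measure_right infsum_eq_nn_integral_count_space)
  also have "\<dots> = menergy \<kappa> (sum_measure S \<mu>) (sum_measure T \<nu>)"
    using \<mu> sum by (intro menergy_sum_measure_left[symmetric]) (auto simp: finite_radon_sets)
  finally show ?thesis .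
qed

lemma pot_add_measure:
  "sets \<mu> = sets borel \<Longrightarrow> sets \<nu> = sets borel \<Longrightarrow> pot \<kappa> (add_measure \<mu> \<nu>) x = pot \<kappa> \<mu> x + pot \<kappa> \<nu> x"
  unfolding pot_def by (intro nn_integral_add_measure kernel_measurable)

lemma menergy_add_measure_left:
  "sets \<mu> = sets borel \<Longrightarrow> sets \<mu>' = sets borel \<Longrightarrow> finite_radon \<nu> \<Longrightarrow>
    menergy \<kappa> (add_measure \<mu> \<mu>') \<nu> = menergy \<kappa> \<mu> \<nu> + menergy \<kappa> \<mu>' \<nu>"
  unfolding menergy_def by (intro nn_integral_add_measure pot_measurable)

lemma menergy_scale_measure_left:
  "sets \<mu> = sets borel \<Longrightarrow> finite_radon \<nu> \<Longrightarrow>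
    menergy \<kappa> (scale_measure c \<mu>) \<nu> = c * menergy \<kappa> \<mu> \<nu>"
  unfolding menergy_def using pot_measurable[of \<nu>]
  by (intro nn_integral_scale_measure) (simp cong: measurable_cong_sets)

lemma menergy_eq_SUP_restrict_measure:
  assumes \<mu>: "finite_radon \<mu>" and \<nu>: "finite_radon \<nu>" and K: "incseq K" "\<And>n. K n \<in> sets borel"
    and AE: "AE x in \<mu>. x \<in> (\<Union>n. K n)"
  shows "menergy \<kappa> \<mu> \<nu> = (SUP n. menergy \<kappa> (restrict_measure \<mu> (K n)) \<nu>)"
proof -
  note [simp] = finite_radon_sets[OF \<mu>]
  have [measurable]: "pot \<kappa> \<nu> \<in> borel_measurable \<mu>" "\<And>n. K n \<in> sets \<mu>"
    using pot_measurable[OF \<nu>] K(2) by (simp_all add: borel_measurable_finite_radon[OF \<mu>])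
  have "menergy \<kappa> \<mu> \<nu> = (\<integral>\<^sup>+ x. (SUP n. pot \<kappa> \<nu> x * indicator (K n) x) \<partial>\<mu>)"
    unfolding menergy_def
  proof (rule nn_integral_cong_AE, use AE in eventually_elim)
    case (elim x)
    then obtain n where "x \<in> K n" by auto
    then show ?case
      by (intro antisym SUP_upper2[of n]) (auto intro!: SUP_least split: split_indicator)
  qed
  also have "\<dots> = (SUP n. \<integral>\<^sup>+ x. pot \<kappa> \<nu> x * indicator (K n) x \<partial>\<mu>)"
    using K by (intro nn_integral_monotone_convergence_SUP)
      (auto simp: incseq_def le_fun_def split: split_indicator)
  also have "\<dots> = (SUP n. menergy \<kappa> (restrict_measure \<mu> (K n)) \<nu>)"
    unfolding menergy_def using K(2) by (simp add: nn_integral_restrict_measure)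
  finally show ?thesis .
qed

lemma exhaustion_by_bounded_pot:
  assumes \<mu>: "finite_radon \<mu>" and \<nu>: "finite_radon \<nu>" and finite: "AE x in \<mu>. pot \<kappa> \<nu> x \<noteq> \<infinity>"
  shows "\<exists>K :: nat \<Rightarrow> 'a set. incseq K \<and> (\<forall>n. compact (K n)) \<and> (AE x in \<mu>. x \<in> (\<Union>n. K n))
    \<and> (\<forall>n. \<forall>x\<in>K n. pot \<kappa> \<nu> x \<le> of_nat n)"
proof -
  obtain L where L: "incseq L" "\<And>n. compact (L n)" "AE x in \<mu>. x \<in> (\<Union>n. L n)"
    using finite_radon_sigma_compact[OF \<mu>] by blast
  define K where "K n = L n \<inter> {x. pot \<kappa> \<nu> x \<le> of_nat n}" for n :: nat
  have "incseq K"
  proof (rule monoI)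
    fix m n :: nat assume mn: "m \<le> n"
    then have "(of_nat m :: ennreal) \<le> of_nat n" by simp
    then have "{x. pot \<kappa> \<nu> x \<le> of_nat m} \<subseteq> {x. pot \<kappa> \<nu> x \<le> of_nat n}"
      by (intro Collect_mono impI) (rule order_trans)
    with incseqD[OF L(1) mn] show "K m \<subseteq> K n" unfolding K_def by (rule Int_mono)
  qed
  moreover have "compact (K n)" for n
  proof -
    have "open {x. of_nat n < pot \<kappa> \<nu> x}" using pot_lsc[OF \<nu>] by (simp add: lsc_iff_open)
    moreover have "- {x. of_nat n < pot \<kappa> \<nu> x} = {x. pot \<kappa> \<nu> x \<le> of_nat n}" by auto
    ultimately show ?thesis unfolding K_def using L(2) by (metis closed_Compl compact_Int_closed)
  qed
  moreover have "AE x in \<mu>. x \<in> (\<Union>n. K n)"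
    using finite L(3)
  proof eventually_elim
    case (elim x)
    obtain m :: nat where m: "pot \<kappa> \<nu> x < of_nat m"
      using elim(1) ennreal_Ex_less_of_nat by (auto simp: less_top)
    obtain n where n: "x \<in> L n" using elim(2) by blast
    have "pot \<kappa> \<nu> x \<le> of_nat (max m n)"
      using less_imp_le[OF m] of_nat_mono[OF max.cobounded1[of m n]] by (rule order_trans)
    moreover have "x \<in> L (max m n)"
      using n incseqD[OF L(1) max.cobounded2[of n m]] by blast
    ultimately have "x \<in> K (max m n)" by (simp add: K_def)
    then show ?case by blast
  qed
  moreover have "pot \<kappa> \<nu> x \<le> of_nat n" if "x \<in> K n" for n x using that by (simp add: K_def)
  ultimately show ?thesis by blast
qed

lemma menergy_le_bounded_kernel:
  assumes "finite_radon \<mu>" "finite_radon \<nu>" "AE x in \<mu>. x \<in> S" "AE y in \<nu>. y \<in> T"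
    and bound: "\<And>x y. x \<in> S \<Longrightarrow> y \<in> T \<Longrightarrow> \<kappa> x y \<le> b"
  shows "menergy \<kappa> \<mu> \<nu> \<le> b * emeasure \<nu> UNIV * emeasure \<mu> UNIV"
proof -
  have pot: "pot \<kappa> \<nu> x \<le> b * emeasure \<nu> UNIV" if "x \<in> S" for x
  proof -
    have "pot \<kappa> \<nu> x \<le> (\<integral>\<^sup>+ y. b \<partial>\<nu>)"
      unfolding pot_def using assms(4) bound[OF that]
      by (intro nn_integral_mono_AE) (auto elim: eventually_mono)
    then show ?thesis using finite_radon_space[OF assms(2)] by simp
  qed
  have "menergy \<kappa> \<mu> \<nu> \<le> (\<integral>\<^sup>+ x. b * emeasure \<nu> UNIV \<partial>\<mu>)"
    unfolding menergy_def using assms(3) pot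
    by (intro nn_integral_mono_AE) (auto elim: eventually_mono)
  then show ?thesis using finite_radon_space[OF assms(1)] by simp
qed

end

lemma closed_supp: "closed (supp M)"
proof -
  have "- supp M = \<Union>{U. open U \<and> emeasure M U = 0}" by (auto simp: supp_def)
  then show ?thesis unfolding closed_def by (metis (no_types, lifting) mem_Collect_eq open_Union)
qed

lemma supp_restrict_measure_subset:
  assumes "closed K" "sets M = sets borel" shows "supp (restrict_measure M K) \<subseteq> K"
proof
  fix x assume x: "x \<in> supp (restrict_measure M K)"
  have "emeasure (restrict_measure M K) (- K) = 0"
    using assms by (subst emeasure_restrict_measure) auto
  then show "x \<in> K" using x assms(1) unfolding supp_def by (auto simp: open_Compl)
qed

lemma enn2real_le_add_imp_le_add:
  assumes "x < \<infinity>" "y < \<infinity>" "z < \<infinity>" "enn2real x \<le> enn2real y + enn2real z"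
  shows "x \<le> y + z"
  using assms by (cases x; cases y; cases z) (auto simp: ennreal_leI simp flip: ennreal_plus)

section \<open>Measures of finite energy\<close>

locale energy_kernel = lsc_kernel \<kappa> for \<kappa> :: "'a::t2_space \<Rightarrow> 'a \<Rightarrow> ennreal" +
  fixes h :: real
  assumes positive_definite: "inE \<kappa> P N \<Longrightarrow> 0 \<le> senergy \<kappa> P N"
    and maximum_principle: "radon \<nu> \<Longrightarrow> compact (supp \<nu>) \<Longrightarrow> (SUP x\<in>supp \<nu>. pot \<kappa> \<nu> x) < \<infinity> \<Longrightarrow>
      pot \<kappa> \<nu> x \<le> ennreal h * (SUP x\<in>supp \<nu>. pot \<kappa> \<nu> x)"
begin

definition \<E> :: "'a measure set" where
  "\<E> = {\<mu>. finite_radon \<mu> \<and> menergy \<kappa> \<mu> \<mu> < \<infinity>}"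

lemma \<E>_finite_radon: "\<mu> \<in> \<E> \<Longrightarrow> finite_radon \<mu>"
  by (simp add: \<E>_def)

lemma \<E>_sets: "\<mu> \<in> \<E> \<Longrightarrow> sets \<mu> = sets borel"
  by (simp add: \<E>_finite_radon finite_radon_sets)

lemma \<E>_Eplus: "\<mu> \<in> \<E> \<Longrightarrow> \<mu> \<in> Eplus \<kappa>"
  by (simp add: \<E>_def Eplus_def finite_radon_def)

lemma \<E>_mono: "finite_radon \<mu> \<Longrightarrow> \<nu> \<in> \<E> \<Longrightarrow> \<mu> \<le> \<nu> \<Longrightarrow> \<mu> \<in> \<E>"
  using menergy_self_mono[of \<mu> \<nu>] by (auto simp: \<E>_def)

lemma \<E>_restrict_measure: "\<mu> \<in> \<E> \<Longrightarrow> B \<in> sets borel \<Longrightarrow> restrict_measure \<mu> B \<in> \<E>"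
  by (rule \<E>_mono[of _ \<mu>])
    (auto intro: finite_radon_restrict_measure restrict_measure_le simp: \<E>_finite_radon \<E>_sets)

lemma menergy_le_add:
  assumes "\<mu> \<in> \<E>" "\<nu> \<in> \<E>" and fin: "menergy \<kappa> \<mu> \<nu> < \<infinity>"
  shows "menergy \<kappa> \<mu> \<nu> \<le> menergy \<kappa> \<mu> \<mu> + menergy \<kappa> \<nu> \<nu>"
proof -
  have "inE \<kappa> \<mu> \<nu>" using assms by (simp add: inE_def \<E>_def finite_radon_def)
  from positive_definite[OF this]
  have "2 * enn2real (menergy \<kappa> \<mu> \<nu>) \<le> enn2real (menergy \<kappa> \<mu> \<mu>) + enn2real (menergy \<kappa> \<nu> \<nu>)"
    by (simp add: senergy_def)
  then have "enn2real (menergy \<kappa> \<mu> \<nu>) \<le> enn2real (menergy \<kappa> \<mu> \<mu>) + enn2real (menergy \<kappa> \<nu> \<nu>)"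
    using enn2real_nonneg[of "menergy \<kappa> \<mu> \<nu>"] by linarith
  with assms show ?thesis by (intro enn2real_le_add_imp_le_add) (auto simp: \<E>_def)
qed

lemma pot_restrict_measure_bounded:
  assumes \<mu>: "finite_radon \<mu>" and K: "compact K" and bound: "\<And>x. x \<in> K \<Longrightarrow> pot \<kappa> \<mu> x \<le> ennreal b"
  shows "pot \<kappa> (restrict_measure \<mu> K) x \<le> ennreal h * ennreal b"
proof -
  let ?\<mu> = "restrict_measure \<mu> K"
  note [simp] = finite_radon_sets[OF \<mu>]
  have [measurable]: "K \<in> sets borel" using K by (rule borel_compact)
  have supp: "supp ?\<mu> \<subseteq> K"
    using K by (intro supp_restrict_measure_subset compact_imp_closed) simp_all
  have "compact (K \<inter> supp ?\<mu>)" using K closed_supp by (rule compact_Int_closed)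
  then have "compact (supp ?\<mu>)" using supp by (simp add: Int_absorb1)
  moreover have sup: "(SUP x\<in>supp ?\<mu>. pot \<kappa> ?\<mu> x) \<le> ennreal b"
  proof (rule SUP_least)
    fix x assume "x \<in> supp ?\<mu>"
    then have "pot \<kappa> \<mu> x \<le> ennreal b" using supp bound by blast
    then show "pot \<kappa> ?\<mu> x \<le> ennreal b"
      using pot_mono[of ?\<mu> \<mu> x] restrict_measure_le[of K \<mu>] by (simp add: order_trans)
  qed
  moreover have "radon ?\<mu>"
    using finite_radon_restrict_measure[OF \<mu>] by (simp add: finite_radon_def)
  ultimately have "pot \<kappa> ?\<mu> x \<le> ennreal h * (SUP x\<in>supp ?\<mu>. pot \<kappa> ?\<mu> x)"
    by (intro maximum_principle) (auto intro: le_less_trans)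
  also have "\<dots> \<le> ennreal h * ennreal b" using sup by (rule mult_left_mono) simp
  finally show ?thesis .
qed

lemma menergy_restrict_measure_le:
  assumes \<mu>: "\<mu> \<in> \<E>" and \<nu>: "\<nu> \<in> \<E>" and K: "compact K"
    and bound: "\<And>x. x \<in> K \<Longrightarrow> pot \<kappa> \<mu> x \<le> ennreal b"
  shows "menergy \<kappa> (restrict_measure \<mu> K) \<nu> \<le> menergy \<kappa> \<mu> \<mu> + menergy \<kappa> \<nu> \<nu>"
proof -
  let ?\<mu> = "restrict_measure \<mu> K"
  have Kb: "K \<in> sets borel" using K by (rule borel_compact)
  have \<mu>K: "?\<mu> \<in> \<E>" using \<mu> Kb by (rule \<E>_restrict_measure)
  have "menergy \<kappa> \<nu> ?\<mu> \<le> (\<integral>\<^sup>+ x. ennreal h * ennreal b \<partial>\<nu>)"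
    unfolding menergy_def
    using pot_restrict_measure_bounded[OF \<E>_finite_radon[OF \<mu>] K bound] by (intro nn_integral_mono)
  also have "\<dots> < \<infinity>"
    using \<E>_finite_radon[OF \<nu>] by (auto simp: finite_radon_def finite_radon_space ennreal_mult_less_top)
  finally have "menergy \<kappa> ?\<mu> \<nu> < \<infinity>"
    using mutual_energy_commute \<mu>K \<nu> by (simp add: \<E>_finite_radon)
  from menergy_le_add[OF \<mu>K \<nu> this]
  show ?thesis
    using menergy_self_mono[OF \<E>_finite_radon[OF \<mu>K] \<E>_finite_radon[OF \<mu>]]
      restrict_measure_le[of K \<mu>] Kb
    by (simp add: \<E>_sets[OF \<mu>] add_right_mono order_trans)
qed

text \<open>Positive definiteness only speaks of pairs whose mutual energy is known to be finite. The maximum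
  principle supplies this for the restrictions of \<open>\<mu>\<close> to compact sets on which its potential is bounded,
  and these exhaust \<open>\<mu>\<close>.\<close>

lemma menergy_finite:
  assumes \<mu>: "\<mu> \<in> \<E>" and \<nu>: "\<nu> \<in> \<E>"
  shows "menergy \<kappa> \<mu> \<nu> < \<infinity>"
proof -
  have radon: "finite_radon \<mu>" "finite_radon \<nu>" using \<mu> \<nu> by (auto intro: \<E>_finite_radon)
  have "AE x in \<mu>. pot \<kappa> \<mu> x \<noteq> \<infinity>"
    using \<mu> pot_measurable[OF radon(1)] by (intro nn_integral_PInf_AE)
      (auto simp: \<E>_def menergy_def borel_measurable_finite_radon[OF radon(1)])
  from exhaustion_by_bounded_pot[OF radon(1) radon(1) this] obtain K :: "nat \<Rightarrow> 'a set"
    where K: "incseq K" "\<And>n. compact (K n)" "AE x in \<mu>. x \<in> (\<Union>n. K n)"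
      "\<And>n x. x \<in> K n \<Longrightarrow> pot \<kappa> \<mu> x \<le> of_nat n" by blast
  have "menergy \<kappa> \<mu> \<nu> = (SUP n. menergy \<kappa> (restrict_measure \<mu> (K n)) \<nu>)"
    using radon K(1) borel_compact[OF K(2)] K(3) by (rule menergy_eq_SUP_restrict_measure)
  also have "\<dots> \<le> menergy \<kappa> \<mu> \<mu> + menergy \<kappa> \<nu> \<nu>"
  proof (rule SUP_least, rule menergy_restrict_measure_le[OF \<mu> \<nu> K(2)])
    show "pot \<kappa> \<mu> x \<le> ennreal (real n)" if "x \<in> K n" for n x
      using K(4)[OF that] by (simp add: ennreal_of_nat_eq_real_of_nat)
  qed
  also have "\<dots> < \<infinity>" using \<mu> \<nu> by (simp add: \<E>_def)
  finally show ?thesis .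
qed

lemma \<E>_add_measure:
  assumes "\<mu> \<in> \<E>" "\<nu> \<in> \<E>" shows "add_measure \<mu> \<nu> \<in> \<E>"
proof -
  have radon: "finite_radon \<mu>" "finite_radon \<nu>" "finite_radon (add_measure \<mu> \<nu>)"
    using assms by (auto intro: \<E>_finite_radon finite_radon_add_measure)
  have "menergy \<kappa> (add_measure \<mu> \<nu>) (add_measure \<mu> \<nu>)
      = menergy \<kappa> (add_measure \<mu> \<nu>) \<mu> + menergy \<kappa> (add_measure \<mu> \<nu>) \<nu>"
    using radon by (subst menergy_add_measure_left)
      (simp_all add: finite_radon_sets mutual_energy_commute[OF radon(1,3)] mutual_energy_commute[OF radon(2,3)])
  also have "\<dots> = menergy \<kappa> \<mu> \<mu> + menergy \<kappa> \<nu> \<mu> + (menergy \<kappa> \<mu> \<nu> + menergy \<kappa> \<nu> \<nu>)"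
    using radon by (simp add: menergy_add_measure_left finite_radon_sets)
  also have "\<dots> < \<infinity>" using menergy_finite assms by simp
  finally show ?thesis using radon by (simp add: \<E>_def)
qed

lemma \<E>_scale_measure:
  assumes "\<mu> \<in> \<E>" "c < \<infinity>" shows "scale_measure c \<mu> \<in> \<E>"
proof -
  have radon: "finite_radon \<mu>" "finite_radon (scale_measure c \<mu>)"
    using assms by (auto intro: \<E>_finite_radon finite_radon_scale_measure)
  have "menergy \<kappa> (scale_measure c \<mu>) (scale_measure c \<mu>) = c * (c * menergy \<kappa> \<mu> \<mu>)"
    using radon by (simp add: mutual_energy_commute[OF radon] menergy_scale_measure_left finite_radon_sets)
  also have "\<dots> < \<infinity>" using assms by (simp add: \<E>_def ennreal_mult_less_top)
  finally show ?thesis using radon by (simp add: \<E>_def)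
qed

lemma \<E>_mix: "\<mu> \<in> \<E> \<Longrightarrow> \<nu> \<in> \<E> \<Longrightarrow> mix t \<mu> \<nu> \<in> \<E>"
  unfolding mix_def by (intro \<E>_add_measure \<E>_scale_measure) auto

lemma \<E>_null_measure: "null_measure borel \<in> \<E>"
  by (simp add: \<E>_def menergy_def finite_radon_null_measure)

definition energy :: "'a measure \<Rightarrow> 'a measure \<Rightarrow> real" where
  "energy \<mu> \<nu> = enn2real (menergy \<kappa> \<mu> \<nu>)"

lemma energy_nonneg: "0 \<le> energy \<mu> \<nu>"
  by (simp add: energy_def)

lemma ennreal_energy: "\<mu> \<in> \<E> \<Longrightarrow> \<nu> \<in> \<E> \<Longrightarrow> ennreal (energy \<mu> \<nu>) = menergy \<kappa> \<mu> \<nu>"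
  using menergy_finite by (simp add: energy_def)

lemma energy_commute: "\<mu> \<in> \<E> \<Longrightarrow> \<nu> \<in> \<E> \<Longrightarrow> energy \<mu> \<nu> = energy \<nu> \<mu>"
  unfolding energy_def by (simp add: mutual_energy_commute \<E>_finite_radon)

lemma energy_null_measure [simp]:
  "energy (null_measure borel) \<mu> = 0" "energy \<mu> (null_measure borel) = 0"
  by (simp_all add: energy_def menergy_def pot_def)

lemma energy_add_measure_left:
  "\<mu> \<in> \<E> \<Longrightarrow> \<mu>' \<in> \<E> \<Longrightarrow> \<nu> \<in> \<E> \<Longrightarrow> energy (add_measure \<mu> \<mu>') \<nu> = energy \<mu> \<nu> + energy \<mu>' \<nu>"
  unfolding energy_def
  by (simp add: menergy_add_measure_left \<E>_finite_radon \<E>_sets enn2real_plus menergy_finite[simplified])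

lemma energy_scale_measure_left:
  "\<mu> \<in> \<E> \<Longrightarrow> \<nu> \<in> \<E> \<Longrightarrow> 0 \<le> c \<Longrightarrow> energy (scale_measure (ennreal c) \<mu>) \<nu> = c * energy \<mu> \<nu>"
  unfolding energy_def by (simp add: menergy_scale_measure_left \<E>_finite_radon \<E>_sets enn2real_mult)

lemma energy_mix_left:
  "\<mu> \<in> \<E> \<Longrightarrow> \<mu>' \<in> \<E> \<Longrightarrow> \<nu> \<in> \<E> \<Longrightarrow> 0 \<le> t \<Longrightarrow> t \<le> 1 \<Longrightarrow>
    energy (mix t \<mu> \<mu>') \<nu> = (1 - t) * energy \<mu> \<nu> + t * energy \<mu>' \<nu>"
  unfolding mix_def by (simp add: energy_add_measure_left energy_scale_measure_left \<E>_scale_measure)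

lemma sdist_eq: "sdist \<kappa> \<mu> \<nu> = sqrt (energy \<mu> \<mu> + energy \<nu> \<nu> - 2 * energy \<mu> \<nu>)"
  by (simp add: sdist_def energy_def)

lemma energy_positive_definite:
  assumes "\<mu> \<in> \<E>" "\<nu> \<in> \<E>" shows "0 \<le> energy \<mu> \<mu> + energy \<nu> \<nu> - 2 * energy \<mu> \<nu>"
proof -
  have "inE \<kappa> \<mu> \<nu>" using assms menergy_finite by (auto simp: inE_def \<E>_def finite_radon_def)
  from positive_definite[OF this] show ?thesis by (simp add: senergy_def energy_def)
qed

lemma pot_AE_finite:
  assumes "\<mu> \<in> \<E>" "\<nu> \<in> \<E>" shows "AE x in \<mu>. pot \<kappa> \<nu> x \<noteq> \<infinity>"
  using menergy_finite[OF assms] pot_measurable[OF \<E>_finite_radon[OF assms(2)]]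
  by (intro nn_integral_PInf_AE)
    (auto simp: menergy_def borel_measurable_finite_radon[OF \<E>_finite_radon[OF assms(1)]])

lemma has_bochner_integral_pot:
  assumes "\<mu> \<in> \<E>" "\<nu> \<in> \<E>"
  shows "has_bochner_integral \<mu> (\<lambda>x. enn2real (pot \<kappa> \<nu> x)) (energy \<mu> \<nu>)"
proof (rule has_bochner_integral_nn_integral)
  have [measurable]: "pot \<kappa> \<nu> \<in> borel_measurable \<mu>"
    using assms pot_measurable by (simp add: borel_measurable_finite_radon \<E>_finite_radon)
  show "(\<lambda>x. enn2real (pot \<kappa> \<nu> x)) \<in> borel_measurable \<mu>" by measurable
  have "(\<integral>\<^sup>+ x. ennreal (enn2real (pot \<kappa> \<nu> x)) \<partial>\<mu>) = menergy \<kappa> \<mu> \<nu>"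
    unfolding menergy_def using pot_AE_finite[OF assms]
    by (intro nn_integral_cong_AE) (auto simp: ennreal_enn2real_if)
  then show "(\<integral>\<^sup>+ x. ennreal (enn2real (pot \<kappa> \<nu> x)) \<partial>\<mu>) = ennreal (energy \<mu> \<nu>)"
    by (simp add: ennreal_energy assms)
qed (auto simp: energy_nonneg)

lemma
  assumes sum: "sum_measure S \<mu> \<in> \<E>" and \<mu>: "\<And>j. j \<in> S \<Longrightarrow> finite_radon (\<mu> j)" and i: "i \<in> S"
  shows \<E>_sum_measure_component: "\<mu> i \<in> \<E>"
    and energy_component_le: "energy (\<mu> i) (\<mu> i) \<le> energy (sum_measure S \<mu>) (sum_measure S \<mu>)"
proof -
  have component_le: "\<mu> i \<le> sum_measure S \<mu>"
    using \<mu> i by (intro le_sum_measure) (auto simp: finite_radon_sets)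
  show "\<mu> i \<in> \<E>" using \<mu>[OF i] sum component_le by (rule \<E>_mono)
  have "menergy \<kappa> (\<mu> i) (\<mu> i) \<le> menergy \<kappa> (sum_measure S \<mu>) (sum_measure S \<mu>)"
    using \<mu>[OF i] \<E>_finite_radon[OF sum] component_le by (rule menergy_self_mono)
  then show "energy (\<mu> i) (\<mu> i) \<le> energy (sum_measure S \<mu>) (sum_measure S \<mu>)"
    using sum by (auto simp: energy_def \<E>_def intro: enn2real_mono)
qed

lemma energy_sum_measure_has_sum:
  assumes sum: "sum_measure S \<mu> \<in> \<E>" and \<mu>: "\<And>j. j \<in> S \<Longrightarrow> finite_radon (\<mu> j)" and \<xi>: "\<xi> \<in> \<E>"
  shows "((\<lambda>j. energy (\<mu> j) \<xi>) has_sum energy (sum_measure S \<mu>) \<xi>) S"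
proof (subst has_sum_iff_nn_integral_count_space)
  have "(\<integral>\<^sup>+ j. ennreal (energy (\<mu> j) \<xi>) \<partial>count_space S) = (\<integral>\<^sup>+ j. menergy \<kappa> (\<mu> j) \<xi> \<partial>count_space S)"
    using \<E>_sum_measure_component[OF sum \<mu>] \<xi> by (intro nn_integral_cong) (simp add: ennreal_energy)
  also have "\<dots> = menergy \<kappa> (sum_measure S \<mu>) \<xi>"
    using \<mu> \<xi>
    by (intro menergy_sum_measure_left[symmetric]) (auto simp: finite_radon_sets \<E>_finite_radon)
  also have "\<dots> = ennreal (energy (sum_measure S \<mu>) \<xi>)"
    using ennreal_energy[OF sum \<xi>] by simp
  finally show "(\<integral>\<^sup>+ j. ennreal (energy (\<mu> j) \<xi>) \<partial>count_space S) = ennreal (energy (sum_measure S \<mu>) \<xi>)" .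
qed (auto simp: energy_nonneg)

lemma \<E>_sum_measure_update:
  assumes sum: "sum_measure S \<mu> \<in> \<E>" and \<mu>: "\<And>j. j \<in> S \<Longrightarrow> finite_radon (\<mu> j)"
    and S: "countable S" and \<nu>: "\<nu> \<in> \<E>"
  shows "sum_measure S (\<mu>(i := \<nu>)) \<in> \<E>"
proof (cases "i \<in> S")
  case False
  then have "sum_measure S (\<mu>(i := \<nu>)) = sum_measure S \<mu>" by (intro sum_measure_cong) auto
  with sum show ?thesis by simp
next
  case i: True
  let ?\<mu> = "\<mu>(i := \<nu>)" and ?B = "add_measure (sum_measure S \<mu>) \<nu>"
  have radon: "finite_radon (?\<mu> j)" if "j \<in> S" for j using \<mu>[OF that] \<E>_finite_radon[OF \<nu>] by simp
  have sets: "sets (?\<mu> j) = sets borel" "sets (\<mu> j) = sets borel" if "j \<in> S" for j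
    by (fact finite_radon_sets[OF radon[OF that]] finite_radon_sets[OF \<mu>[OF that]])+
  have emeasure_le: "(\<integral>\<^sup>+ j. emeasure (?\<mu> j) B \<partial>count_space S) \<le> emeasure ?B B"
    if B: "B \<in> sets borel" for B
  proof -
    have "emeasure (?\<mu> j) B \<le> emeasure (\<mu> j) B + emeasure \<nu> B * indicator {i} j" for j
      by (cases "j = i") auto
    then have "(\<integral>\<^sup>+ j. emeasure (?\<mu> j) B \<partial>count_space S)
        \<le> (\<integral>\<^sup>+ j. emeasure (\<mu> j) B + emeasure \<nu> B * indicator {i} j \<partial>count_space S)"
      by (rule nn_integral_mono)
    also have "\<dots> = (\<integral>\<^sup>+ j. emeasure (\<mu> j) B \<partial>count_space S) + emeasure \<nu> B"
      using i by (subst nn_integral_add) (simp_all add: nn_integral_cmult_indicator)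
    also have "\<dots> = emeasure ?B B"
      using sets(2) B by (simp add: emeasure_add_measure emeasure_sum_measure \<E>_sets[OF \<nu>])
    finally show ?thesis .
  qed
  have B: "?B \<in> \<E>" using sum \<nu> by (rule \<E>_add_measure)
  then have "emeasure ?B UNIV < \<infinity>" by (simp add: \<E>_def finite_radon_def)
  then have "(\<integral>\<^sup>+ j. emeasure (?\<mu> j) UNIV \<partial>count_space S) < \<infinity>"
    by (rule le_less_trans[OF emeasure_le, rotated]) simp
  with radon S have "finite_radon (sum_measure S ?\<mu>)"
    by (rule finite_radon_sum_measure)
  moreover have "sum_measure S ?\<mu> \<le> ?B"
    by (subst le_measure) (simp_all add: emeasure_sum_measure[OF sets(1)] emeasure_le del: fun_upd_apply)
  ultimately show ?thesis using B \<E>_mono by blast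
qed

end

section \<open>Signed measures of finite energy\<close>

definition signed_add :: "'a::topological_space measure \<times> 'a measure \<Rightarrow> 'a measure \<times> 'a measure
    \<Rightarrow> 'a measure \<times> 'a measure" (infixl \<open>\<oplus>\<close> 65) where
  "\<sigma> \<oplus> \<tau> = (add_measure (fst \<sigma>) (fst \<tau>), add_measure (snd \<sigma>) (snd \<tau>))"

abbreviation signed_diff :: "'a::topological_space measure \<times> 'a measure \<Rightarrow> 'a measure \<times> 'a measure
    \<Rightarrow> 'a measure \<times> 'a measure" (infixl \<open>\<ominus>\<close> 65) where
  "\<sigma> \<ominus> \<tau> \<equiv> \<sigma> \<oplus> prod.swap \<tau>"

lemma nonneg_quadratic_imp_discriminant_le:
  fixes a b c :: real
  assumes "\<And>t. 0 \<le> a + 2 * t * b + t\<^sup>2 * c" "0 \<le> c"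
  shows "b\<^sup>2 \<le> a * c"
proof (cases "c = 0")
  case True
  have "b = 0"
  proof (rule ccontr)
    assume "b \<noteq> 0"
    then show False using assms(1)[of "- (a + 1) / (2 * b)"] True by (simp add: field_simps)
  qed
  then show ?thesis using True by simp
next
  case False
  then have c: "0 < c" using assms(2) by simp
  have "0 \<le> c * (a + 2 * (- b / c) * b + (- b / c)\<^sup>2 * c)"
    using assms(1)[of "- b / c"] c by (intro mult_nonneg_nonneg) auto
  also have "\<dots> = a * c - b\<^sup>2" using c by (simp add: field_simps power2_eq_square)
  finally show ?thesis by simp
qed

context energy_kernel
begin

lemma signed_add_mem: "\<sigma> \<in> \<E> \<times> \<E> \<Longrightarrow> \<tau> \<in> \<E> \<times> \<E> \<Longrightarrow> \<sigma> \<oplus> \<tau> \<in> \<E> \<times> \<E>"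
  by (auto simp: signed_add_def intro: \<E>_add_measure)

lemma swap_mem: "\<sigma> \<in> \<E> \<times> \<E> \<Longrightarrow> prod.swap \<sigma> \<in> \<E> \<times> \<E>"
  by auto

definition signed_energy :: "'a measure \<times> 'a measure \<Rightarrow> 'a measure \<times> 'a measure \<Rightarrow> real"
    (\<open>\<langle>_,/ _\<rangle>\<close>) where
  "\<langle>\<sigma>, \<tau>\<rangle> = energy (fst \<sigma>) (fst \<tau>) + energy (snd \<sigma>) (snd \<tau>)
     - energy (fst \<sigma>) (snd \<tau>) - energy (snd \<sigma>) (fst \<tau>)"

lemma signed_energy_commute: "\<sigma> \<in> \<E> \<times> \<E> \<Longrightarrow> \<tau> \<in> \<E> \<times> \<E> \<Longrightarrow> \<langle>\<sigma>, \<tau>\<rangle> = \<langle>\<tau>, \<sigma>\<rangle>"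
  by (auto simp: signed_energy_def energy_commute)

lemma signed_energy_swap [simp]: "\<langle>prod.swap \<sigma>, \<tau>\<rangle> = - \<langle>\<sigma>, \<tau>\<rangle>" "\<langle>\<sigma>, prod.swap \<tau>\<rangle> = - \<langle>\<sigma>, \<tau>\<rangle>"
  by (simp_all add: signed_energy_def)

lemma signed_energy_add_left:
  "\<sigma> \<in> \<E> \<times> \<E> \<Longrightarrow> \<sigma>' \<in> \<E> \<times> \<E> \<Longrightarrow> \<tau> \<in> \<E> \<times> \<E> \<Longrightarrow> \<langle>\<sigma> \<oplus> \<sigma>', \<tau>\<rangle> = \<langle>\<sigma>, \<tau>\<rangle> + \<langle>\<sigma>', \<tau>\<rangle>"
  by (auto simp: signed_energy_def signed_add_def energy_add_measure_left)

lemma signed_energy_add_right: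
  assumes "\<sigma> \<in> \<E> \<times> \<E>" "\<tau> \<in> \<E> \<times> \<E>" "\<tau>' \<in> \<E> \<times> \<E>"
  shows "\<langle>\<sigma>, \<tau> \<oplus> \<tau>'\<rangle> = \<langle>\<sigma>, \<tau>\<rangle> + \<langle>\<sigma>, \<tau>'\<rangle>"
  using assms signed_energy_add_left[OF assms(2,3,1)]
  by (simp only: signed_energy_commute[of \<sigma>] signed_add_mem)

lemma signed_energy_self_nonneg: "\<sigma> \<in> \<E> \<times> \<E> \<Longrightarrow> 0 \<le> \<langle>\<sigma>, \<sigma>\<rangle>"
  using energy_positive_definite[of "fst \<sigma>" "snd \<sigma>"] energy_commute[of "fst \<sigma>" "snd \<sigma>"]
  by (auto simp: signed_energy_def)

lemma signed_energy_diff_self: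
  assumes "\<sigma> \<in> \<E> \<times> \<E>" "\<tau> \<in> \<E> \<times> \<E>"
  shows "\<langle>\<sigma> \<ominus> \<tau>, \<sigma> \<ominus> \<tau>\<rangle> = \<langle>\<sigma>, \<sigma>\<rangle> - 2 * \<langle>\<sigma>, \<tau>\<rangle> + \<langle>\<tau>, \<tau>\<rangle>"
  using assms signed_energy_commute[OF assms]
  by (simp add: signed_energy_add_left signed_energy_add_right signed_add_mem swap_mem
      del: mem_Times_iff)

lemma signed_energy_diff_translate:
  assumes "\<sigma> \<in> \<E> \<times> \<E>" "\<tau> \<in> \<E> \<times> \<E>" "\<xi> \<in> \<E> \<times> \<E>"
  shows "\<langle>(\<sigma> \<oplus> \<xi>) \<ominus> (\<tau> \<oplus> \<xi>), (\<sigma> \<oplus> \<xi>) \<ominus> (\<tau> \<oplus> \<xi>)\<rangle> = \<langle>\<sigma> \<ominus> \<tau>, \<sigma> \<ominus> \<tau>\<rangle>"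
  using assms signed_energy_commute[OF assms(1,3)] signed_energy_commute[OF assms(2,3)]
  by (simp add: signed_energy_diff_self signed_energy_add_left signed_energy_add_right signed_add_mem
      del: mem_Times_iff)

lemma signed_energy_perturbation:
  assumes mem: "\<sigma> \<in> \<E> \<times> \<E>" "\<sigma>' \<in> \<E> \<times> \<E>" "\<rho> \<in> \<E> \<times> \<E>" "\<tau> \<in> \<E> \<times> \<E>"
    and \<sigma>': "\<And>\<xi>. \<xi> \<in> \<E> \<times> \<E> \<Longrightarrow> \<langle>\<sigma>', \<xi>\<rangle> = \<langle>\<sigma>, \<xi>\<rangle> + t * (\<langle>\<rho>, \<xi>\<rangle> - \<langle>\<tau>, \<xi>\<rangle>)"
  shows "\<langle>\<sigma>', \<sigma>'\<rangle> = \<langle>\<sigma>, \<sigma>\<rangle> + 2 * t * (\<langle>\<rho>, \<sigma>\<rangle> - \<langle>\<tau>, \<sigma>\<rangle>) + t\<^sup>2 * (\<langle>\<rho>, \<rho>\<rangle> - 2 * \<langle>\<rho>, \<tau>\<rangle> + \<langle>\<tau>, \<tau>\<rangle>)"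
proof -
  have right: "\<langle>\<xi>, \<sigma>'\<rangle> = \<langle>\<sigma>, \<xi>\<rangle> + t * (\<langle>\<rho>, \<xi>\<rangle> - \<langle>\<tau>, \<xi>\<rangle>)" if "\<xi> \<in> \<E> \<times> \<E>" for \<xi>
    using signed_energy_commute[OF that mem(2)] \<sigma>'[OF that] by simp
  show ?thesis
    unfolding \<sigma>'[OF mem(2)] right[OF mem(1)] right[OF mem(3)] right[OF mem(4)]
      signed_energy_commute[OF mem(1,3)] signed_energy_commute[OF mem(1,4)]
      signed_energy_commute[OF mem(4,3)]
    by (simp add: algebra_simps power2_eq_square)
qed

theorem signed_energy_Cauchy_Schwarz:
  assumes \<sigma>: "\<sigma> \<in> \<E> \<times> \<E>" and \<tau>: "\<tau> \<in> \<E> \<times> \<E>"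
  shows "\<bar>\<langle>\<sigma>, \<tau>\<rangle>\<bar> \<le> sqrt \<langle>\<sigma>, \<sigma>\<rangle> * sqrt \<langle>\<tau>, \<tau>\<rangle>"
proof -
  have nonneg: "0 \<le> \<langle>\<sigma>, \<sigma>\<rangle> + 2 * t * \<langle>\<sigma>, \<rho>\<rangle> + t\<^sup>2 * \<langle>\<rho>, \<rho>\<rangle>" if t: "0 \<le> t" and \<rho>: "\<rho> \<in> \<E> \<times> \<E>" for t \<rho>
  proof -
    define \<rho>' where "\<rho>' = map_prod (scale_measure (ennreal t)) (scale_measure (ennreal t)) \<rho>"
    have \<rho>': "\<rho>' \<in> \<E> \<times> \<E>" using \<rho> by (auto simp: \<rho>'_def \<E>_scale_measure)
    have scale: "\<langle>\<rho>', \<xi>\<rangle> = t * \<langle>\<rho>, \<xi>\<rangle>" if "\<xi> \<in> \<E> \<times> \<E>" for \<xi>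
      using t \<rho> that by (auto simp: \<rho>'_def signed_energy_def energy_scale_measure_left algebra_simps)
    have "0 \<le> \<langle>\<sigma> \<oplus> \<rho>', \<sigma> \<oplus> \<rho>'\<rangle>"
      using \<sigma> \<rho>' by (intro signed_energy_self_nonneg signed_add_mem)
    also have "\<dots> = \<langle>\<sigma>, \<sigma>\<rangle> + 2 * \<langle>\<rho>', \<sigma>\<rangle> + \<langle>\<rho>', \<rho>'\<rangle>"
      using \<sigma> \<rho>' signed_energy_commute[OF \<sigma> \<rho>']
      by (simp add: signed_energy_add_left signed_energy_add_right signed_add_mem del: mem_Times_iff)
    also have "\<dots> = \<langle>\<sigma>, \<sigma>\<rangle> + 2 * t * \<langle>\<sigma>, \<rho>\<rangle> + t\<^sup>2 * \<langle>\<rho>, \<rho>\<rangle>"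
      using signed_energy_commute[OF \<sigma> \<rho>] signed_energy_commute[OF \<rho> \<rho>']
      by (simp add: scale[OF \<sigma>] scale[OF \<rho>] scale[OF \<rho>'] power2_eq_square)
    finally show ?thesis .
  qed
  have "0 \<le> \<langle>\<sigma>, \<sigma>\<rangle> + 2 * t * \<langle>\<sigma>, \<tau>\<rangle> + t\<^sup>2 * \<langle>\<tau>, \<tau>\<rangle>" for t
    using nonneg[of t \<tau>] nonneg[of "- t" "prod.swap \<tau>"] \<tau> by (cases "0 \<le> t") auto
  from nonneg_quadratic_imp_discriminant_le[OF this signed_energy_self_nonneg[OF \<tau>]]
  have "sqrt (\<langle>\<sigma>, \<tau>\<rangle>\<^sup>2) \<le> sqrt (\<langle>\<sigma>, \<sigma>\<rangle> * \<langle>\<tau>, \<tau>\<rangle>)" by (rule real_sqrt_le_mono)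
  then show ?thesis by (simp add: real_sqrt_mult)
qed

lemma signed_energy_diff_le:
  assumes "\<sigma> \<in> \<E> \<times> \<E>" "\<sigma>' \<in> \<E> \<times> \<E>" "\<tau> \<in> \<E> \<times> \<E>"
  shows "\<bar>\<langle>\<sigma>, \<tau>\<rangle> - \<langle>\<sigma>', \<tau>\<rangle>\<bar> \<le> sqrt \<langle>\<sigma> \<ominus> \<sigma>', \<sigma> \<ominus> \<sigma>'\<rangle> * sqrt \<langle>\<tau>, \<tau>\<rangle>"
  using assms signed_energy_Cauchy_Schwarz[of "\<sigma> \<ominus> \<sigma>'" \<tau>]
  by (simp add: signed_energy_add_left signed_add_mem swap_mem del: mem_Times_iff)

lemma energy_diff_le_sdist:
  assumes "\<mu> \<in> \<E>" "\<nu> \<in> \<E>" "\<xi> \<in> \<E>"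
  shows "\<bar>energy \<mu> \<xi> - energy \<nu> \<xi>\<bar> \<le> sdist \<kappa> \<mu> \<nu> * sqrt (energy \<xi> \<xi>)"
  using signed_energy_Cauchy_Schwarz[of "(\<mu>, \<nu>)" "(\<xi>, null_measure borel)"] assms
    energy_commute[OF assms(1,2)] \<E>_null_measure
  by (simp add: signed_energy_def sdist_eq)

lemma signed_energy_tendsto_weak_strong:
  assumes \<rho>: "\<forall>\<^sub>F s in F. \<rho> s \<in> \<E> \<times> \<E> \<and> \<langle>\<rho> s, \<rho> s\<rangle> \<le> C"
    and \<sigma>: "\<forall>\<^sub>F s in F. \<sigma> s \<in> \<E> \<times> \<E>" and \<tau>: "\<tau> \<in> \<E> \<times> \<E>"
    and weak: "((\<lambda>s. \<langle>\<rho> s, \<tau>\<rangle>) \<longlongrightarrow> l) F"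
    and strong: "((\<lambda>s. sqrt \<langle>\<sigma> s \<ominus> \<tau>, \<sigma> s \<ominus> \<tau>\<rangle>) \<longlongrightarrow> 0) F"
  shows "((\<lambda>s. \<langle>\<rho> s, \<sigma> s\<rangle>) \<longlongrightarrow> l) F"
proof -
  have "((\<lambda>s. \<langle>\<sigma> s, \<rho> s\<rangle> - \<langle>\<tau>, \<rho> s\<rangle>) \<longlongrightarrow> 0) F"
  proof (rule Lim_null_comparison)
    show "((\<lambda>s. sqrt \<langle>\<sigma> s \<ominus> \<tau>, \<sigma> s \<ominus> \<tau>\<rangle> * sqrt C) \<longlongrightarrow> 0) F"
      using strong by (rule tendsto_mult_left_zero)
    show "\<forall>\<^sub>F s in F. norm (\<langle>\<sigma> s, \<rho> s\<rangle> - \<langle>\<tau>, \<rho> s\<rangle>) \<le> sqrt \<langle>\<sigma> s \<ominus> \<tau>, \<sigma> s \<ominus> \<tau>\<rangle> * sqrt C"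
      using \<rho> \<sigma>
    proof eventually_elim
      case (elim s)
      then have "norm (\<langle>\<sigma> s, \<rho> s\<rangle> - \<langle>\<tau>, \<rho> s\<rangle>) \<le> sqrt \<langle>\<sigma> s \<ominus> \<tau>, \<sigma> s \<ominus> \<tau>\<rangle> * sqrt \<langle>\<rho> s, \<rho> s\<rangle>"
        using \<tau> by (simp only: real_norm_def signed_energy_diff_le)
      also have "\<dots> \<le> sqrt \<langle>\<sigma> s \<ominus> \<tau>, \<sigma> s \<ominus> \<tau>\<rangle> * sqrt C"
        using elim \<tau>
        by (intro mult_left_mono real_sqrt_ge_zero signed_energy_self_nonneg signed_add_mem swap_mem) auto
      finally show ?case .
    qed
  qed
  with weak have "((\<lambda>s. \<langle>\<rho> s, \<tau>\<rangle> + (\<langle>\<sigma> s, \<rho> s\<rangle> - \<langle>\<tau>, \<rho> s\<rangle>)) \<longlongrightarrow> l + 0) F" by (rule tendsto_add)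
  moreover have "\<forall>\<^sub>F s in F. \<langle>\<rho> s, \<tau>\<rangle> + (\<langle>\<sigma> s, \<rho> s\<rangle> - \<langle>\<tau>, \<rho> s\<rangle>) = \<langle>\<rho> s, \<sigma> s\<rangle>"
    using \<rho> \<sigma>
  proof eventually_elim
    case (elim s)
    then show ?case
      using \<tau> signed_energy_commute[of "\<rho> s" \<tau>] signed_energy_commute[of "\<rho> s" "\<sigma> s"] by linarith
  qed
  ultimately show ?thesis by (simp add: tendsto_cong)
qed

end

section \<open>Vague convergence\<close>

lemma Cc_measurable: "f \<in> Cc \<Longrightarrow> f \<in> borel_measurable borel"
  by (auto simp: Cc_def intro: borel_measurable_continuous_onI)

lemma Cc_bounded:
  assumes "f \<in> Cc" shows "\<exists>b. \<forall>x. \<bar>f x\<bar> \<le> b"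
proof -
  obtain K where K: "compact K" "\<And>x. x \<notin> K \<Longrightarrow> f x = 0" and f: "continuous_on UNIV f"
    using assms by (auto simp: Cc_def)
  have "bounded (f ` K)"
    using f K(1)
    by (intro compact_imp_bounded compact_continuous_image) (auto intro: continuous_on_subset)
  then obtain b where b: "\<And>x. x \<in> K \<Longrightarrow> \<bar>f x\<bar> \<le> b" by (auto simp: bounded_iff)
  have "\<bar>f x\<bar> \<le> max b 0" for x using b[of x] K(2)[of x] by (cases "x \<in> K") auto
  then show ?thesis by blast
qed

lemma Cc_integrable:
  fixes M :: "'a::t2_space measure"
  assumes f: "f \<in> Cc" and M: "radon M" shows "integrable M f"
proof -
  obtain b where b: "\<And>x. \<bar>f x\<bar> \<le> b" using Cc_bounded[OF f] by blast
  obtain K where K: "compact K" "\<And>x. x \<notin> K \<Longrightarrow> f x = 0" using f by (auto simp: Cc_def)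
  have sets: "sets M = sets borel" using M by (simp add: radon_def)
  have Kb: "K \<in> sets M" unfolding sets using K(1) by (rule borel_compact)
  have "\<forall>K. compact K \<longrightarrow> emeasure M K < \<infinity>" using M unfolding radon_def by (elim conjE)
  then have "emeasure M K < \<infinity>" using K(1) by blast
  with Kb have "integrable M (indicator K :: 'a \<Rightarrow> real)" by (rule integrable_real_indicator)
  then have "integrable M (\<lambda>x. b * indicator K x)" by simp
  then show ?thesis
  proof (rule Bochner_Integration.integrable_bound)
    show "f \<in> borel_measurable M"
      using Cc_measurable[OF f] sets by (simp cong: measurable_cong_sets)
    have "norm (f x) \<le> norm (b * indicator K x)" for x
      using order_trans[OF b abs_ge_self] K(2)[of x] by (cases "x \<in> K") simp_all
    then show "AE x in M. norm (f x) \<le> norm (b * indicator K x)" by simp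
  qed
qed

lemma Cc_Urysohn:
  fixes K :: "'a::t2_space set"
  assumes lc: "locally_compact_space (euclidean :: 'a topology)" and K: "compact K"
  obtains f where "f \<in> Cc" "\<And>x. 0 \<le> f x \<and> f x \<le> 1" "\<And>x. x \<in> K \<Longrightarrow> f x = 1"
proof -
  have Hausdorff: "Hausdorff_space (euclidean :: 'a topology)"
    by (simp add: Hausdorff_space_def disjnt_def) (metis hausdorff)
  have regular: "completely_regular_space (euclidean :: 'a topology)"
    using locally_compact_regular_imp_completely_regular_space[OF lc] Hausdorff by simp
  obtain U L where UL: "open U" "compact L" "K \<subseteq> U" "U \<subseteq> L"
    using lc K Hausdorff locally_compact_space_compact_closed_compact[of "euclidean :: 'a topology"]
    by auto
  have "compactin euclidean K" "closedin euclidean (- U)" "disjnt K (- U)"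
    using K UL by (auto simp: disjnt_def)
  from Urysohn_completely_regular_compact_closed[OF zero_le_one regular this]
  obtain f :: "'a \<Rightarrow> real" where f: "continuous_map euclidean (top_of_set {0..1}) f"
    "f ` (- U) \<subseteq> {0}" "f ` K \<subseteq> {1}" .
  show thesis
  proof (rule that)
    have "continuous_on UNIV f" using f(1) by (auto simp: continuous_map_in_subtopology)
    moreover have "f x = 0" if "x \<notin> L" for x using f(2) UL(4) that by blast
    ultimately show "f \<in> Cc" using UL(2) by (auto simp: Cc_def)
    show "0 \<le> f x \<and> f x \<le> 1" for x using f(1) by (auto simp: continuous_map_in_subtopology)
    show "f x = 1" if "x \<in> K" for x using f(3) that by blast
  qed
qed

definition vague_nhd :: "'a::topological_space measure \<Rightarrow> ('a \<Rightarrow> real) set \<Rightarrow> real \<Rightarrow> 'a measure set" where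
  "vague_nhd \<nu> fs \<epsilon> = {\<mu>. \<forall>f\<in>fs. \<bar>(\<integral>x. f x \<partial>\<mu>) - (\<integral>x. f x \<partial>\<nu>)\<bar> < \<epsilon>}"

lemma vague_nhd_Int_subset:
  "vague_nhd \<nu> (fs \<union> gs) (min \<epsilon> \<delta>) \<subseteq> vague_nhd \<nu> fs \<epsilon> \<inter> vague_nhd \<nu> gs \<delta>"
  by (auto simp: vague_nhd_def)

lemma mix_mem_vague_nhd:
  fixes M N :: "'a::t2_space measure"
  assumes radon: "radon M" "radon N" and fs: "fs \<subseteq> Cc" and t: "0 \<le> t" "t \<le> 1"
    and mem: "M \<in> vague_nhd \<nu> fs \<epsilon>" "N \<in> vague_nhd \<nu> fs \<epsilon>"
  shows "mix t M N \<in> vague_nhd \<nu> fs \<epsilon>"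
proof -
  have "\<bar>(\<integral>x. f x \<partial>mix t M N) - (\<integral>x. f x \<partial>\<nu>)\<bar> < \<epsilon>" if "f \<in> fs" for f
  proof -
    have "f \<in> Cc" using fs that by blast
    then have "integrable M f" "integrable N f" using radon by (auto intro: Cc_integrable)
    moreover have "sets M = sets borel" "sets N = sets borel" using radon by (simp_all add: radon_def)
    ultimately have "(\<integral>x. f x \<partial>mix t M N) = (1 - t) * (\<integral>x. f x \<partial>M) + t * (\<integral>x. f x \<partial>N)"
      using t by (intro integral_mix)
    moreover have "(\<integral>x. f x \<partial>M) \<in> ball (\<integral>x. f x \<partial>\<nu>) \<epsilon>" "(\<integral>x. f x \<partial>N) \<in> ball (\<integral>x. f x \<partial>\<nu>) \<epsilon>"
      using mem that by (simp_all add: vague_nhd_def dist_real_def abs_minus_commute)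
    then have "(1 - t) * (\<integral>x. f x \<partial>M) + t * (\<integral>x. f x \<partial>N) \<in> ball (\<integral>x. f x \<partial>\<nu>) \<epsilon>"
      using convexD[OF convex_ball _ _ _ t(1), of "\<integral>x. f x \<partial>M" _ _ "\<integral>x. f x \<partial>N" "1 - t"] t(2) by simp
    ultimately show ?thesis by (simp add: dist_real_def abs_minus_commute)
  qed
  then show ?thesis by (simp add: vague_nhd_def)
qed

lemma eventually_vague_nhd:
  assumes fs: "finite fs" "fs \<subseteq> Cc" and \<epsilon>: "0 < \<epsilon>"
    and vague: "\<And>f. f \<in> Cc \<Longrightarrow> ((\<lambda>s. \<integral>x. f x \<partial>m s) \<longlongrightarrow> (\<integral>x. f x \<partial>\<nu>)) F"
  shows "\<forall>\<^sub>F s in F. m s \<in> vague_nhd \<nu> fs \<epsilon>"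
proof -
  have "\<forall>\<^sub>F s in F. \<bar>(\<integral>x. f x \<partial>m s) - (\<integral>x. f x \<partial>\<nu>)\<bar> < \<epsilon>" if "f \<in> fs" for f
    using tendstoD[OF vague \<epsilon>, of f] fs(2) that by (auto simp: dist_real_def)
  then show ?thesis by (simp add: vague_nhd_def eventually_ball_finite_distrib[OF fs(1)])
qed

lemma vague_clusterI:
  assumes F: "F \<noteq> bot" and nhd: "\<And>fs \<epsilon>. finite fs \<Longrightarrow> fs \<subseteq> Cc \<Longrightarrow> 0 < \<epsilon> \<Longrightarrow> \<forall>\<^sub>F \<mu> in F. \<mu> \<in> vague_nhd \<nu> fs \<epsilon>"
  shows "vague_cluster F \<nu>"
  unfolding vague_cluster_def
proof (intro allI impI)
  fix fs :: "('a \<Rightarrow> real) set" and \<epsilon> :: real assume "finite fs \<and> fs \<subseteq> Cc" "0 < \<epsilon>"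
  then have "\<forall>\<^sub>F \<mu> in F. \<mu> \<in> vague_nhd \<nu> fs \<epsilon>" using nhd by simp
  from eventually_frequently[OF F this]
  show "\<exists>\<^sub>F \<mu> in F. \<forall>f\<in>fs. \<bar>(\<integral>x. f x \<partial>\<mu>) - (\<integral>x. f x \<partial>\<nu>)\<bar> < \<epsilon>" by (simp add: vague_nhd_def)
qed

lemma vague_limit_mass_le:
  fixes \<nu> :: "'a::t2_space measure"
  assumes lc: "locally_compact_space (euclidean :: 'a topology)" and F: "F \<noteq> bot" and \<nu>: "radon \<nu>"
    and mass: "\<forall>\<^sub>F s in F. finite_radon (m s) \<and> measure (m s) UNIV \<le> c"
    and vague: "\<And>f. f \<in> Cc \<Longrightarrow> ((\<lambda>s. \<integral>x. f x \<partial>m s) \<longlongrightarrow> (\<integral>x. f x \<partial>\<nu>)) F"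
  shows "emeasure \<nu> UNIV \<le> ennreal c"
proof -
  have "emeasure \<nu> K \<le> ennreal c" if K: "compact K" for K
  proof -
    have sets: "K \<in> sets \<nu>" using \<nu> K by (simp add: radon_def borel_compact)
    obtain f where f: "f \<in> Cc" "\<And>x. 0 \<le> f x \<and> f x \<le> 1" "\<And>x. x \<in> K \<Longrightarrow> f x = 1"
      using Cc_Urysohn[OF lc K] by blast
    have "emeasure \<nu> K = (\<integral>\<^sup>+ x. indicator K x \<partial>\<nu>)" using sets by simp
    also have "\<dots> \<le> (\<integral>\<^sup>+ x. ennreal (f x) \<partial>\<nu>)"
      using f(3) by (intro nn_integral_mono) (auto split: split_indicator)
    also have "\<dots> = ennreal (\<integral>x. f x \<partial>\<nu>)"
      using f(2) by (intro nn_integral_eq_integral Cc_integrable[OF f(1) \<nu>]) auto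
    also have "\<dots> \<le> ennreal c"
    proof (intro ennreal_leI tendsto_upperbound[OF vague[OF f(1)] _ F])
      show "\<forall>\<^sub>F s in F. (\<integral>x. f x \<partial>m s) \<le> c"
        using mass
      proof eventually_elim
        case (elim s)
        then interpret finite_measure "m s" by (simp add: finite_radon_finite_measure)
        have "(\<integral>x. f x \<partial>m s) \<le> (\<integral>x. 1 \<partial>m s)"
          using f elim by (intro integral_mono Cc_integrable[OF f(1)]) (auto simp: finite_radon_def)
        also have "\<dots> = measure (m s) UNIV" using elim by (simp add: finite_radon_space)
        finally show ?case using elim by simp
      qed
    qed
    finally show ?thesis .
  qed
  moreover have "emeasure \<nu> UNIV = (SUP K\<in>{K. compact K \<and> K \<subseteq> UNIV}. emeasure \<nu> K)"
    using \<nu> unfolding radon_def by (metis open_UNIV)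
  ultimately show ?thesis by (auto intro: SUP_least)
qed

section \<open>Consistent kernels\<close>

lemma filter_of_directed_sets:
  assumes ne: "B \<noteq> {}" and nonempty: "\<And>b. b \<in> B \<Longrightarrow> D b \<noteq> {}"
    and directed: "\<And>a b. a \<in> B \<Longrightarrow> b \<in> B \<Longrightarrow> \<exists>c\<in>B. D c \<subseteq> D a \<inter> D b"
  shows "\<exists>F. F \<noteq> bot \<and> (\<forall>b\<in>B. \<forall>\<^sub>F x in F. x \<in> D b)"
proof (intro exI conjI ballI)
  let ?F = "INF b\<in>B. principal (D b)"
  have "eventually P ?F \<longleftrightarrow> (\<exists>b\<in>B. eventually P (principal (D b)))" for P
    using ne directed by (intro eventually_INF_base) auto
  from this[of "\<lambda>_. False"] show "?F \<noteq> bot"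
    using nonempty by (auto simp: trivial_limit_def eventually_principal)
  show "\<forall>\<^sub>F x in ?F. x \<in> D b" if "b \<in> B" for b
    using INF_lower[OF that, of "\<lambda>b. principal (D b)"] by (simp add: le_principal)
qed

lemma filter_of_almost_minimal:
  fixes e :: "'b \<Rightarrow> real"
  assumes ne: "Q \<noteq> {}" and nonneg: "\<And>x. 0 \<le> e x" and bounded: "\<And>q. q \<in> Q \<Longrightarrow> \<exists>x\<in>C q. e x \<le> b"
    and directed: "\<And>p q. p \<in> Q \<Longrightarrow> q \<in> Q \<Longrightarrow> \<exists>r\<in>Q. C r \<subseteq> C p \<inter> C q"
  shows "\<exists>F l. F \<noteq> bot \<and> (\<forall>q\<in>Q. \<forall>\<epsilon>>0. \<forall>\<^sub>F x in F. x \<in> C q \<and> e x < l + \<epsilon>)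
    \<and> (\<forall>\<epsilon>>0. \<exists>q\<in>Q. \<forall>x\<in>C q. l - \<epsilon> < e x)"
proof -
  define least where "least q = (INF x\<in>C q. e x)" for q
  define l where "l = (SUP q\<in>Q. least q)"
  define D where "D r = {x\<in>C (fst r). e x < l + snd r}" for r
  have bdd_below: "bdd_below (e ` C q)" for q using nonneg by (intro bdd_belowI[of _ 0]) auto
  then have least_le: "least q \<le> e x" if "x \<in> C q" for q x
    unfolding least_def using that by (rule cINF_lower)
  then have "least q \<le> b" if "q \<in> Q" for q using bounded[OF that] by (meson order_trans)
  then have bdd_above: "bdd_above (least ` Q)" by (intro bdd_aboveI[of _ b]) auto
  have "\<exists>F. F \<noteq> bot \<and> (\<forall>r\<in>Q \<times> {0<..}. \<forall>\<^sub>F x in F. x \<in> D r)"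
  proof (rule filter_of_directed_sets)
    show "Q \<times> {0::real<..} \<noteq> {}" using ne by (simp add: gt_ex)
    show "D r \<noteq> {}" if r: "r \<in> Q \<times> {0<..}" for r
    proof -
      have q: "fst r \<in> Q" "0 < snd r" using r by auto
      have "(INF x\<in>C (fst r). e x) < l + snd r"
        using cSUP_upper[OF q(1) bdd_above] q(2) by (simp add: l_def least_def)
      moreover have "C (fst r) \<noteq> {}" using bounded[OF q(1)] by blast
      ultimately show ?thesis by (auto simp: cINF_less_iff bdd_below D_def)
    qed
    show "\<exists>t\<in>Q \<times> {0<..}. D t \<subseteq> D r \<inter> D s" if "r \<in> Q \<times> {0<..}" "s \<in> Q \<times> {0<..}" for r s
    proof -
      have "fst r \<in> Q" "fst s \<in> Q" using that by auto
      from directed[OF this] obtain q where q: "q \<in> Q" "C q \<subseteq> C (fst r) \<inter> C (fst s)" by blast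
      have "D (q, min (snd r) (snd s)) \<subseteq> D r \<inter> D s" using q(2) by (auto simp: D_def)
      then show ?thesis using q(1) that by (intro bexI[of _ "(q, min (snd r) (snd s))"]) auto
    qed
  qed
  then obtain F where F: "F \<noteq> bot" "\<forall>q\<in>Q. \<forall>\<epsilon>>0. \<forall>\<^sub>F x in F. x \<in> C q \<and> e x < l + \<epsilon>"
    by (auto simp: D_def)
  have "\<exists>q\<in>Q. l - \<epsilon> < least q" if "0 < \<epsilon>" for \<epsilon>
    using less_cSUP_iff[OF ne bdd_above, of "l - \<epsilon>"] that by (simp add: l_def)
  then have "\<exists>q\<in>Q. \<forall>x\<in>C q. l - \<epsilon> < e x" if "0 < \<epsilon>" for \<epsilon>
    using that least_le by (meson less_le_trans)
  with F show ?thesis by (intro exI[of _ F] exI[of _ l] conjI allI impI)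
qed

lemma strong_cauchyI:
  assumes "\<And>\<epsilon>. 0 < \<epsilon> \<Longrightarrow> \<exists>S. (\<forall>\<^sub>F \<mu> in F. \<mu> \<in> S) \<and> (\<forall>\<mu>\<in>S. \<forall>\<nu>\<in>S. sdist \<kappa> \<mu> \<nu> < \<epsilon>)"
  shows "strong_cauchy \<kappa> F"
  unfolding strong_cauchy_def
proof (intro allI impI)
  fix \<epsilon> :: real assume "0 < \<epsilon>"
  from assms[OF this] obtain S where S: "\<forall>\<^sub>F \<mu> in F. \<mu> \<in> S" "\<And>\<mu> \<nu>. \<mu> \<in> S \<Longrightarrow> \<nu> \<in> S \<Longrightarrow> sdist \<kappa> \<mu> \<nu> < \<epsilon>"
    by blast
  from eventually_prodI[OF S(1) S(1)] show "\<forall>\<^sub>F (\<mu>, \<nu>) in F \<times>\<^sub>F F. sdist \<kappa> \<mu> \<nu> < \<epsilon>"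
    by (rule eventually_mono) (simp add: case_prod_beta' S(2))
qed

context energy_kernel
begin

lemma sdist_parallelogram:
  assumes "\<mu> \<in> \<E>" "\<nu> \<in> \<E>"
  shows "(sdist \<kappa> \<mu> \<nu>)\<^sup>2 = 2 * energy \<mu> \<mu> + 2 * energy \<nu> \<nu>
    - 4 * energy (mix (1/2) \<mu> \<nu>) (mix (1/2) \<mu> \<nu>)"
proof -
  let ?m = "mix (1/2) \<mu> \<nu>"
  have m: "?m \<in> \<E>" using assms by (rule \<E>_mix)
  have left: "energy ?m \<xi> = (energy \<mu> \<xi> + energy \<nu> \<xi>) / 2" if "\<xi> \<in> \<E>" for \<xi>
    using assms that by (simp add: energy_mix_left add_divide_distrib)
  have "energy ?m ?m = (energy ?m \<mu> + energy ?m \<nu>) / 2"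
    unfolding left[OF m] using assms m by (simp add: energy_commute[of ?m])
  also have "\<dots> = (energy \<mu> \<mu> + 2 * energy \<mu> \<nu> + energy \<nu> \<nu>) / 4"
    using energy_commute[OF assms] by (simp add: left[OF assms(1)] left[OF assms(2)] field_simps)
  finally show ?thesis
    using energy_positive_definite[OF assms] by (simp add: sdist_eq)
qed

lemma sdist_less_of_almost_minimal:
  assumes mem: "\<mu> \<in> \<E>" "\<nu> \<in> \<E>" and lower: "l \<le> energy (mix (1/2) \<mu> \<nu>) (mix (1/2) \<mu> \<nu>)"
    and upper: "energy \<mu> \<mu> < u" "energy \<nu> \<nu> < u" and \<epsilon>: "4 * (u - l) \<le> \<epsilon>\<^sup>2" "0 \<le> \<epsilon>"
  shows "sdist \<kappa> \<mu> \<nu> < \<epsilon>"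
proof -
  have "(sdist \<kappa> \<mu> \<nu>)\<^sup>2 < \<epsilon>\<^sup>2"
    using sdist_parallelogram[OF mem] lower upper \<epsilon>(1) by (simp add: right_diff_distrib)
  then show ?thesis using \<epsilon>(2) by (rule power2_less_imp_less)
qed

lemma minimizing_Cauchy_filter:
  assumes ne: "Q \<noteq> {}" and sub: "\<And>q. q \<in> Q \<Longrightarrow> C q \<subseteq> \<E>"
    and midpoint: "\<And>q \<mu> \<nu>. q \<in> Q \<Longrightarrow> \<mu> \<in> C q \<Longrightarrow> \<nu> \<in> C q \<Longrightarrow> mix (1/2) \<mu> \<nu> \<in> C q"
    and bounded: "\<And>q. q \<in> Q \<Longrightarrow> \<exists>\<mu>\<in>C q. energy \<mu> \<mu> \<le> b"
    and directed: "\<And>p q. p \<in> Q \<Longrightarrow> q \<in> Q \<Longrightarrow> \<exists>r\<in>Q. C r \<subseteq> C p \<inter> C q"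
  shows "\<exists>F. F \<noteq> bot \<and> (\<forall>q\<in>Q. \<forall>\<^sub>F \<mu> in F. \<mu> \<in> C q) \<and> strong_cauchy \<kappa> F"
proof -
  obtain F l where F: "F \<noteq> bot" "\<And>q \<epsilon>. q \<in> Q \<Longrightarrow> 0 < \<epsilon> \<Longrightarrow> \<forall>\<^sub>F \<mu> in F. \<mu> \<in> C q \<and> energy \<mu> \<mu> < l + \<epsilon>"
    and l: "\<And>\<epsilon>. 0 < \<epsilon> \<Longrightarrow> \<exists>q\<in>Q. \<forall>\<mu>\<in>C q. l - \<epsilon> < energy \<mu> \<mu>"
    using filter_of_almost_minimal[of Q "\<lambda>\<mu>. energy \<mu> \<mu>" C, OF ne energy_nonneg bounded directed] by blast
  have "\<forall>\<^sub>F \<mu> in F. \<mu> \<in> C q" if "q \<in> Q" for q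
    using F(2)[OF that zero_less_one] by eventually_elim simp
  moreover have "strong_cauchy \<kappa> F"
  proof (rule strong_cauchyI)
    fix \<epsilon> :: real assume \<epsilon>: "0 < \<epsilon>"
    define \<eta> where "\<eta> = \<epsilon>\<^sup>2 / 8"
    have \<eta>: "0 < \<eta>" "4 * ((l + \<eta>) - (l - \<eta>)) \<le> \<epsilon>\<^sup>2" using \<epsilon> by (simp_all add: \<eta>_def)
    obtain q where q: "q \<in> Q" "\<And>\<mu>. \<mu> \<in> C q \<Longrightarrow> l - \<eta> < energy \<mu> \<mu>" using l[OF \<eta>(1)] by blast
    define S where "S = {\<mu>\<in>C q. energy \<mu> \<mu> < l + \<eta>}"
    have "sdist \<kappa> \<mu> \<nu> < \<epsilon>" if mem: "\<mu> \<in> S" "\<nu> \<in> S" for \<mu> \<nu>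
    proof -
      have C: "\<mu> \<in> C q" "\<nu> \<in> C q" and upper: "energy \<mu> \<mu> < l + \<eta>" "energy \<nu> \<nu> < l + \<eta>"
        using mem by (simp_all add: S_def)
      have "l - \<eta> \<le> energy (mix (1/2) \<mu> \<nu>) (mix (1/2) \<mu> \<nu>)"
        using midpoint[OF q(1) C] by (intro less_imp_le q(2))
      moreover have "\<mu> \<in> \<E>" "\<nu> \<in> \<E>" using C sub[OF q(1)] by auto
      ultimately show ?thesis
        using upper \<eta>(2) less_imp_le[OF \<epsilon>] by (intro sdist_less_of_almost_minimal)
    qed
    moreover have "\<forall>\<^sub>F \<mu> in F. \<mu> \<in> S" using F(2)[OF q(1) \<eta>(1)] by (simp add: S_def)
    ultimately show "\<exists>S. (\<forall>\<^sub>F \<mu> in F. \<mu> \<in> S) \<and> (\<forall>\<mu>\<in>S. \<forall>\<nu>\<in>S. sdist \<kappa> \<mu> \<nu> < \<epsilon>)" by blast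
  qed
  ultimately show ?thesis using F(1) by (intro exI[of _ F] conjI ballI)
qed

end

locale consistent_kernel = energy_kernel +
  assumes consistent: "F \<noteq> bot \<Longrightarrow> \<forall>\<^sub>F \<mu> in F. \<mu> \<in> Eplus \<kappa> \<Longrightarrow> strong_cauchy \<kappa> F \<Longrightarrow> radon \<nu> \<Longrightarrow>
    vague_cluster F \<nu> \<Longrightarrow> ((\<lambda>\<mu>. sdist \<kappa> \<mu> \<nu>) \<longlongrightarrow> 0) F"
begin

lemma vague_closure_convex_imp_strong_limit:
  assumes H: "H \<subseteq> \<E>" and midpoint: "\<And>\<mu> \<nu>. \<mu> \<in> H \<Longrightarrow> \<nu> \<in> H \<Longrightarrow> mix (1/2) \<mu> \<nu> \<in> H" and \<nu>: "radon \<nu>"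
    and approx: "\<And>fs \<epsilon>. finite fs \<Longrightarrow> fs \<subseteq> Cc \<Longrightarrow> 0 < \<epsilon> \<Longrightarrow> \<exists>\<mu>\<in>H \<inter> vague_nhd \<nu> fs \<epsilon>. energy \<mu> \<mu> \<le> b"
  shows "\<exists>F. F \<noteq> bot \<and> (\<forall>\<^sub>F \<mu> in F. \<mu> \<in> H) \<and> ((\<lambda>\<mu>. sdist \<kappa> \<mu> \<nu>) \<longlongrightarrow> 0) F"
proof -
  define Q where "Q = {fs. finite fs \<and> fs \<subseteq> (Cc :: ('a \<Rightarrow> real) set)} \<times> {0::real<..}"
  define C where "C q = H \<inter> vague_nhd \<nu> (fst q) (snd q)" for q
  have Q: "(fs, \<epsilon>) \<in> Q" if "finite fs" "fs \<subseteq> Cc" "0 < \<epsilon>" for fs \<epsilon>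
    using that by (simp add: Q_def)
  have radon: "radon \<mu>" if "\<mu> \<in> H" for \<mu>
    using that H \<E>_finite_radon by (auto simp: finite_radon_def)
  have "\<exists>F. F \<noteq> bot \<and> (\<forall>q\<in>Q. \<forall>\<^sub>F \<mu> in F. \<mu> \<in> C q) \<and> strong_cauchy \<kappa> F"
  proof (rule minimizing_Cauchy_filter)
    show "Q \<noteq> {}" using Q[of "{}" 1] by auto
    show "C q \<subseteq> \<E>" for q using H by (auto simp: C_def)
    show "\<exists>\<mu>\<in>C q. energy \<mu> \<mu> \<le> b" if "q \<in> Q" for q
      using that approx[of "fst q" "snd q"] by (auto simp: Q_def C_def)
    show "\<exists>r\<in>Q. C r \<subseteq> C p \<inter> C q" if "p \<in> Q" "q \<in> Q" for p q
    proof (rule bexI)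
      show "C (fst p \<union> fst q, min (snd p) (snd q)) \<subseteq> C p \<inter> C q"
        using vague_nhd_Int_subset by (fastforce simp: C_def)
      show "(fst p \<union> fst q, min (snd p) (snd q)) \<in> Q" using that by (auto simp: Q_def)
    qed
    show "mix (1/2) \<mu> \<mu>' \<in> C q" if "q \<in> Q" "\<mu> \<in> C q" "\<mu>' \<in> C q" for q \<mu> \<mu>'
      using that midpoint mix_mem_vague_nhd[of \<mu> \<mu>' "fst q" "1/2"] radon by (auto simp: C_def Q_def)
  qed
  then obtain F where F: "F \<noteq> bot" "\<And>q. q \<in> Q \<Longrightarrow> \<forall>\<^sub>F \<mu> in F. \<mu> \<in> C q" "strong_cauchy \<kappa> F" by blast
  have mem_H: "\<forall>\<^sub>F \<mu> in F. \<mu> \<in> H"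
    using F(2)[OF Q[of "{}" 1]] by (simp add: C_def eventually_conj_iff)
  have "vague_cluster F \<nu>"
    using F(1) F(2)[OF Q] by (intro vague_clusterI) (auto simp: C_def eventually_conj_iff)
  moreover have "\<forall>\<^sub>F \<mu> in F. \<mu> \<in> Eplus \<kappa>"
    using mem_H by eventually_elim (use H \<E>_Eplus in blast)
  ultimately have "((\<lambda>\<mu>. sdist \<kappa> \<mu> \<nu>) \<longlongrightarrow> 0) F"
    using F(1,3) \<nu> by (intro consistent)
  with F(1) mem_H show ?thesis by blast
qed

lemma eventually_energy_less_of_vague:
  assumes bounded: "\<forall>\<^sub>F s in F. m s \<in> \<E> \<and> energy (m s) (m s) \<le> b" and \<nu>: "\<nu> \<in> \<E>" and \<xi>: "\<xi> \<in> \<E>"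
    and vague: "\<And>f. f \<in> Cc \<Longrightarrow> ((\<lambda>s. \<integral>x. f x \<partial>m s) \<longlongrightarrow> (\<integral>x. f x \<partial>\<nu>)) F"
    and \<delta>: "0 < \<delta>" and u: "\<bar>u\<bar> = 1"
  shows "\<forall>\<^sub>F s in F. u * (energy (m s) \<xi> - energy \<nu> \<xi>) < \<delta>"
proof (rule ccontr)
  define H where "H = {\<mu>\<in>\<E>. \<delta> \<le> u * (energy \<mu> \<xi> - energy \<nu> \<xi>)}"
  assume "\<not> ?thesis"
  then have "\<exists>\<^sub>F s in F. \<delta> \<le> u * (energy (m s) \<xi> - energy \<nu> \<xi>)" by (simp add: not_eventually not_less)
  from frequently_eventually_frequently[OF this bounded]
  have frequently_H: "\<exists>\<^sub>F s in F. m s \<in> H \<and> energy (m s) (m s) \<le> b"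
    by (rule frequently_elim1) (simp add: H_def)
  have "\<exists>G. G \<noteq> bot \<and> (\<forall>\<^sub>F \<mu> in G. \<mu> \<in> H) \<and> ((\<lambda>\<mu>. sdist \<kappa> \<mu> \<nu>) \<longlongrightarrow> 0) G"
  proof (rule vague_closure_convex_imp_strong_limit)
    show "H \<subseteq> \<E>" by (auto simp: H_def)
    show "radon \<nu>" using \<E>_finite_radon[OF \<nu>] by (simp add: finite_radon_def)
    show "mix (1/2) \<mu> \<mu>' \<in> H" if \<mu>: "\<mu> \<in> H" "\<mu>' \<in> H" for \<mu> \<mu>'
    proof -
      have mem: "\<mu> \<in> \<E>" "\<mu>' \<in> \<E>" using \<mu> by (auto simp: H_def)
      have "u * (energy (mix (1/2) \<mu> \<mu>') \<xi> - energy \<nu> \<xi>)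
          = (u * (energy \<mu> \<xi> - energy \<nu> \<xi>) + u * (energy \<mu>' \<xi> - energy \<nu> \<xi>)) / 2"
        using mem \<xi> by (simp add: energy_mix_left field_simps)
      then show ?thesis using \<mu> \<E>_mix[OF mem, of "1/2"] by (simp add: H_def)
    qed
    show "\<exists>\<mu>\<in>H \<inter> vague_nhd \<nu> fs \<epsilon>. energy \<mu> \<mu> \<le> b" if "finite fs" "fs \<subseteq> Cc" "0 < \<epsilon>" for fs \<epsilon>
      using frequently_ex[OF frequently_eventually_frequently[OF frequently_H
        eventually_vague_nhd[OF that vague]]] by blast
  qed
  then obtain G where G: "G \<noteq> bot" "\<forall>\<^sub>F \<mu> in G. \<mu> \<in> H" "((\<lambda>\<mu>. sdist \<kappa> \<mu> \<nu>) \<longlongrightarrow> 0) G" by blast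
  have "((\<lambda>\<mu>. sdist \<kappa> \<mu> \<nu> * sqrt (energy \<xi> \<xi>)) \<longlongrightarrow> 0) G"
    using G(3) by (rule tendsto_mult_left_zero)
  from order_tendstoD(2)[OF this \<delta>] G(2) have "\<forall>\<^sub>F \<mu> in G. False"
  proof eventually_elim
    case (elim \<mu>)
    have "\<delta> \<le> \<bar>u * (energy \<mu> \<xi> - energy \<nu> \<xi>)\<bar>" using elim(2) unfolding H_def by auto
    also have "\<dots> = \<bar>energy \<mu> \<xi> - energy \<nu> \<xi>\<bar>" using u by (simp add: abs_mult)
    also have "\<dots> \<le> sdist \<kappa> \<mu> \<nu> * sqrt (energy \<xi> \<xi>)"
      using elim(2) \<nu> \<xi> by (intro energy_diff_le_sdist) (auto simp: H_def)
    finally show ?case using elim(1) by simp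
  qed
  then show False using G(1) by simp
qed

theorem energy_tendsto_of_vague:
  assumes bounded: "\<forall>\<^sub>F s in F. m s \<in> \<E> \<and> energy (m s) (m s) \<le> b" and \<nu>: "\<nu> \<in> \<E>" and \<xi>: "\<xi> \<in> \<E>"
    and vague: "\<And>f. f \<in> Cc \<Longrightarrow> ((\<lambda>s. \<integral>x. f x \<partial>m s) \<longlongrightarrow> (\<integral>x. f x \<partial>\<nu>)) F"
  shows "((\<lambda>s. energy (m s) \<xi>) \<longlongrightarrow> energy \<nu> \<xi>) F"
proof (rule tendstoI)
  fix \<epsilon> :: real assume \<epsilon>: "0 < \<epsilon>"
  note less = eventually_energy_less_of_vague[OF bounded \<nu> \<xi> vague \<epsilon>]
  have "\<forall>\<^sub>F s in F. 1 * (energy (m s) \<xi> - energy \<nu> \<xi>) < \<epsilon>"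
    "\<forall>\<^sub>F s in F. - 1 * (energy (m s) \<xi> - energy \<nu> \<xi>) < \<epsilon>"
    using less[of 1] less[of "- 1"] by simp_all
  then show "\<forall>\<^sub>F s in F. dist (energy (m s) \<xi>) (energy \<nu> \<xi>) < \<epsilon>"
    by eventually_elim (simp add: dist_real_def abs_less_iff)
qed

end

lemma admissible_kernel_imp_consistent_kernel:
  assumes "admissible_kernel \<kappa> h" shows "consistent_kernel \<kappa> h"
proof
  note admissible = assms[unfolded admissible_kernel_def]
  show "lsc (\<lambda>(x, y). \<kappa> x y)" using admissible by (elim conjE)
  show "\<kappa> x y = \<kappa> y x" for x y using admissible by (elim conjE) (erule allE, erule spec)
  show "0 \<le> senergy \<kappa> P N" if "inE \<kappa> P N" for P N
    using admissible that by (elim conjE) blast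
  have "\<forall>\<nu>. radon \<nu> \<and> compact (supp \<nu>) \<longrightarrow> (SUP x\<in>supp \<nu>. pot \<kappa> \<nu> x) < \<infinity> \<longrightarrow>
      (\<forall>x. pot \<kappa> \<nu> x \<le> ennreal h * (SUP x\<in>supp \<nu>. pot \<kappa> \<nu> x))"
    using admissible by (elim conjE)
  then show "pot \<kappa> \<nu> x \<le> ennreal h * (SUP x\<in>supp \<nu>. pot \<kappa> \<nu> x)"
    if "radon \<nu>" "compact (supp \<nu>)" "(SUP x\<in>supp \<nu>. pot \<kappa> \<nu> x) < \<infinity>" for \<nu> x
    using that by simp
  have "\<forall>F. F \<noteq> bot \<longrightarrow> (\<forall>\<^sub>F \<mu> in F. \<mu> \<in> Eplus \<kappa>) \<longrightarrow> strong_cauchy \<kappa> F \<longrightarrow>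
      (\<forall>\<nu>. radon \<nu> \<longrightarrow> vague_cluster F \<nu> \<longrightarrow> \<nu> \<in> Eplus \<kappa> \<and> ((\<lambda>\<mu>. sdist \<kappa> \<mu> \<nu>) \<longlongrightarrow> 0) F)"
    using admissible by (elim conjE)
  then show "((\<lambda>\<mu>. sdist \<kappa> \<mu> \<nu>) \<longlongrightarrow> 0) F"
    if "F \<noteq> bot" "\<forall>\<^sub>F \<mu> in F. \<mu> \<in> Eplus \<kappa>" "strong_cauchy \<kappa> F" "radon \<nu>" "vague_cluster F \<nu>" for F \<nu>
    using that by simp
qed

section \<open>Properties that hold nearly everywhere\<close>

lemma nearly_everywhereI:
  assumes "\<And>\<nu>. \<nu> \<in> Eplus \<kappa> \<Longrightarrow> concentrated \<nu> {x\<in>S. \<not> P x} \<Longrightarrow> emeasure \<nu> UNIV = 1 \<Longrightarrow> False"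
  shows "nearly_everywhere \<kappa> S P"
proof -
  have "{\<nu>. \<nu> \<in> Eplus \<kappa> \<and> concentrated \<nu> {x\<in>S. \<not> P x} \<and> emeasure \<nu> UNIV = 1} = {}"
    using assms by blast
  then show ?thesis unfolding nearly_everywhere_def icap_def by (simp only:) simp
qed

lemma nearly_everywhereD:
  assumes ne: "nearly_everywhere \<kappa> S P"
    and \<nu>: "\<nu> \<in> Eplus \<kappa>" "concentrated \<nu> {x\<in>S. \<not> P x}" "emeasure \<nu> UNIV = 1"
  shows False
proof -
  have "(INF \<nu>\<in>{\<nu>. \<nu> \<in> Eplus \<kappa> \<and> concentrated \<nu> {x\<in>S. \<not> P x} \<and> emeasure \<nu> UNIV = 1}. menergy \<kappa> \<nu> \<nu>)
      \<le> menergy \<kappa> \<nu> \<nu>"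
    using \<nu> by (intro INF_lower) auto
  also have "\<dots> < top" using \<nu>(1) by (simp add: Eplus_def)
  finally show False using ne by (simp add: nearly_everywhere_def icap_def)
qed

lemma (in energy_kernel) nearly_everywhere_imp_AE:
  assumes ne: "nearly_everywhere \<kappa> S P" and \<mu>: "\<mu> \<in> \<E>" and S: "AE x in \<mu>. x \<in> S"
    and B: "{x\<in>S. \<not> P x} \<in> sets borel"
  shows "AE x in \<mu>. x \<in> S \<and> P x"
proof -
  let ?B = "{x\<in>S. \<not> P x}"
  note [simp] = \<E>_sets[OF \<mu>]
  have "emeasure \<mu> ?B = 0"
  proof (rule ccontr)
    assume nonzero: "emeasure \<mu> ?B \<noteq> 0"
    define r where "r = emeasure \<mu> ?B"
    have r: "r \<noteq> 0" "r \<noteq> top"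
      using nonzero
        finite_measure.emeasure_finite[OF finite_radon_finite_measure[OF \<E>_finite_radon[OF \<mu>]]]
      by (auto simp: r_def)
    define \<nu> where "\<nu> = scale_measure (inverse r) (restrict_measure \<mu> ?B)"
    have \<nu>: "\<nu> \<in> \<E>"
      unfolding \<nu>_def using r(1) \<mu> B
      by (intro \<E>_scale_measure \<E>_restrict_measure) (simp_all add: less_top[symmetric])
    moreover have "emeasure \<nu> UNIV = inverse r * r"
      using B by (simp add: \<nu>_def emeasure_restrict_measure r_def)
    then have "emeasure \<nu> UNIV = 1"
      using r by (cases r) (auto simp: inverse_ennreal ennreal_mult[symmetric])
    moreover have "emeasure \<nu> (- ?B) = 0"
      using B by (simp add: \<nu>_def emeasure_restrict_measure)
    then have "concentrated \<nu> ?B"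
      unfolding concentrated_iff_AE[OF \<E>_sets[OF \<nu>]] AE_mem_iff_emeasure_Compl[OF \<E>_sets[OF \<nu>] B] .
    ultimately show False
      by (intro nearly_everywhereD[OF ne]) (auto intro: \<E>_Eplus)
  qed
  then have "AE x in \<mu>. x \<notin> ?B" using B by (intro AE_not_in null_setsI) auto
  with S show ?thesis by eventually_elim auto
qed

section \<open>Vector measures on a condenser\<close>

locale constrained_condenser = energy_kernel \<kappa> h
  for \<kappa> :: "'a::t2_space \<Rightarrow> 'a \<Rightarrow> ennreal" and h :: real +
  fixes Ip In :: "'i set" and A :: "'i \<Rightarrow> 'a set" and chiP chiN :: "'a measure"
    and g :: "'a \<Rightarrow> real" and a :: "'i \<Rightarrow> real" and c :: real
  assumes condenser: "condenser \<kappa> Ip In A"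
    and field: "external_field \<kappa> Ip In A chiP chiN"
    and g_continuous: "continuous_on (\<Union>i\<in>Ip \<union> In. A i) g"
    and c_pos: "0 < c" and c_le_g: "\<And>x i. i \<in> Ip \<union> In \<Longrightarrow> x \<in> A i \<Longrightarrow> c \<le> g x"
    and a_pos: "\<And>i. i \<in> Ip \<union> In \<Longrightarrow> 0 < a i" and a_summable: "a summable_on (Ip \<union> In)"
begin

abbreviation I :: "'i set" where "I \<equiv> Ip \<union> In"
abbreviation chi :: "'a measure \<times> 'a measure" where "chi \<equiv> (chiP, chiN)"
abbreviation G :: "('i \<Rightarrow> 'a measure) \<Rightarrow> real" where "G \<equiv> Gchi \<kappa> Ip In chiP chiN"
abbreviation W :: "('i \<Rightarrow> 'a measure) \<Rightarrow> 'i \<Rightarrow> 'a \<Rightarrow> ereal" where "W \<equiv> Wpot \<kappa> Ip In chiP chiN"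
abbreviation constrained :: "('i \<Rightarrow> 'a measure) set" where "constrained \<equiv> EplusAag \<kappa> Ip In A a g I"

lemma countable_I: "countable I" and countable_Ip: "countable Ip" and countable_In: "countable In"
  and disjoint_I: "Ip \<inter> In = {}" and closed_A: "i \<in> I \<Longrightarrow> closed (A i)"
  using condenser by (auto simp: condenser_def)

lemma borel_A: "i \<in> I \<Longrightarrow> A i \<in> sets borel"
  using closed_A by (rule borel_closed)

lemma chi_mem: "chi \<in> \<E> \<times> \<E>"
  using field by (simp add: external_field_def inE_def \<E>_def finite_radon_def)

definition R :: "('i \<Rightarrow> 'a measure) \<Rightarrow> 'a measure \<times> 'a measure" where
  "R \<mu> = (sum_measure Ip \<mu>, sum_measure In \<mu>)"

abbreviation total :: "('i \<Rightarrow> 'a measure) \<Rightarrow> 'a measure \<times> 'a measure" where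
  "total \<mu> \<equiv> R \<mu> \<oplus> chi"

text \<open>The constraints imply these mass bounds, which, unlike the constraints, pass to vague limits.\<close>

definition mass_bounded :: "('i \<Rightarrow> 'a measure) set" where
  "mass_bounded = {\<mu> \<in> EplusA \<kappa> Ip In A. \<forall>i\<in>I. emeasure (\<mu> i) UNIV \<le> ennreal (a i / c)}"

lemma total_mass_le:
  assumes "S \<subseteq> I" "\<And>i. i \<in> S \<Longrightarrow> emeasure (\<mu> i) UNIV \<le> ennreal (a i / c)"
  shows "(\<integral>\<^sup>+ i. emeasure (\<mu> i) UNIV \<partial>count_space S) \<le> ennreal (\<Sum>\<^sub>\<infinity>i\<in>I. a i / c)"
proof -
  have nonneg: "0 \<le> a i / c" if "i \<in> I" for i using a_pos[OF that] c_pos by simp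
  have summable_I: "(\<lambda>i. a i / c) summable_on I"
    using summable_on_cmult_right[OF a_summable, of "1 / c"] by simp
  then have summable: "(\<lambda>i. a i / c) summable_on S"
    using assms(1) by (rule summable_on_subset_banach)
  have "(\<integral>\<^sup>+ i. emeasure (\<mu> i) UNIV \<partial>count_space S) \<le> (\<integral>\<^sup>+ i. ennreal (a i / c) \<partial>count_space S)"
    using assms(2) by (intro nn_integral_mono) simp
  also have "\<dots> = ennreal (\<Sum>\<^sub>\<infinity>i\<in>S. a i / c)"
    using has_sum_infsum[OF summable] nonneg assms(1)
    by (subst (asm) has_sum_iff_nn_integral_count_space) (auto intro!: infsum_nonneg)
  also have "\<dots> \<le> ennreal (\<Sum>\<^sub>\<infinity>i\<in>I. a i / c)"
    using summable summable_I assms(1) nonneg by (intro ennreal_leI infsum_mono_neutral) auto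
  finally show ?thesis .
qed

lemma
  assumes \<mu>: "\<mu> \<in> mass_bounded" and i: "i \<in> I"
  shows mass_bounded_finite_radon: "finite_radon (\<mu> i)"
    and mass_bounded_AE: "AE x in \<mu> i. x \<in> A i"
proof -
  have \<mu>i: "radon (\<mu> i)" "concentrated (\<mu> i) (A i)" "emeasure (\<mu> i) UNIV \<le> ennreal (a i / c)"
    using \<mu> i by (auto simp: mass_bounded_def EplusA_def)
  then show "finite_radon (\<mu> i)" by (auto simp: finite_radon_def intro: le_less_trans)
  then show "AE x in \<mu> i. x \<in> A i" using \<mu>i(2) by (simp add: concentrated_iff_AE finite_radon_sets)
qed

lemma mass_bounded_finite_radon_sum:
  assumes \<mu>: "\<mu> \<in> mass_bounded" and S: "S \<subseteq> I"
  shows "finite_radon (sum_measure S \<mu>)"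
proof (rule finite_radon_sum_measure)
  show "finite_radon (\<mu> i)" if "i \<in> S" for i
    using \<mu> that S by (intro mass_bounded_finite_radon) auto
  show "countable S" using S countable_I by (rule countable_subset)
  have "(\<integral>\<^sup>+ i. emeasure (\<mu> i) UNIV \<partial>count_space S) \<le> ennreal (\<Sum>\<^sub>\<infinity>i\<in>I. a i / c)"
    using \<mu> S by (intro total_mass_le) (auto simp: mass_bounded_def)
  then show "(\<integral>\<^sup>+ i. emeasure (\<mu> i) UNIV \<partial>count_space S) < \<infinity>" by (rule le_less_trans) simp
qed

lemma mass_bounded_blockE:
  assumes "\<mu> \<in> mass_bounded" "\<nu> \<in> mass_bounded" "S \<subseteq> I" "T \<subseteq> I"
  shows "blockE \<kappa> S T \<mu> \<nu> = menergy \<kappa> (sum_measure S \<mu>) (sum_measure T \<nu>)"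
proof (rule blockE_eq_menergy)
  show "countable S" "countable T" using assms(3,4) countable_I by (auto intro: countable_subset)
  show "finite_radon (\<mu> i)" if "i \<in> S" for i using assms that by (intro mass_bounded_finite_radon) auto
  show "finite_radon (\<nu> j)" if "j \<in> T" for j using assms that by (intro mass_bounded_finite_radon) auto
  show "finite_radon (sum_measure T \<nu>)" using assms(2,4) by (rule mass_bounded_finite_radon_sum)
qed

lemma R_mem: assumes \<mu>: "\<mu> \<in> mass_bounded" shows "R \<mu> \<in> \<E> \<times> \<E>"
proof -
  have "blockE \<kappa> Ip Ip \<mu> \<mu> < \<infinity>" "blockE \<kappa> In In \<mu> \<mu> < \<infinity>"
    using \<mu> by (auto simp: mass_bounded_def EplusA_def)
  then show ?thesis
    using mass_bounded_finite_radon_sum[OF \<mu>] mass_bounded_blockE[OF \<mu> \<mu>] by (simp add: R_def \<E>_def)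
qed

lemma sum_measure_mem:
  assumes "\<mu> \<in> mass_bounded" shows "sum_measure Ip \<mu> \<in> \<E>" "sum_measure In \<mu> \<in> \<E>"
  using R_mem[OF assms] by (auto simp: R_def)

lemma total_mem: "\<mu> \<in> mass_bounded \<Longrightarrow> total \<mu> \<in> \<E> \<times> \<E>"
  by (intro signed_add_mem R_mem chi_mem)

lemma mass_bounded_component:
  assumes \<mu>: "\<mu> \<in> mass_bounded" and i: "i \<in> I"
  shows "\<mu> i \<in> \<E>"
  using i \<E>_sum_measure_component[OF sum_measure_mem(1)[OF \<mu>]]
    \<E>_sum_measure_component[OF sum_measure_mem(2)[OF \<mu>]] mass_bounded_finite_radon[OF \<mu>] by blast

lemma mass_boundedI:
  assumes R: "R \<mu> \<in> \<E> \<times> \<E>"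
    and \<mu>: "\<And>i. i \<in> I \<Longrightarrow> finite_radon (\<mu> i)" "\<And>i. i \<in> I \<Longrightarrow> AE x in \<mu> i. x \<in> A i"
      "\<And>i. i \<in> I \<Longrightarrow> emeasure (\<mu> i) UNIV \<le> ennreal (a i / c)"
  shows "\<mu> \<in> mass_bounded"
proof -
  have sum: "sum_measure Ip \<mu> \<in> \<E>" "sum_measure In \<mu> \<in> \<E>" using R by (auto simp: R_def)
  have "blockE \<kappa> S T \<mu> \<mu> = menergy \<kappa> (sum_measure S \<mu>) (sum_measure T \<mu>)"
    if "S \<in> {Ip, In}" "T \<in> {Ip, In}" for S T
    using that \<mu>(1) countable_Ip countable_In sum[THEN \<E>_finite_radon]
    by (intro blockE_eq_menergy) auto
  then have "blockE \<kappa> Ip Ip \<mu> \<mu> < \<infinity>" "blockE \<kappa> In In \<mu> \<mu> < \<infinity>" "blockE \<kappa> Ip In \<mu> \<mu> < \<infinity>"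
    using menergy_finite[OF sum(1,1)] menergy_finite[OF sum(2,2)] menergy_finite[OF sum] by simp_all
  moreover have "radon (\<mu> i) \<and> concentrated (\<mu> i) (A i)" if "i \<in> I" for i
    using \<mu>(1,2)[OF that]
    by (simp add: concentrated_iff_AE finite_radon_sets) (simp add: finite_radon_def)
  ultimately show ?thesis using \<mu>(3) by (simp add: mass_bounded_def EplusA_def)
qed

lemma vmut_eq: "\<mu> \<in> mass_bounded \<Longrightarrow> \<nu> \<in> mass_bounded \<Longrightarrow> vmut \<kappa> Ip In \<mu> \<nu> = \<langle>R \<mu>, R \<nu>\<rangle>"
  by (simp add: vmut_def signed_energy_def energy_def R_def mass_bounded_blockE)

lemma vdist_eq:
  "\<mu> \<in> mass_bounded \<Longrightarrow> \<nu> \<in> mass_bounded \<Longrightarrow>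
    vdist \<kappa> Ip In \<mu> \<nu> = sqrt \<langle>R \<mu> \<ominus> R \<nu>, R \<mu> \<ominus> R \<nu>\<rangle>"
  by (simp add: vdist_def vmut_eq signed_energy_diff_self R_mem)

lemma chimut_eq:
  assumes \<mu>: "\<mu> \<in> mass_bounded" shows "chimut \<kappa> Ip In chiP chiN \<mu> = \<langle>R \<mu>, chi\<rangle>"
proof -
  have "(\<Sum>\<^sub>\<infinity>i\<in>S. menergy \<kappa> \<xi> (\<mu> i)) = menergy \<kappa> \<xi> (sum_measure S \<mu>)"
    if S: "S \<subseteq> I" "countable S" and "\<xi> \<in> \<E>" for S \<xi>
  proof (rule menergy_sum_measure_right[symmetric])
    show "finite_radon (\<mu> j)" if "j \<in> S" for j
      using \<mu> S(1) that by (intro mass_bounded_finite_radon) auto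
  qed (use that \<mu> in \<open>auto intro: mass_bounded_finite_radon_sum \<E>_finite_radon\<close>)
  then have "chimut \<kappa> Ip In chiP chiN \<mu> = \<langle>chi, R \<mu>\<rangle>"
    using chi_mem countable_Ip countable_In
    by (simp add: chimut_def signed_energy_def energy_def R_def)
  then show ?thesis using signed_energy_commute[OF chi_mem R_mem[OF \<mu>]] by simp
qed

lemma G_eq: "\<mu> \<in> mass_bounded \<Longrightarrow> G \<mu> = \<langle>R \<mu>, R \<mu>\<rangle> + 2 * \<langle>R \<mu>, chi\<rangle>"
  by (simp add: Gchi_def vnorm2_def vmut_eq chimut_eq)

definition charge :: "'i \<Rightarrow> 'a measure \<Rightarrow> 'a measure \<times> 'a measure" where
  "charge i m = (if i \<in> Ip then (m, null_measure borel) else (null_measure borel, m))"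

lemma charge_mem: "m \<in> \<E> \<Longrightarrow> charge i m \<in> \<E> \<times> \<E>"
  by (simp add: charge_def \<E>_null_measure)

lemma signed_energy_charge:
  "\<langle>charge i m, \<tau>\<rangle> = alpha Ip i * (energy m (fst \<tau>) - energy m (snd \<tau>))"
  by (simp add: charge_def signed_energy_def alpha_def)

lemma signed_energy_charge_charge: "\<langle>charge i m, charge i n\<rangle> = energy m n"
  by (simp add: charge_def signed_energy_def)

lemma signed_energy_R_has_sum:
  assumes \<mu>: "\<mu> \<in> mass_bounded" and \<tau>: "\<tau> \<in> \<E> \<times> \<E>"
  shows "((\<lambda>i. \<langle>charge i (\<mu> i), \<tau>\<rangle>) has_sum \<langle>R \<mu>, \<tau>\<rangle>) I"
proof -
  let ?f = "\<lambda>i. \<langle>charge i (\<mu> i), \<tau>\<rangle>"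
  have has_sum: "((\<lambda>i. energy (\<mu> i) \<xi>) has_sum energy (sum_measure S \<mu>) \<xi>) S"
    if "S \<in> {Ip, In}" "\<xi> \<in> \<E>" for S \<xi>
    using that sum_measure_mem[OF \<mu>] mass_bounded_finite_radon[OF \<mu>]
    by (intro energy_sum_measure_has_sum) auto
  have \<tau>': "fst \<tau> \<in> \<E>" "snd \<tau> \<in> \<E>" using \<tau> by auto
  have positive: "(?f has_sum energy (sum_measure Ip \<mu>) (fst \<tau>) - energy (sum_measure Ip \<mu>) (snd \<tau>)) Ip"
    by (rule has_sum_cong[THEN iffD1, OF _ has_sum_diff[OF has_sum[OF _ \<tau>'(1)] has_sum[OF _ \<tau>'(2)]]])
      (auto simp: signed_energy_charge alpha_def)
  have negative: "(?f has_sum energy (sum_measure In \<mu>) (snd \<tau>) - energy (sum_measure In \<mu>) (fst \<tau>)) In"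
    using disjoint_I
    by (intro has_sum_cong[THEN iffD1, OF _ has_sum_diff[OF has_sum[OF _ \<tau>'(2)] has_sum[OF _ \<tau>'(1)]]])
      (auto simp: signed_energy_charge alpha_def)
  show ?thesis
    using has_sum_Un_disjoint[OF positive negative disjoint_I]
    by (simp add: signed_energy_def R_def algebra_simps)
qed

lemma signed_energy_R_update:
  assumes \<mu>: "\<mu> \<in> mass_bounded" and \<mu>': "\<mu>(i := \<nu>) \<in> mass_bounded" and i: "i \<in> I" and \<tau>: "\<tau> \<in> \<E> \<times> \<E>"
  shows "\<langle>R (\<mu>(i := \<nu>)), \<tau>\<rangle> = \<langle>R \<mu>, \<tau>\<rangle> + (\<langle>charge i \<nu>, \<tau>\<rangle> - \<langle>charge i (\<mu> i), \<tau>\<rangle>)"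
proof (rule has_sum_unique[OF signed_energy_R_has_sum[OF \<mu>' \<tau>]])
  let ?d = "\<langle>charge i \<nu>, \<tau>\<rangle> - \<langle>charge i (\<mu> i), \<tau>\<rangle>"
  have "((\<lambda>j. if j = i then ?d else 0) has_sum ?d) I"
    using i by (intro has_sum_finite_neutralI[where B = "{i}"]) auto
  with signed_energy_R_has_sum[OF \<mu> \<tau>]
  have "((\<lambda>j. \<langle>charge j (\<mu> j), \<tau>\<rangle> + (if j = i then ?d else 0)) has_sum \<langle>R \<mu>, \<tau>\<rangle> + ?d) I"
    by (rule has_sum_add)
  moreover have "\<langle>charge j (\<mu> j), \<tau>\<rangle> + (if j = i then ?d else 0) = \<langle>charge j ((\<mu>(i := \<nu>)) j), \<tau>\<rangle>" for j
    by simp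
  ultimately show "((\<lambda>j. \<langle>charge j ((\<mu>(i := \<nu>)) j), \<tau>\<rangle>) has_sum \<langle>R \<mu>, \<tau>\<rangle> + ?d) I"
    by (simp only:)
qed

lemma G_update_mix:
  assumes \<mu>: "\<mu> \<in> mass_bounded" and \<mu>': "\<mu>(i := mix t (\<mu> i) \<nu>) \<in> mass_bounded" and i: "i \<in> I"
    and \<nu>: "\<nu> \<in> \<E>" and t: "0 \<le> t" "t \<le> 1"
  shows "G (\<mu>(i := mix t (\<mu> i) \<nu>)) = G \<mu>
    + 2 * t * (\<langle>charge i \<nu>, total \<mu>\<rangle> - \<langle>charge i (\<mu> i), total \<mu>\<rangle>)
    + t\<^sup>2 * (energy \<nu> \<nu> - 2 * energy \<nu> (\<mu> i) + energy (\<mu> i) (\<mu> i))"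
proof -
  let ?\<mu> = "\<mu>(i := mix t (\<mu> i) \<nu>)"
  note mem = charge_mem[OF \<nu>] charge_mem[OF mass_bounded_component[OF \<mu> i]]
  have update: "\<langle>R ?\<mu>, \<tau>\<rangle> = \<langle>R \<mu>, \<tau>\<rangle> + t * (\<langle>charge i \<nu>, \<tau>\<rangle> - \<langle>charge i (\<mu> i), \<tau>\<rangle>)"
    if \<tau>: "\<tau> \<in> \<E> \<times> \<E>" for \<tau>
  proof -
    have "\<langle>charge i (mix t (\<mu> i) \<nu>), \<tau>\<rangle> = (1 - t) * \<langle>charge i (\<mu> i), \<tau>\<rangle> + t * \<langle>charge i \<nu>, \<tau>\<rangle>"
      using mass_bounded_component[OF \<mu> i] \<nu> t \<tau>
      by (auto simp: signed_energy_charge energy_mix_left algebra_simps)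
    then show ?thesis
      unfolding signed_energy_R_update[OF \<mu> \<mu>' i \<tau>] by (simp add: algebra_simps)
  qed
  have "\<langle>R ?\<mu>, R ?\<mu>\<rangle> = \<langle>R \<mu>, R \<mu>\<rangle> + 2 * t * (\<langle>charge i \<nu>, R \<mu>\<rangle> - \<langle>charge i (\<mu> i), R \<mu>\<rangle>)
      + t\<^sup>2 * (\<langle>charge i \<nu>, charge i \<nu>\<rangle> - 2 * \<langle>charge i \<nu>, charge i (\<mu> i)\<rangle>
        + \<langle>charge i (\<mu> i), charge i (\<mu> i)\<rangle>)"
    using R_mem[OF \<mu>] R_mem[OF \<mu>'] mem update by (rule signed_energy_perturbation)
  then show ?thesis
    unfolding G_eq[OF \<mu>] G_eq[OF \<mu>'] update[OF chi_mem] signed_energy_charge_charge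
      signed_energy_add_right[OF mem(1) R_mem[OF \<mu>] chi_mem]
      signed_energy_add_right[OF mem(2) R_mem[OF \<mu>] chi_mem]
    by (simp add: algebra_simps)
qed

lemma energy_parts_bounded:
  obtains b where "\<And>\<mu>. \<mu> \<in> mass_bounded \<Longrightarrow> energy (fst (R \<mu>)) (snd (R \<mu>)) \<le> b"
proof -
  define k where "k = (SUP p\<in>(\<Union>i\<in>Ip. A i) \<times> (\<Union>j\<in>In. A j). \<kappa> (fst p) (snd p))"
  let ?T = "ennreal (\<Sum>\<^sub>\<infinity>i\<in>I. a i / c)"
  have k: "k < \<infinity>" using condenser by (simp add: condenser_def k_def)
  have "menergy \<kappa> (fst (R \<mu>)) (snd (R \<mu>)) \<le> k * ?T * ?T" if \<mu>: "\<mu> \<in> mass_bounded" for \<mu>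
  proof -
    have sets: "sets (\<mu> i) = sets borel" if "i \<in> I" for i
      using mass_bounded_finite_radon[OF \<mu> that] by (rule finite_radon_sets)
    have AE: "AE x in sum_measure S \<mu>. x \<in> (\<Union>i\<in>S. A i)" if S: "S \<subseteq> I" for S
    proof (rule AE_sum_measure)
      show "(\<Union>i\<in>S. A i) \<in> sets borel"
        using S countable_subset[OF S countable_I] borel_A by (intro sets.countable_UN') auto
      show "AE x in \<mu> i. x \<in> (\<Union>i\<in>S. A i)" if "i \<in> S" for i
        using mass_bounded_AE[OF \<mu> subsetD[OF S that]] by eventually_elim (use that in blast)
    qed (use sets S in auto)
    have mass: "emeasure (sum_measure S \<mu>) UNIV \<le> ?T" if S: "S \<subseteq> I" for S
      using total_mass_le[OF S, of \<mu>] sets \<mu> S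
      by (subst emeasure_sum_measure) (auto simp: mass_bounded_def)
    have "menergy \<kappa> (fst (R \<mu>)) (snd (R \<mu>))
        \<le> k * emeasure (sum_measure In \<mu>) UNIV * emeasure (sum_measure Ip \<mu>) UNIV"
      unfolding R_def fst_conv snd_conv
    proof (rule menergy_le_bounded_kernel)
      show "\<kappa> x y \<le> k" if "x \<in> (\<Union>i\<in>Ip. A i)" "y \<in> (\<Union>j\<in>In. A j)" for x y
        unfolding k_def using that by (intro SUP_upper2[of "(x, y)"]) auto
    qed (use mass_bounded_finite_radon_sum[OF \<mu>] AE in \<open>simp_all del: UN_iff\<close>)
    also have "\<dots> \<le> k * ?T * ?T" using mass by (intro mult_mono) auto
    finally show ?thesis .
  qed
  moreover have "k * ?T * ?T < top" using k by (simp add: ennreal_mult_less_top)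
  ultimately have "energy (fst (R \<mu>)) (snd (R \<mu>)) \<le> enn2real (k * ?T * ?T)" if "\<mu> \<in> mass_bounded" for \<mu>
    unfolding energy_def using that by (intro enn2real_mono)
  then show thesis by (rule that)
qed

section \<open>Constrained measures on a plate\<close>

definition feasible :: "'i \<Rightarrow> 'a measure set" where
  "feasible i = {\<nu>\<in>\<E>. (AE x in \<nu>. x \<in> A i) \<and> (\<integral>\<^sup>+ x. ennreal (g x) \<partial>\<nu>) = ennreal (a i)}"

text \<open>Off \<open>A i\<close> the function \<open>g\<close> is arbitrary and need not be Borel.\<close>

definition g_on :: "'i \<Rightarrow> 'a \<Rightarrow> real" where
  "g_on i x = indicator (A i) x *\<^sub>R g x"

lemma g_on_eq: "x \<in> A i \<Longrightarrow> g_on i x = g x"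
  by (simp add: g_on_def)

lemma g_on_measurable: "i \<in> I \<Longrightarrow> g_on i \<in> borel_measurable borel"
  unfolding g_on_def using borel_A g_continuous
  by (intro borel_measurable_continuous_on_indicator) (auto intro: continuous_on_subset)

lemma g_on_nonneg: "i \<in> I \<Longrightarrow> 0 \<le> g_on i x"
  using c_le_g[of i x] c_pos by (cases "x \<in> A i") (auto simp: g_on_def)

lemma nn_integral_g_on:
  "AE x in m. x \<in> A i \<Longrightarrow> (\<integral>\<^sup>+ x. ennreal (g x) \<partial>m) = (\<integral>\<^sup>+ x. ennreal (g_on i x) \<partial>m)"
  by (intro nn_integral_cong_AE) (auto simp: g_on_eq elim: eventually_mono)

lemma emeasure_le_nn_integral_g:
  assumes "i \<in> I" "AE x in m. x \<in> A i" "space m = UNIV"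
  shows "ennreal c * emeasure m UNIV \<le> (\<integral>\<^sup>+ x. ennreal (g x) \<partial>m)"
proof -
  have "ennreal c * emeasure m UNIV = (\<integral>\<^sup>+ x. ennreal c \<partial>m)" using assms(3) by simp
  also have "\<dots> \<le> (\<integral>\<^sup>+ x. ennreal (g x) \<partial>m)"
    using assms(2) c_le_g[OF assms(1)]
    by (intro nn_integral_mono_AE) (auto intro: ennreal_leI elim: eventually_mono)
  finally show ?thesis .
qed

lemma emeasure_le_of_constraint:
  assumes i: "i \<in> I" and "AE x in m. x \<in> A i" "space m = UNIV"
    and "(\<integral>\<^sup>+ x. ennreal (g x) \<partial>m) = ennreal (a i)"
  shows "emeasure m UNIV \<le> ennreal (a i / c)"
proof -
  have mass_le: "ennreal c * emeasure m UNIV \<le> ennreal (a i)"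
    using emeasure_le_nn_integral_g[OF assms(1-3)] assms(4) by simp
  show ?thesis
  proof (cases "emeasure m UNIV")
    case (real r)
    then have "c * r \<le> a i"
      using mass_le c_pos a_pos[OF i] by (simp add: ennreal_le_iff flip: ennreal_mult)
    then show ?thesis using real c_pos by (simp add: field_simps ennreal_leI)
  next
    case top
    then show ?thesis using mass_le c_pos by (simp add: ennreal_mult_top top_unique)
  qed
qed

lemma constrained_mass_bounded: "constrained \<subseteq> mass_bounded"
proof
  fix \<mu> assume \<mu>: "\<mu> \<in> constrained"
  have "emeasure (\<mu> i) UNIV \<le> ennreal (a i / c)" if i: "i \<in> I" for i
  proof (rule emeasure_le_of_constraint[OF i])
    have "radon (\<mu> i)" "concentrated (\<mu> i) (A i)" using \<mu> i by (auto simp: EplusAag_def EplusA_def)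
    then have sets: "sets (\<mu> i) = sets borel" by (simp add: radon_def)
    then show "AE x in \<mu> i. x \<in> A i" using \<open>concentrated (\<mu> i) (A i)\<close> by (simp add: concentrated_iff_AE)
    show "space (\<mu> i) = UNIV" using sets_eq_imp_space_eq[OF sets] by simp
    show "(\<integral>\<^sup>+ x. ennreal (g x) \<partial>\<mu> i) = ennreal (a i)" using \<mu> i by (simp add: EplusAag_def)
  qed
  then show "\<mu> \<in> mass_bounded" using \<mu> by (simp add: mass_bounded_def EplusAag_def)
qed

lemma constrained_component:
  assumes \<mu>: "\<mu> \<in> constrained" and i: "i \<in> I" shows "\<mu> i \<in> feasible i"
proof -
  have "\<mu> \<in> mass_bounded" using \<mu> constrained_mass_bounded by blast
  then show ?thesis
    using \<mu> i mass_bounded_component[of \<mu> i] mass_bounded_AE[of \<mu> i]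
    by (simp add: feasible_def EplusAag_def)
qed

lemma constrained_update:
  assumes \<mu>: "\<mu> \<in> constrained" and i: "i \<in> I" and \<nu>: "\<nu> \<in> feasible i"
  shows "\<mu>(i := \<nu>) \<in> constrained"
proof -
  let ?\<mu> = "\<mu>(i := \<nu>)"
  have bounded: "\<mu> \<in> mass_bounded" using \<mu> constrained_mass_bounded by blast
  have \<nu>': "\<nu> \<in> \<E>" "AE x in \<nu>. x \<in> A i" "(\<integral>\<^sup>+ x. ennreal (g x) \<partial>\<nu>) = ennreal (a i)"
    using \<nu> by (auto simp: feasible_def)
  have "?\<mu> \<in> mass_bounded"
  proof (rule mass_boundedI)
    show "R ?\<mu> \<in> \<E> \<times> \<E>"
      unfolding R_def
      using sum_measure_mem[OF bounded] mass_bounded_finite_radon[OF bounded] countable_Ip countable_In \<nu>'(1)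
      by (intro SigmaI \<E>_sum_measure_update) auto
    fix j assume j: "j \<in> I"
    show "finite_radon (?\<mu> j)"
      using mass_bounded_finite_radon[OF bounded j] \<E>_finite_radon[OF \<nu>'(1)] by simp
    show "AE x in ?\<mu> j. x \<in> A j"
      unfolding fun_upd_apply using mass_bounded_AE[OF bounded j] \<nu>'(2) by simp
    show "emeasure (?\<mu> j) UNIV \<le> ennreal (a j / c)"
      using bounded j emeasure_le_of_constraint[OF i \<nu>'(2) _ \<nu>'(3)]
        finite_radon_space[OF \<E>_finite_radon[OF \<nu>'(1)]]
      by (simp add: mass_bounded_def)
  qed
  then show ?thesis using \<mu> \<nu>'(3) by (auto simp: EplusAag_def mass_bounded_def)
qed

lemma feasible_mix:
  assumes i: "i \<in> I" and \<mu>: "\<mu> \<in> feasible i" and \<nu>: "\<nu> \<in> feasible i" and t: "0 \<le> t" "t \<le> 1"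
  shows "mix t \<mu> \<nu> \<in> feasible i"
proof -
  have \<mu>': "\<mu> \<in> \<E>" "AE x in \<mu>. x \<in> A i" "(\<integral>\<^sup>+ x. ennreal (g_on i x) \<partial>\<mu>) = ennreal (a i)"
    and \<nu>': "\<nu> \<in> \<E>" "AE x in \<nu>. x \<in> A i" "(\<integral>\<^sup>+ x. ennreal (g_on i x) \<partial>\<nu>) = ennreal (a i)"
    using \<mu> \<nu> by (auto simp: feasible_def nn_integral_g_on)
  note sets = \<E>_sets[OF \<mu>'(1)] \<E>_sets[OF \<nu>'(1)]
  have AE: "AE x in mix t \<mu> \<nu>. x \<in> A i"
    using sets borel_A[OF i] \<mu>'(2) \<nu>'(2) by (rule AE_mix)
  have "(\<integral>\<^sup>+ x. ennreal (g_on i x) \<partial>mix t \<mu> \<nu>)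
      = ennreal (1 - t) * ennreal (a i) + ennreal t * ennreal (a i)"
    using sets g_on_measurable[OF i] by (simp add: nn_integral_mix \<mu>'(3) \<nu>'(3))
  also have "\<dots> = ennreal ((1 - t) * a i + t * a i)"
    using t a_pos[OF i] by (simp add: ennreal_mult ennreal_plus)
  also have "\<dots> = ennreal (a i)" by (simp add: algebra_simps)
  finally show ?thesis
    using AE \<E>_mix[OF \<mu>'(1) \<nu>'(1)] by (simp add: feasible_def nn_integral_g_on)
qed

lemma has_bochner_integral_g_on:
  assumes i: "i \<in> I" and \<nu>: "\<nu> \<in> feasible i"
  shows "has_bochner_integral \<nu> (g_on i) (a i)"
proof (rule has_bochner_integral_nn_integral)
  show "g_on i \<in> borel_measurable \<nu>"
    using \<nu> g_on_measurable[OF i]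
    by (simp add: feasible_def borel_measurable_finite_radon \<E>_finite_radon)
  show "(\<integral>\<^sup>+ x. ennreal (g_on i x) \<partial>\<nu>) = ennreal (a i)"
    using \<nu> by (simp add: feasible_def nn_integral_g_on[symmetric])
qed (use i a_pos[OF i] g_on_nonneg in auto)

lemma feasible_scale_measure:
  assumes i: "i \<in> I" and m: "m \<in> \<E>" "AE x in m. x \<in> A i"
    and r: "(\<integral>\<^sup>+ x. ennreal (g x) \<partial>m) = ennreal r" "0 < r"
  shows "scale_measure (ennreal (a i / r)) m \<in> feasible i"
proof -
  let ?m = "scale_measure (ennreal (a i / r)) m"
  have AE: "AE x in ?m. x \<in> A i" using m(2) by (rule AE_scale_measure)
  have "(\<integral>\<^sup>+ x. ennreal (g_on i x) \<partial>?m) = ennreal (a i / r) * (\<integral>\<^sup>+ x. ennreal (g_on i x) \<partial>m)"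
    using g_on_measurable[OF i]
    by (intro nn_integral_scale_measure) (simp add: \<E>_sets[OF m(1)] cong: measurable_cong_sets)
  also have "\<dots> = ennreal (a i)"
    using r a_pos[OF i] by (simp add: nn_integral_g_on[OF m(2), symmetric] flip: ennreal_mult)
  finally have "(\<integral>\<^sup>+ x. ennreal (g x) \<partial>?m) = ennreal (a i)" by (simp add: nn_integral_g_on[OF AE])
  then show ?thesis using AE \<E>_scale_measure[OF m(1)] by (simp add: feasible_def)
qed

text \<open>The integral of \<open>g\<close> over \<open>m\<close> may be infinite, so \<open>m\<close> is restricted to a set where \<open>g\<close> is bounded
  before it is normalized.\<close>

lemma exists_feasible:
  assumes i: "i \<in> I" and m: "m \<in> \<E>" "emeasure m UNIV \<noteq> 0" and AE: "AE x in m. x \<in> A i \<and> P x"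
  obtains \<nu> where "\<nu> \<in> feasible i" "AE x in \<nu>. P x"
proof -
  note [simp] = \<E>_sets[OF m(1)] finite_radon_space[OF \<E>_finite_radon[OF m(1)]]
  note [measurable] = borel_A[OF i] g_on_measurable[OF i]
  define B where "B n = {x\<in>A i. g_on i x \<le> real n}" for n :: nat
  have B[measurable]: "B n \<in> sets borel" for n unfolding B_def by measurable
  obtain n where n: "emeasure m (B n) \<noteq> 0"
  proof -
    have "AE x in m. x \<in> (\<Union>n. B n)"
      using AE by eventually_elim (auto simp: B_def real_arch_simple)
    then have "emeasure m (\<Union>n. B n) = emeasure m (space m)" by (intro emeasure_eq_AE) auto
    then have "(\<Union>n. B n) \<notin> null_sets m" using m(2) by auto
    then obtain n where "B n \<notin> null_sets m" using null_sets_UN by blast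
    then have "emeasure m (B n) \<noteq> 0" using null_setsI[of m "B n"] by auto
    then show thesis by (rule that)
  qed
  define m' where "m' = restrict_measure m (B n)"
  have m': "m' \<in> \<E>" unfolding m'_def using m(1) B by (rule \<E>_restrict_measure)
  have mass: "emeasure m' UNIV = emeasure m (B n)"
    by (simp add: m'_def emeasure_restrict_measure)
  have AE_m': "(AE x in m'. Q x) \<longleftrightarrow> (AE x in m. x \<in> B n \<longrightarrow> Q x)" for Q
    unfolding m'_def using B by (intro AE_restrict_measure) simp
  have AE_A: "AE x in m'. x \<in> A i" and AE_P: "AE x in m'. P x" and AE_B: "AE x in m'. x \<in> B n"
    unfolding AE_m' using AE by (auto elim: eventually_mono)
  have space: "space m' = UNIV" by (rule finite_radon_space[OF \<E>_finite_radon[OF m']])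
  have "(\<integral>\<^sup>+ x. ennreal (g x) \<partial>m') \<le> (\<integral>\<^sup>+ x. ennreal n \<partial>m')"
    using AE_B
    by (intro nn_integral_mono_AE) (auto simp: B_def g_on_eq ennreal_leI elim: eventually_mono)
  also have "\<dots> < top"
    using \<E>_finite_radon[OF m'] space by (simp add: finite_radon_def ennreal_mult_less_top)
  finally obtain r where r: "(\<integral>\<^sup>+ x. ennreal (g x) \<partial>m') = ennreal r" "0 \<le> r"
    by (cases "\<integral>\<^sup>+ x. ennreal (g x) \<partial>m'") auto
  have "0 < ennreal c * emeasure m' UNIV"
    using n mass c_pos by (simp add: ennreal_zero_less_mult_iff zero_less_iff_neq_zero)
  also have "\<dots> \<le> ennreal r" using emeasure_le_nn_integral_g[OF i AE_A space] r(1) by simp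
  finally have "0 < r" by simp
  from feasible_scale_measure[OF i m' AE_A r(1) this] AE_scale_measure[OF AE_P]
  show thesis by (rule that)
qed

section \<open>Weighted potentials\<close>

lemma W_eq:
  assumes \<mu>: "\<mu> \<in> mass_bounded"
  shows "W \<mu> i x = ereal (alpha Ip i)
    * (enn2ereal (pot \<kappa> (fst (total \<mu>)) x) - enn2ereal (pot \<kappa> (snd (total \<mu>)) x))"
proof -
  have "pot \<kappa> (add_measure (sum_measure S \<mu>) \<xi>) x = pot \<kappa> \<xi> x + (\<Sum>\<^sub>\<infinity>j\<in>S. pot \<kappa> (\<mu> j) x)"
    if "S \<in> {Ip, In}" "\<xi> \<in> \<E>" for S \<xi>
    using that countable_Ip countable_In mass_bounded_finite_radon[OF \<mu>]
    by (subst pot_add_measure) (auto simp: pot_sum_measure finite_radon_sets \<E>_sets add.commute)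
  then show ?thesis using chi_mem by (simp add: Wpot_def signed_add_def R_def)
qed

lemma W_measurable:
  assumes \<mu>: "\<mu> \<in> mass_bounded" shows "W \<mu> i \<in> borel_measurable borel"
proof -
  have "total \<mu> \<in> \<E> \<times> \<E>" using \<mu> by (rule total_mem)
  then have [measurable]: "pot \<kappa> (fst (total \<mu>)) \<in> borel_measurable borel"
    "pot \<kappa> (snd (total \<mu>)) \<in> borel_measurable borel"
    by (auto simp: mem_Times_iff intro: pot_measurable \<E>_finite_radon)
  show ?thesis unfolding W_eq[OF \<mu>, abs_def] by measurable
qed

lemma
  assumes \<mu>: "\<mu> \<in> mass_bounded" and m: "m \<in> \<E>"
  shows W_AE_finite: "AE x in m. ereal (real_of_ereal (W \<mu> i x)) = W \<mu> i x"
    and has_bochner_integral_W: "has_bochner_integral m (\<lambda>x. real_of_ereal (W \<mu> i x)) \<langle>charge i m, total \<mu>\<rangle>"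
proof -
  let ?\<sigma> = "total \<mu>"
  let ?w = "\<lambda>x. alpha Ip i * (enn2real (pot \<kappa> (fst ?\<sigma>) x) - enn2real (pot \<kappa> (snd ?\<sigma>) x))"
  have \<sigma>: "fst ?\<sigma> \<in> \<E>" "snd ?\<sigma> \<in> \<E>" using total_mem[OF \<mu>] by (simp_all add: mem_Times_iff)
  have W_real: "AE x in m. W \<mu> i x = ereal (?w x)"
    using pot_AE_finite[OF m \<sigma>(1)] pot_AE_finite[OF m \<sigma>(2)]
  proof eventually_elim
    case (elim x)
    then obtain u v where "pot \<kappa> (fst ?\<sigma>) x = ennreal u" "0 \<le> u" "pot \<kappa> (snd ?\<sigma>) x = ennreal v" "0 \<le> v"
      by (cases "pot \<kappa> (fst ?\<sigma>) x"; cases "pot \<kappa> (snd ?\<sigma>) x") auto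
    then show ?case by (simp add: W_eq[OF \<mu>] enn2ereal_ennreal)
  qed
  then show "AE x in m. ereal (real_of_ereal (W \<mu> i x)) = W \<mu> i x"
    by eventually_elim simp
  have "has_bochner_integral m ?w \<langle>charge i m, ?\<sigma>\<rangle>"
    unfolding signed_energy_charge
    by (intro has_bochner_integral_mult_right has_bochner_integral_diff has_bochner_integral_pot m \<sigma>)
  moreover have "(\<lambda>x. real_of_ereal (W \<mu> i x)) \<in> borel_measurable m"
    using W_measurable[OF \<mu>, of i] by (simp add: borel_measurable_finite_radon[OF \<E>_finite_radon[OF m]])
  moreover have "AE x in m. ?w x = real_of_ereal (W \<mu> i x)"
    using W_real by eventually_elim simp
  ultimately show "has_bochner_integral m (\<lambda>x. real_of_ereal (W \<mu> i x)) \<langle>charge i m, ?\<sigma>\<rangle>"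
    by (subst has_bochner_integral_cong_AE[symmetric]) (auto dest: has_bochner_integral_iff[THEN iffD1])
qed

lemma intW_eq:
  "\<mu> \<in> mass_bounded \<Longrightarrow> i \<in> I \<Longrightarrow> intW \<kappa> Ip In chiP chiN \<mu> i = \<langle>charge i (\<mu> i), total \<mu>\<rangle>"
  unfolding intW_def by (intro has_bochner_integral_integral_eq has_bochner_integral_W mass_bounded_component)

lemma intW_has_sum:
  assumes \<mu>: "\<mu> \<in> mass_bounded"
  shows "((\<lambda>i. intW \<kappa> Ip In chiP chiN \<mu> i) has_sum (vnorm2 \<kappa> Ip In \<mu> + G \<mu>) / 2) I"
proof -
  have mem: "R \<mu> \<in> \<E> \<times> \<E>" using \<mu> by (rule R_mem)
  have "((\<lambda>i. \<langle>charge i (\<mu> i), total \<mu>\<rangle>) has_sum \<langle>R \<mu>, total \<mu>\<rangle>) I"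
    using \<mu> total_mem[OF \<mu>] by (rule signed_energy_R_has_sum)
  moreover have "\<langle>R \<mu>, total \<mu>\<rangle> = (vnorm2 \<kappa> Ip In \<mu> + G \<mu>) / 2"
    by (simp add: signed_energy_add_right[OF mem mem chi_mem] vnorm2_def vmut_eq G_eq \<mu>)
  ultimately show ?thesis
    by (subst has_sum_cong[OF intW_eq[OF \<mu>]]) simp_all
qed

lemma le_charge_of_AE_le_W:
  assumes i: "i \<in> I" and \<mu>: "\<mu> \<in> mass_bounded" and \<nu>: "\<nu> \<in> feasible i"
    and W_bound: "AE x in \<nu>. ereal (\<eta> * g x) \<le> ereal (a i) * W \<mu> i x"
  shows "\<eta> \<le> \<langle>charge i \<nu>, total \<mu>\<rangle>"
proof -
  have \<nu>': "\<nu> \<in> \<E>" "AE x in \<nu>. x \<in> A i" using \<nu> by (auto simp: feasible_def)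
  note G = has_bochner_integral_mult_right[OF has_bochner_integral_g_on[OF i \<nu>], of \<eta>]
  note W = has_bochner_integral_mult_right[OF has_bochner_integral_W[OF \<mu> \<nu>'(1)], of "a i" i]
  have "AE x in \<nu>. \<eta> * g_on i x \<le> a i * real_of_ereal (W \<mu> i x)"
    using W_bound W_AE_finite[OF \<mu> \<nu>'(1), of i] \<nu>'(2)
  proof eventually_elim
    case (elim x)
    then have "ereal (\<eta> * g_on i x) \<le> ereal (a i) * ereal (real_of_ereal (W \<mu> i x))"
      by (simp add: g_on_eq)
    then show ?case by simp
  qed
  then have "(\<integral>x. \<eta> * g_on i x \<partial>\<nu>) \<le> (\<integral>x. a i * real_of_ereal (W \<mu> i x) \<partial>\<nu>)"
    using G W by (intro integral_mono_AE) (auto simp: has_bochner_integral_iff)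
  then have "\<eta> * a i \<le> a i * \<langle>charge i \<nu>, total \<mu>\<rangle>"
    unfolding has_bochner_integral_integral_eq[OF G] has_bochner_integral_integral_eq[OF W] .
  then show ?thesis using a_pos[OF i] by (simp add: mult.commute)
qed

lemma charge_less_of_AE_W_less:
  assumes i: "i \<in> I" and \<mu>: "\<mu> \<in> mass_bounded" and \<nu>: "\<nu> \<in> feasible i"
    and less: "AE x in \<nu>. ereal (a i) * W \<mu> i x < ereal (\<eta> * g x)"
  shows "\<langle>charge i \<nu>, total \<mu>\<rangle> < \<eta>"
proof -
  have \<nu>': "\<nu> \<in> \<E>" "AE x in \<nu>. x \<in> A i" "(\<integral>\<^sup>+ x. ennreal (g x) \<partial>\<nu>) = ennreal (a i)"
    using \<nu> by (auto simp: feasible_def)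
  interpret finite_measure \<nu> using \<nu>'(1) by (intro finite_radon_finite_measure \<E>_finite_radon)
  note G = has_bochner_integral_mult_right[OF has_bochner_integral_g_on[OF i \<nu>], of \<eta>]
  note W = has_bochner_integral_mult_right[OF has_bochner_integral_W[OF \<mu> \<nu>'(1)], of "a i" i]
  have "AE x in \<nu>. a i * real_of_ereal (W \<mu> i x) < \<eta> * g_on i x"
    using less W_AE_finite[OF \<mu> \<nu>'(1), of i] \<nu>'(2)
  proof eventually_elim
    case (elim x)
    then have "ereal (a i) * ereal (real_of_ereal (W \<mu> i x)) < ereal (\<eta> * g_on i x)"
      by (simp add: g_on_eq)
    then show ?case by simp
  qed
  moreover have "emeasure \<nu> (space \<nu>) \<noteq> 0"
  proof
    assume "emeasure \<nu> (space \<nu>) = 0"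
    then have "AE x in \<nu>. False" by (intro AE_I'[of "space \<nu>"]) auto
    then have "(\<integral>\<^sup>+ x. ennreal (g x) \<partial>\<nu>) = (\<integral>\<^sup>+ x. 0 \<partial>\<nu>)"
      by (intro nn_integral_cong_AE) (auto elim: eventually_mono)
    then show False using \<nu>'(3) a_pos[OF i] by simp
  qed
  ultimately have "(\<integral>x. a i * real_of_ereal (W \<mu> i x) \<partial>\<nu>) < (\<integral>x. \<eta> * g_on i x \<partial>\<nu>)"
    using G W by (intro integral_less_AE_space) (auto simp: has_bochner_integral_iff)
  then have "a i * \<langle>charge i \<nu>, total \<mu>\<rangle> < \<eta> * a i"
    unfolding has_bochner_integral_integral_eq[OF G] has_bochner_integral_integral_eq[OF W] .
  then show ?thesis using a_pos[OF i] by (simp add: mult.commute)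
qed

end

section \<open>Extremal measures\<close>

lemma nonneg_of_linear_perturbation:
  fixes d b :: real
  assumes "\<And>t. 0 < t \<Longrightarrow> t \<le> 1 \<Longrightarrow> 0 \<le> d + t * b"
  shows "0 \<le> d"
proof -
  have "((\<lambda>t. d + t * b) \<longlongrightarrow> d + 0 * b) (at_right 0)" by (intro tendsto_intros)
  moreover have "\<forall>\<^sub>F t in at_right 0. 0 \<le> d + t * b"
    unfolding eventually_at_right_field using assms by (intro exI[of _ 1]) auto
  ultimately have "0 \<le> d + 0 * b" by (rule tendsto_lowerbound) simp
  then show ?thesis by simp
qed

locale minimizing_net = constrained_condenser \<kappa> h Ip In A chiP chiN g a c + consistent_kernel \<kappa> h
  for \<kappa> :: "'a::t2_space \<Rightarrow> 'a \<Rightarrow> ennreal" and h :: real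
    and Ip In :: "'i set" and A chiP chiN g a c +
  fixes F :: "('i \<Rightarrow> 'a measure) filter" and \<gamma> :: "'i \<Rightarrow> 'a measure"
  assumes locally_compact: "locally_compact_space (euclidean :: 'a topology)"
    and F_nonbot: "F \<noteq> bot"
    and \<gamma>_EplusA: "\<gamma> \<in> EplusA \<kappa> Ip In A"
    and eventually_constrained: "\<forall>\<^sub>F \<mu> in F. \<mu> \<in> constrained"
    and minimizing: "((\<lambda>\<mu>. ereal (G \<mu>)) \<longlongrightarrow> Ginf \<kappa> Ip In A chiP chiN a g I) F"
    and strong: "((\<lambda>\<mu>. vdist \<kappa> Ip In \<mu> \<gamma>) \<longlongrightarrow> 0) F"
    and vague: "\<And>i f. i \<in> I \<Longrightarrow> f \<in> Cc \<Longrightarrow> ((\<lambda>\<mu>. \<integral>x. f x \<partial>\<mu> i) \<longlongrightarrow> (\<integral>x. f x \<partial>\<gamma> i)) F"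
begin

lemma eventually_mass_bounded: "\<forall>\<^sub>F \<mu> in F. \<mu> \<in> mass_bounded"
  using eventually_constrained by eventually_elim (use constrained_mass_bounded in blast)

lemma \<gamma>_mass_bounded: "\<gamma> \<in> mass_bounded"
proof -
  have "emeasure (\<gamma> i) UNIV \<le> ennreal (a i / c)" if i: "i \<in> I" for i
  proof (rule vague_limit_mass_le[OF locally_compact F_nonbot _ _ vague[OF i]])
    show "radon (\<gamma> i)" using \<gamma>_EplusA i by (simp add: EplusA_def)
    show "\<forall>\<^sub>F \<mu> in F. finite_radon (\<mu> i) \<and> measure (\<mu> i) UNIV \<le> a i / c"
      using eventually_mass_bounded
    proof eventually_elim
      case (elim \<mu>)
      have "measure (\<mu> i) UNIV \<le> a i / c"
        using elim i a_pos[OF i] c_pos unfolding measure_def mass_bounded_def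
        by (intro enn2real_leI) auto
      with mass_bounded_finite_radon[OF elim i] show ?case by blast
    qed
  qed
  then show ?thesis using \<gamma>_EplusA by (simp add: mass_bounded_def)
qed

lemma R_\<gamma>_mem: "R \<gamma> \<in> \<E> \<times> \<E>"
  using \<gamma>_mass_bounded by (rule R_mem)

lemma R_tendsto_strong: "((\<lambda>\<mu>. sqrt \<langle>R \<mu> \<ominus> R \<gamma>, R \<mu> \<ominus> R \<gamma>\<rangle>) \<longlongrightarrow> 0) F"
proof (rule Lim_transform_eventually[OF strong])
  show "\<forall>\<^sub>F \<mu> in F. vdist \<kappa> Ip In \<mu> \<gamma> = sqrt \<langle>R \<mu> \<ominus> R \<gamma>, R \<mu> \<ominus> R \<gamma>\<rangle>"
    using eventually_mass_bounded by eventually_elim (simp add: vdist_eq \<gamma>_mass_bounded)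
qed

lemma total_tendsto_weak_strong:
  assumes \<rho>: "\<forall>\<^sub>F \<mu> in F. \<rho> \<mu> \<in> \<E> \<times> \<E> \<and> \<langle>\<rho> \<mu>, \<rho> \<mu>\<rangle> \<le> b" and weak: "((\<lambda>\<mu>. \<langle>\<rho> \<mu>, total \<gamma>\<rangle>) \<longlongrightarrow> l) F"
  shows "((\<lambda>\<mu>. \<langle>\<rho> \<mu>, total \<mu>\<rangle>) \<longlongrightarrow> l) F"
proof (rule signed_energy_tendsto_weak_strong[OF \<rho> _ _ weak])
  show "total \<gamma> \<in> \<E> \<times> \<E>" using \<gamma>_mass_bounded by (rule total_mem)
  show "\<forall>\<^sub>F \<mu> in F. total \<mu> \<in> \<E> \<times> \<E>"
    using eventually_mass_bounded by eventually_elim (rule total_mem)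
  show "((\<lambda>\<mu>. sqrt \<langle>total \<mu> \<ominus> total \<gamma>, total \<mu> \<ominus> total \<gamma>\<rangle>) \<longlongrightarrow> 0) F"
  proof (rule Lim_transform_eventually[OF R_tendsto_strong])
    show "\<forall>\<^sub>F \<mu> in F. sqrt \<langle>R \<mu> \<ominus> R \<gamma>, R \<mu> \<ominus> R \<gamma>\<rangle> = sqrt \<langle>total \<mu> \<ominus> total \<gamma>, total \<mu> \<ominus> total \<gamma>\<rangle>"
      using eventually_mass_bounded
    proof eventually_elim
      case (elim \<mu>)
      show ?case using signed_energy_diff_translate[OF R_mem[OF elim] R_\<gamma>_mem chi_mem] by simp
    qed
  qed
qed

lemma R_tendsto_weak:
  assumes \<tau>: "\<tau> \<in> \<E> \<times> \<E>" shows "((\<lambda>\<mu>. \<langle>R \<mu>, \<tau>\<rangle>) \<longlongrightarrow> \<langle>R \<gamma>, \<tau>\<rangle>) F"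
proof -
  have "((\<lambda>\<mu>. \<langle>\<tau>, R \<mu>\<rangle>) \<longlongrightarrow> \<langle>\<tau>, R \<gamma>\<rangle>) F"
  proof (rule signed_energy_tendsto_weak_strong[OF _ _ R_\<gamma>_mem tendsto_const R_tendsto_strong])
    show "\<forall>\<^sub>F \<mu> in F. \<tau> \<in> \<E> \<times> \<E> \<and> \<langle>\<tau>, \<tau>\<rangle> \<le> \<langle>\<tau>, \<tau>\<rangle>" using \<tau> by simp
    show "\<forall>\<^sub>F \<mu> in F. R \<mu> \<in> \<E> \<times> \<E>"
      using eventually_mass_bounded by eventually_elim (rule R_mem)
  qed
  moreover have "\<forall>\<^sub>F \<mu> in F. \<langle>\<tau>, R \<mu>\<rangle> = \<langle>R \<mu>, \<tau>\<rangle>"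
    using eventually_mass_bounded by eventually_elim (intro signed_energy_commute \<tau> R_mem)
  ultimately show ?thesis
    unfolding signed_energy_commute[OF \<tau> R_\<gamma>_mem] by (rule Lim_transform_eventually)
qed

lemma R_norm_tendsto: "((\<lambda>\<mu>. \<langle>R \<mu>, R \<mu>\<rangle>) \<longlongrightarrow> \<langle>R \<gamma>, R \<gamma>\<rangle>) F"
proof -
  let ?d = "\<lambda>\<mu>. sqrt \<langle>R \<mu> \<ominus> R \<gamma>, R \<mu> \<ominus> R \<gamma>\<rangle>"
  have "((\<lambda>\<mu>. (?d \<mu>)\<^sup>2 + 2 * \<langle>R \<mu>, R \<gamma>\<rangle> - \<langle>R \<gamma>, R \<gamma>\<rangle>) \<longlongrightarrow> 0\<^sup>2 + 2 * \<langle>R \<gamma>, R \<gamma>\<rangle> - \<langle>R \<gamma>, R \<gamma>\<rangle>) F"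
    by (intro tendsto_intros R_tendsto_strong R_tendsto_weak R_\<gamma>_mem)
  moreover have "\<forall>\<^sub>F \<mu> in F. (?d \<mu>)\<^sup>2 + 2 * \<langle>R \<mu>, R \<gamma>\<rangle> - \<langle>R \<gamma>, R \<gamma>\<rangle> = \<langle>R \<mu>, R \<mu>\<rangle>"
    using eventually_mass_bounded
  proof eventually_elim
    case (elim \<mu>)
    have "0 \<le> \<langle>R \<mu> \<ominus> R \<gamma>, R \<mu> \<ominus> R \<gamma>\<rangle>"
      by (intro signed_energy_self_nonneg signed_add_mem swap_mem R_mem elim R_\<gamma>_mem)
    then show ?case by (simp add: signed_energy_diff_self[OF R_mem[OF elim] R_\<gamma>_mem])
  qed
  ultimately have "((\<lambda>\<mu>. \<langle>R \<mu>, R \<mu>\<rangle>) \<longlongrightarrow> 0\<^sup>2 + 2 * \<langle>R \<gamma>, R \<gamma>\<rangle> - \<langle>R \<gamma>, R \<gamma>\<rangle>) F"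
    by (rule Lim_transform_eventually)
  then show ?thesis by simp
qed

lemma G_tendsto: "(G \<longlongrightarrow> G \<gamma>) F"
proof -
  have "((\<lambda>\<mu>. \<langle>R \<mu>, R \<mu>\<rangle> + 2 * \<langle>R \<mu>, chi\<rangle>) \<longlongrightarrow> G \<gamma>) F"
    unfolding G_eq[OF \<gamma>_mass_bounded] by (intro tendsto_intros R_norm_tendsto R_tendsto_weak chi_mem)
  moreover have "\<forall>\<^sub>F \<mu> in F. \<langle>R \<mu>, R \<mu>\<rangle> + 2 * \<langle>R \<mu>, chi\<rangle> = G \<mu>"
    using eventually_mass_bounded by eventually_elim (simp add: G_eq)
  ultimately show ?thesis by (rule Lim_transform_eventually)
qed

lemma Ginf_eq: "Ginf \<kappa> Ip In A chiP chiN a g I = ereal (G \<gamma>)"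
  using tendsto_unique[OF F_nonbot minimizing] G_tendsto by simp

lemma eventually_component_energy_le:
  obtains b where "\<forall>\<^sub>F \<mu> in F. \<forall>i\<in>I. energy (\<mu> i) (\<mu> i) \<le> b"
proof -
  obtain k where k: "\<And>\<mu>. \<mu> \<in> mass_bounded \<Longrightarrow> energy (fst (R \<mu>)) (snd (R \<mu>)) \<le> k"
    using energy_parts_bounded by blast
  define b where "b = \<langle>R \<gamma>, R \<gamma>\<rangle> + 1 + 2 * k"
  have "\<forall>\<^sub>F \<mu> in F. \<langle>R \<mu>, R \<mu>\<rangle> < \<langle>R \<gamma>, R \<gamma>\<rangle> + 1"
    using R_norm_tendsto by (rule order_tendstoD(2)) simp
  with eventually_mass_bounded have "\<forall>\<^sub>F \<mu> in F. \<forall>i\<in>I. energy (\<mu> i) (\<mu> i) \<le> b"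
  proof eventually_elim
    case (elim \<mu>)
    note sum = sum_measure_mem[OF elim(1)]
    have "\<langle>R \<mu>, R \<mu>\<rangle> = energy (sum_measure Ip \<mu>) (sum_measure Ip \<mu>)
        + energy (sum_measure In \<mu>) (sum_measure In \<mu>) - 2 * energy (sum_measure Ip \<mu>) (sum_measure In \<mu>)"
      using energy_commute[OF sum] by (simp add: signed_energy_def R_def)
    then have "energy (sum_measure S \<mu>) (sum_measure S \<mu>) \<le> b" if "S \<in> {Ip, In}" for S
      using that elim(2) k[OF elim(1)] energy_nonneg[of "sum_measure Ip \<mu>" "sum_measure Ip \<mu>"]
        energy_nonneg[of "sum_measure In \<mu>" "sum_measure In \<mu>"]
      by (auto simp: b_def R_def)
    moreover have "energy (\<mu> i) (\<mu> i) \<le> energy (sum_measure S \<mu>) (sum_measure S \<mu>)"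
      if "i \<in> S" "S \<in> {Ip, In}" for i S
      using that sum mass_bounded_finite_radon[OF elim(1)] by (intro energy_component_le) auto
    ultimately show ?case by (blast intro: order_trans)
  qed
  then show thesis by (rule that)
qed

lemma charge_tendsto:
  assumes i: "i \<in> I" and \<tau>: "\<tau> \<in> \<E> \<times> \<E>"
  shows "((\<lambda>\<mu>. \<langle>charge i (\<mu> i), \<tau>\<rangle>) \<longlongrightarrow> \<langle>charge i (\<gamma> i), \<tau>\<rangle>) F"
proof -
  obtain b where b: "\<forall>\<^sub>F \<mu> in F. \<forall>i\<in>I. energy (\<mu> i) (\<mu> i) \<le> b"
    using eventually_component_energy_le by blast
  have bounded: "\<forall>\<^sub>F \<mu> in F. \<mu> i \<in> \<E> \<and> energy (\<mu> i) (\<mu> i) \<le> b"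
    using b eventually_mass_bounded by eventually_elim (use i mass_bounded_component in blast)
  have "((\<lambda>\<mu>. energy (\<mu> i) \<xi>) \<longlongrightarrow> energy (\<gamma> i) \<xi>) F" if "\<xi> \<in> \<E>" for \<xi>
    using bounded mass_bounded_component[OF \<gamma>_mass_bounded i] that vague[OF i]
    by (rule energy_tendsto_of_vague)
  then show ?thesis
    unfolding signed_energy_charge using \<tau> by (intro tendsto_intros) auto
qed

lemma charge_total_tendsto:
  assumes i: "i \<in> I"
  shows "((\<lambda>\<mu>. \<langle>charge i (\<mu> i), total \<mu>\<rangle>) \<longlongrightarrow> \<langle>charge i (\<gamma> i), total \<gamma>\<rangle>) F"
proof -
  obtain b where b: "\<forall>\<^sub>F \<mu> in F. \<forall>i\<in>I. energy (\<mu> i) (\<mu> i) \<le> b"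
    using eventually_component_energy_le by blast
  show ?thesis
  proof (rule total_tendsto_weak_strong[OF _ charge_tendsto[OF i]])
    show "\<forall>\<^sub>F \<mu> in F. charge i (\<mu> i) \<in> \<E> \<times> \<E> \<and> \<langle>charge i (\<mu> i), charge i (\<mu> i)\<rangle> \<le> b"
      unfolding signed_energy_charge_charge
      using b eventually_mass_bounded
      by eventually_elim (use i mass_bounded_component charge_mem in blast)
  qed (rule total_mem[OF \<gamma>_mass_bounded])
qed

lemma G_\<gamma>_le_perturbation:
  assumes \<mu>: "\<mu> \<in> constrained" and i: "i \<in> I" and \<nu>: "\<nu> \<in> feasible i" and t: "0 \<le> t" "t \<le> 1"
    and b: "energy (\<mu> i) (\<mu> i) \<le> b"
  shows "G \<gamma> \<le> G \<mu> + 2 * t * (\<langle>charge i \<nu>, total \<mu>\<rangle> - \<langle>charge i (\<mu> i), total \<mu>\<rangle>)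
    + t\<^sup>2 * (energy \<nu> \<nu> + b)"
proof -
  let ?\<mu> = "\<mu>(i := mix t (\<mu> i) \<nu>)"
  have \<mu>': "?\<mu> \<in> constrained"
    using t by (intro constrained_update feasible_mix constrained_component \<mu> i \<nu>)
  have bounded: "\<mu> \<in> mass_bounded" "?\<mu> \<in> mass_bounded"
    using \<mu> \<mu>' constrained_mass_bounded by blast+
  have \<nu>\<E>: "\<nu> \<in> \<E>" using \<nu> by (simp add: feasible_def)
  have "Ginf \<kappa> Ip In A chiP chiN a g I \<le> ereal (G ?\<mu>)"
    unfolding Ginf_def using \<mu>' by (rule INF_lower)
  then have "G \<gamma> \<le> G ?\<mu>" by (simp add: Ginf_eq)
  also have "\<dots> = G \<mu> + 2 * t * (\<langle>charge i \<nu>, total \<mu>\<rangle> - \<langle>charge i (\<mu> i), total \<mu>\<rangle>)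
      + t\<^sup>2 * (energy \<nu> \<nu> - 2 * energy \<nu> (\<mu> i) + energy (\<mu> i) (\<mu> i))"
    using bounded i \<nu>\<E> t by (rule G_update_mix)
  also have "\<dots> \<le> G \<mu> + 2 * t * (\<langle>charge i \<nu>, total \<mu>\<rangle> - \<langle>charge i (\<mu> i), total \<mu>\<rangle>)
      + t\<^sup>2 * (energy \<nu> \<nu> + b)"
    using b energy_nonneg[of \<nu> "\<mu> i"] by (intro add_left_mono mult_left_mono) auto
  finally show ?thesis .
qed

theorem variational_inequality:
  assumes i: "i \<in> I" and \<nu>: "\<nu> \<in> feasible i"
  shows "intW \<kappa> Ip In chiP chiN \<gamma> i \<le> \<langle>charge i \<nu>, total \<gamma>\<rangle>"
proof -
  have \<nu>\<E>: "\<nu> \<in> \<E>" using \<nu> by (simp add: feasible_def)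
  obtain b where b: "\<forall>\<^sub>F \<mu> in F. \<forall>i\<in>I. energy (\<mu> i) (\<mu> i) \<le> b"
    using eventually_component_energy_le by blast
  define d where "d = \<langle>charge i \<nu>, total \<gamma>\<rangle> - \<langle>charge i (\<gamma> i), total \<gamma>\<rangle>"
  have "0 \<le> 2 * d + t * (energy \<nu> \<nu> + b)" if t: "0 < t" "t \<le> 1" for t
  proof -
    let ?f = "\<lambda>\<mu>. G \<mu> + 2 * t * (\<langle>charge i \<nu>, total \<mu>\<rangle> - \<langle>charge i (\<mu> i), total \<mu>\<rangle>)
      + t\<^sup>2 * (energy \<nu> \<nu> + b)"
    have "\<forall>\<^sub>F \<mu> in F. G \<gamma> \<le> ?f \<mu>"
      using eventually_constrained b
    proof eventually_elim
      case (elim \<mu>)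
      show ?case
        using elim(1) i \<nu> less_imp_le[OF t(1)] t(2) bspec[OF elim(2) i]
        by (rule G_\<gamma>_le_perturbation)
    qed
    moreover have "(?f \<longlongrightarrow> G \<gamma> + 2 * t * d + t\<^sup>2 * (energy \<nu> \<nu> + b)) F"
      unfolding d_def
    proof (intro tendsto_intros G_tendsto charge_total_tendsto i)
      show "((\<lambda>\<mu>. \<langle>charge i \<nu>, total \<mu>\<rangle>) \<longlongrightarrow> \<langle>charge i \<nu>, total \<gamma>\<rangle>) F"
        using charge_mem[OF \<nu>\<E>, of i]
        by (intro total_tendsto_weak_strong[OF _ tendsto_const] always_eventually) auto
    qed
    ultimately have "G \<gamma> \<le> G \<gamma> + 2 * t * d + t\<^sup>2 * (energy \<nu> \<nu> + b)"
      using tendsto_lowerbound F_nonbot by blast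
    then have "0 \<le> t * (2 * d + t * (energy \<nu> \<nu> + b))" by (simp add: algebra_simps power2_eq_square)
    then show ?thesis using t(1) by (simp add: zero_le_mult_iff)
  qed
  then have "0 \<le> 2 * d" by (rule nonneg_of_linear_perturbation)
  then show ?thesis by (simp add: d_def intW_eq[OF \<gamma>_mass_bounded i])
qed

lemma intW_\<gamma>_has_sum:
  "((\<lambda>i. intW \<kappa> Ip In chiP chiN \<gamma> i) has_sum
     (vnorm2 \<kappa> Ip In \<gamma> + real_of_ereal (Ginf \<kappa> Ip In A chiP chiN a g I)) / 2) I"
  using intW_has_sum[OF \<gamma>_mass_bounded] by (simp add: Ginf_eq)

lemma W_ge_nearly_everywhere:
  assumes i: "i \<in> I"
  shows "nearly_everywhere \<kappa> (A i)
    (\<lambda>x. ereal (a i) * W \<gamma> i x \<ge> ereal (intW \<kappa> Ip In chiP chiN \<gamma> i * g x))"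
proof (rule nearly_everywhereI)
  let ?\<eta> = "intW \<kappa> Ip In chiP chiN \<gamma> i"
  fix m assume m: "m \<in> Eplus \<kappa>" "concentrated m {x\<in>A i. \<not> ereal (a i) * W \<gamma> i x \<ge> ereal (?\<eta> * g x)}"
    "emeasure m UNIV = 1"
  then have m\<E>: "m \<in> \<E>" by (simp add: Eplus_def \<E>_def finite_radon_def)
  then have "AE x in m. x \<in> A i \<and> ereal (a i) * W \<gamma> i x < ereal (?\<eta> * g x)"
    using m(2) by (simp add: concentrated_iff_AE \<E>_sets not_le)
  then obtain \<nu> where \<nu>: "\<nu> \<in> feasible i" "AE x in \<nu>. ereal (a i) * W \<gamma> i x < ereal (?\<eta> * g x)"
    using exists_feasible[OF i m\<E>] m(3) by (metis zero_neq_one)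
  from charge_less_of_AE_W_less[OF i \<gamma>_mass_bounded this] variational_inequality[OF i \<nu>(1)]
  show False by simp
qed

lemma le_intW_of_nearly_everywhere:
  assumes i: "i \<in> I"
    and ne: "nearly_everywhere \<kappa> (A i) (\<lambda>x. ereal (a i) * W \<gamma> i x \<ge> ereal (\<eta> * g x))"
  shows "\<eta> \<le> intW \<kappa> Ip In chiP chiN \<gamma> i"
  unfolding intW_eq[OF \<gamma>_mass_bounded i]
proof (rule tendsto_lowerbound[OF charge_tendsto[OF i] _ F_nonbot])
  show "total \<gamma> \<in> \<E> \<times> \<E>" using \<gamma>_mass_bounded by (rule total_mem)
  have [measurable]: "g_on i \<in> borel_measurable borel" "A i \<in> sets borel"
    "W \<gamma> i \<in> borel_measurable borel"
    using g_on_measurable[OF i] borel_A[OF i] W_measurable[OF \<gamma>_mass_bounded] by auto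
  have "{x\<in>A i. \<not> ereal (a i) * W \<gamma> i x \<ge> ereal (\<eta> * g x)}
      = {x\<in>A i. \<not> ereal (a i) * W \<gamma> i x \<ge> ereal (\<eta> * g_on i x)}"
    by (auto simp: g_on_eq)
  also have "\<dots> \<in> sets borel" by measurable
  finally have exceptional: "{x\<in>A i. \<not> ereal (a i) * W \<gamma> i x \<ge> ereal (\<eta> * g x)} \<in> sets borel" .
  show "\<forall>\<^sub>F \<mu> in F. \<eta> \<le> \<langle>charge i (\<mu> i), total \<gamma>\<rangle>"
    using eventually_constrained
  proof eventually_elim
    case (elim \<mu>)
    then have \<mu>i: "\<mu> i \<in> feasible i" using i by (rule constrained_component)
    then have "AE x in \<mu> i. x \<in> A i \<and> ereal (a i) * W \<gamma> i x \<ge> ereal (\<eta> * g x)"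
      using ne exceptional by (intro nearly_everywhere_imp_AE) (auto simp: feasible_def)
    then have "AE x in \<mu> i. ereal (a i) * W \<gamma> i x \<ge> ereal (\<eta> * g x)"
      by eventually_elim simp
    with i \<gamma>_mass_bounded \<mu>i show ?case by (rule le_charge_of_AE_le_W)
  qed
qed

lemma intW_unique:
  assumes sum: "(\<eta> has_sum (vnorm2 \<kappa> Ip In \<gamma> + real_of_ereal (Ginf \<kappa> Ip In A chiP chiN a g I)) / 2) I"
    and ne: "\<And>i. i \<in> I \<Longrightarrow>
      nearly_everywhere \<kappa> (A i) (\<lambda>x. ereal (a i) * W \<gamma> i x \<ge> ereal (\<eta> i * g x))"
    and i: "i \<in> I"
  shows "\<eta> i = intW \<kappa> Ip In chiP chiN \<gamma> i"
proof -
  have le_intW: "\<eta> j \<le> intW \<kappa> Ip In chiP chiN \<gamma> j" if "j \<in> I" for j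
    using that ne[OF that] by (rule le_intW_of_nearly_everywhere)
  have "((\<lambda>j. intW \<kappa> Ip In chiP chiN \<gamma> j - \<eta> j) has_sum 0) I"
    using has_sum_diff[OF intW_\<gamma>_has_sum sum] by simp
  then have "(\<Sum>j\<in>{i}. intW \<kappa> Ip In chiP chiN \<gamma> j - \<eta> j) \<le> 0"
    using i le_intW by (intro finite_sum_le_has_sum) auto
  with le_intW[OF i] show ?thesis by simp
qed

end

lemma extremal_imp_minimizing_net:
  fixes \<kappa> :: "'a::t2_space \<Rightarrow> 'a \<Rightarrow> ennreal"
  assumes lc: "locally_compact_space (euclidean :: 'a topology)"
    and kernel: "admissible_kernel \<kappa> h" and "condenser \<kappa> Ip In A"
    and "external_field \<kappa> Ip In A chiP chiN" and g: "admissible_g \<kappa> (Ip \<union> In) A g"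
    and "\<forall>i\<in>Ip \<union> In. 0 < a i" "a summable_on (Ip \<union> In)"
    and extremal: "\<gamma> \<in> extremal \<kappa> h Ip In A chiP chiN a g (Ip \<union> In)"
  obtains c F where "minimizing_net \<kappa> h Ip In A chiP chiN g a c F \<gamma>"
proof -
  obtain c where c: "0 < c" "\<And>x. x \<in> (\<Union>i\<in>Ip \<union> In. A i) \<Longrightarrow> c \<le> g x"
    and g_continuous: "continuous_on (\<Union>i\<in>Ip \<union> In. A i) g"
    using g unfolding admissible_g_def by blast
  obtain F where F: "F \<noteq> bot"
    and constrained: "\<forall>\<^sub>F \<mu> in F. \<mu> \<in> EplusAag \<kappa> Ip In A a g (Ip \<union> In)
      \<and> (\<Sum>\<^sub>\<infinity>i\<in>Ip \<union> In. emeasure (\<mu> i) UNIV) \<le> ennreal (Hconst h (Ip \<union> In) A chiP a g (Ip \<union> In))"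
    and limits: "((\<lambda>\<mu>. ereal (Gchi \<kappa> Ip In chiP chiN \<mu>)) \<longlongrightarrow> Ginf \<kappa> Ip In A chiP chiN a g (Ip \<union> In)) F"
      "((\<lambda>\<mu>. vdist \<kappa> Ip In \<mu> \<gamma>) \<longlongrightarrow> 0) F"
      "\<forall>i\<in>Ip \<union> In. \<forall>f\<in>Cc. ((\<lambda>\<mu>. \<integral>x. f x \<partial>(\<mu> i)) \<longlongrightarrow> (\<integral>x. f x \<partial>(\<gamma> i))) F"
    and \<gamma>: "\<gamma> \<in> EplusA \<kappa> Ip In A"
    using extremal unfolding extremal_def by blast
  interpret consistent_kernel \<kappa> h
    using kernel by (rule admissible_kernel_imp_consistent_kernel)
  have "minimizing_net \<kappa> h Ip In A chiP chiN g a c F \<gamma>"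
  proof
    show "\<forall>\<^sub>F \<mu> in F. \<mu> \<in> EplusAag \<kappa> Ip In A a g (Ip \<union> In)"
      using constrained by eventually_elim simp
  qed (use assms c g_continuous F limits \<gamma> in auto)
  then show thesis by (rule that)
qed

theorem theorem12p1:
  fixes \<kappa> :: "'a::t2_space \<Rightarrow> 'a \<Rightarrow> ennreal" and h :: real
    and Ip In :: "'i set" and A :: "'i \<Rightarrow> 'a set"
    and chiP chiN :: "'a measure" and g :: "'a \<Rightarrow> real" and a :: "'i \<Rightarrow> real"
    and \<gamma> :: "'i \<Rightarrow> 'a measure"
  assumes X: "locally_compact_space (euclidean :: 'a topology)" "\<not> compact (UNIV :: 'a set)"
    and kernel: "admissible_kernel \<kappa> h"
    and cond: "condenser \<kappa> Ip In A"
    and field: "external_field \<kappa> Ip In A chiP chiN"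
    and gass: "admissible_g \<kappa> (Ip \<union> In) A g"
    and apos: "\<forall>i\<in>Ip \<union> In. a i > 0" and asum: "a summable_on (Ip \<union> In)"
    and Gfin: "Ginf \<kappa> Ip In A chiP chiN a g (Ip \<union> In) < \<infinity>"
    and ext: "\<gamma> \<in> extremal \<kappa> h Ip In A chiP chiN a g (Ip \<union> In)"
  shows "((\<lambda>i. intW \<kappa> Ip In chiP chiN \<gamma> i) has_sum
            (vnorm2 \<kappa> Ip In \<gamma> + real_of_ereal (Ginf \<kappa> Ip In A chiP chiN a g (Ip \<union> In))) / 2) (Ip \<union> In)
    \<and> (\<forall>i\<in>Ip \<union> In. nearly_everywhere \<kappa> (A i)
            (\<lambda>x. ereal (a i) * Wpot \<kappa> Ip In chiP chiN \<gamma> i x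
                   \<ge> ereal (intW \<kappa> Ip In chiP chiN \<gamma> i * g x)))
    \<and> (\<forall>\<eta> :: 'i \<Rightarrow> real.
         (\<eta> has_sum (vnorm2 \<kappa> Ip In \<gamma> + real_of_ereal (Ginf \<kappa> Ip In A chiP chiN a g (Ip \<union> In))) / 2) (Ip \<union> In)
         \<longrightarrow> (\<forall>i\<in>Ip \<union> In. nearly_everywhere \<kappa> (A i)
               (\<lambda>x. ereal (a i) * Wpot \<kappa> Ip In chiP chiN \<gamma> i x \<ge> ereal (\<eta> i * g x)))
         \<longrightarrow> (\<forall>i\<in>Ip \<union> In. \<eta> i = intW \<kappa> Ip In chiP chiN \<gamma> i))"
proof -
  obtain c F where "minimizing_net \<kappa> h Ip In A chiP chiN g a c F \<gamma>"
    using extremal_imp_minimizing_net[OF X(1) kernel cond field gass apos asum ext] .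
  then interpret minimizing_net \<kappa> h Ip In A chiP chiN g a c F \<gamma> .
  show ?thesis using intW_\<gamma>_has_sum W_ge_nearly_everywhere intW_unique by blast
qed

end
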